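(* Let $\rho>0$ with $\rho\tau\le1$. Assume that $(U^n)_{n\in\mathbb N}$ solves the leapfrog scheme with initial conditions $U^0=U^1=0$, let $u_{h\tau}:=R(U)$, $w_{h\tau}:=L(U)$ and $\delta_{h\tau}:=u_{h\tau}-w_{h\tau}$. Assume that $f\in C^3_{\rm b}(J;L^2(\Omega))$ and assume the CFL condition. Then $$\int_0^{+\infty}\|\dot\delta_{h\tau}(t)\|_\Omega^2e^{-2\rho t}dt\lesssim\frac{\tau^4}{\rho^2}\int_0^{+\infty}\|\ddot f(t)\|_\Omega^2e^{-2\rho t}dt,$$ $$\int_0^{+\infty}\|\nabla\delta_{h\tau}(t)\|_\Omega^2e^{-2\rho t}dt\lesssim\frac{\tau^4}{\rho^2}\int_0^{+\infty}\Big\{\|\ddot f(t)\|_\Omega^2+\tau^2\|f^{(3)}(t)\|_\Omega^2\Big\}e^{-2\rho t}dt,$$ $$\int_0^{+\infty}\|\nabla\dot\delta_{h\tau}(t)\|_\Omega^2e^{-2\rho t}dt\lesssim\frac{\tau^4}{\rho^2}\int_0^{+\infty}\|f^{(3)}(t)\|_\Omega^2e^{-2\rho t}dt.$$ In addition, $$\int_0^{+\infty}\|w_{h\tau}^{(3)}(t)\|_\Omega^2e^{-2\rho t}dt\lesssim\frac1{\rho^2}\int_0^{+\infty}\|\ddot f(t)\|_\Omega^2e^{-2\rho t}dt.$$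
   Context: $A\lesssim B$ means $A\le CB$ with a constant $C$ independent of the time step $\tau$, the mesh size $h$, the damping parameter $\rho$, and of any function involved in the bound (it may depend on fixed quantities such as the CFL parameter $\mu_0$). $\Omega\subset\mathbb R^d$, $d\ge1$, is an open bounded Lipschitz polyhedron, $J:=[0,+\infty)$, $V:=H^1_0(\Omega)$, $(\cdot,\cdot)_\Omega$ and $\|\cdot\|_\Omega$ are the $L^2(\Omega)$ inner product and norm (same notation for vector-valued functions). Dots (or superscripts $(r)$) denote time derivatives. $C^r_{\rm b}(J;Y):=\{v\in C^r(J;Y): v^{(r)}\in L^\infty(J;Y)\}$ for a Banach space $Y$. The source $f\in H^1(J;L^2(\Omega))\cap L^\infty(J;L^2(\Omega))$ is supported away from zero, i.e. it vanishes for $t$ in a neighborhood of $0$ in $J$. $\mathcal T_h$ is an affine simplicial mesh covering $\Omega$ exactly, and $V_h\subset V$ is the space of continuous, piecewise polynomial functions of degree at most $k\ge1$ on $\mathcal T_h$ vanishing on $\partial\Omega$. $\tau>0$ is a constant time step, $t^n:=n\tau$, $J_n:=[t^n,t^{n+1})$ for $n\in\mathbb N$ ($0\in\mathbb N$). The leapfrog scheme seeks $U=(U^n)_{n\in\mathbb N}\subset V_h$ with $\frac1{\tau^2}(U^{n+1}-2U^n+U^{n-1},v_h)_\Omega+(\nabla U^n,\nabla v_h)_\Omega=(f(t^n),v_h)_\Omega$ for all $n\ge1$, $v_h\in V_h$. CFL condition. Set $m_{h\tau}(v_h,w_h):=(v_h,w_h)_\Omega-\tau^2(\nabla v_h,\nabla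 w_h)_\Omega$ on $V_h\times V_h$. The CFL condition is $\tau\le C(\mu_0)h_{\min}$, where $h_{\min}$ is the smallest diameter of a mesh cell, $\mu_0\in(0,1)$ is fixed, and the constant $C(\mu_0)>0$ (depending on $\mu_0$ and the mesh shape-regularity) is such that $\mu_0\|v_h\|_\Omega^2\le m_{h\tau}(v_h,v_h)\le\|v_h\|_\Omega^2$ holds for all $v_h\in V_h$. Time reconstructions. Sequences are extended by zero to negative indices. For a sequence $W=(W^n)_{n\in\mathbb N}$ and $t\in J_n$, $$R(W)(t):=W^n+\frac{W^{n+1}-W^{n-1}}{2\tau}(t-t^n)+\frac{W^{n+1}-2W^n+W^{n-1}}{\tau^2}\frac12(t-t^n)^2,$$ $$L(W)(t):=\alpha^n+\beta^n(t-t^n)+\gamma^n\tfrac12(t-t^n)^2+\vartheta^n\tfrac16(t-t^n)^3+\epsilon^n\tfrac1{24}(t-t^n)^4,$$ with $\alpha^n=\frac{3W^{n+1}+17W^n+5W^{n-1}-W^{n-2}}{24}$, $\beta^n=\frac{5W^{n+1}+3W^n-9W^{n-1}+W^{n-2}}{12\tau}$, $\gamma^n=\frac{W^{n+1}-2W^n+W^{n-1}}{\tau^2}$, $\vartheta^n=\frac{W^{n+2}-2W^{n+1}+2W^{n-1}-W^{n-2}}{2\tau^3}$, $\epsilon^n=\frac{W^{n+2}-4W^{n+1}+6W^n-4W^{n-1}+W^{n-2}}{\tau^4}$. The (weak) time derivatives $\dot\delta_{h\tau}$ and $w_{h\tau}^{(3)}$ are computed locally on each $J_n$. *)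

theory Defs
  imports "HOL-Analysis.Analysis"
begin

section \<open>The space L2 on a domain\<close>

text \<open>Elements of L2 are represented by functions; every notion below depends only on their
  restriction to the domain, up to null sets.\<close>

definition in_L2 :: "'a::euclidean_space set \<Rightarrow> ('a \<Rightarrow> 'b::euclidean_space) \<Rightarrow> bool" where
  "in_L2 \<Omega> g \<longleftrightarrow> g \<in> borel_measurable (lebesgue_on \<Omega>) \<and>
     integrable (lebesgue_on \<Omega>) (\<lambda>x. (norm (g x))\<^sup>2)"

definition l2_inner ::
    "'a::euclidean_space set \<Rightarrow> ('a \<Rightarrow> 'b::euclidean_space) \<Rightarrow> ('a \<Rightarrow> 'b) \<Rightarrow> real" where
  "l2_inner \<Omega> g h = (LINT x|lebesgue_on \<Omega>. g x \<bullet> h x)"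

definition l2_norm :: "'a::euclidean_space set \<Rightarrow> ('a \<Rightarrow> 'b::euclidean_space) \<Rightarrow> real" where
  "l2_norm \<Omega> g = sqrt (l2_inner \<Omega> g g)"


section \<open>Weak gradients and the Sobolev space with vanishing trace\<close>

text \<open>\<open>test_fun \<Omega> \<phi> g\<close>: the function \<open>\<phi>\<close> is continuously differentiable with gradient \<open>g\<close> and has
  compact support in \<open>\<Omega>\<close>.  Mollification shows that infinitely differentiable test functions
  would give the same weak gradients and the same closure in H1.\<close>

definition test_fun :: "'a::euclidean_space set \<Rightarrow> ('a \<Rightarrow> real) \<Rightarrow> ('a \<Rightarrow> 'a) \<Rightarrow> bool" where
  "test_fun \<Omega> \<phi> g \<longleftrightarrow> (\<forall>x. GDERIV \<phi> x :> g x) \<and> continuous_on UNIV g \<and>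
     (\<exists>K. compact K \<and> K \<subseteq> \<Omega> \<and> (\<forall>x. x \<notin> K \<longrightarrow> \<phi> x = 0))"

definition has_weak_grad :: "'a::euclidean_space set \<Rightarrow> ('a \<Rightarrow> real) \<Rightarrow> ('a \<Rightarrow> 'a) \<Rightarrow> bool" where
  "has_weak_grad \<Omega> v G \<longleftrightarrow> in_L2 \<Omega> v \<and> in_L2 \<Omega> G \<and>
     (\<forall>\<phi> g. test_fun \<Omega> \<phi> g \<longrightarrow>
        (LINT x|lebesgue_on \<Omega>. v x *\<^sub>R g x) = - (LINT x|lebesgue_on \<Omega>. \<phi> x *\<^sub>R G x))"

text \<open>The weak gradient is determined up to null sets; one representative is chosen.\<close>

definition weak_grad :: "'a::euclidean_space set \<Rightarrow> ('a \<Rightarrow> real) \<Rightarrow> ('a \<Rightarrow> 'a)" where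
  "weak_grad \<Omega> v = (SOME G. has_weak_grad \<Omega> v G)"

definition in_H10 :: "'a::euclidean_space set \<Rightarrow> ('a \<Rightarrow> real) \<Rightarrow> bool" where
  "in_H10 \<Omega> v \<longleftrightarrow> (\<exists>G. has_weak_grad \<Omega> v G \<and>
     (\<forall>e>0. \<exists>\<phi> g. test_fun \<Omega> \<phi> g \<and>
        l2_norm \<Omega> (\<lambda>x. \<phi> x - v x) < e \<and> l2_norm \<Omega> (\<lambda>x. g x - G x) < e))"


section \<open>Domain, mesh and finite element space\<close>

text \<open>Near each boundary point, \<open>\<Omega>\<close> is the strict subgraph, in some direction \<open>\<nu>\<close>, of a Lipschitz
  function of the component of \<open>x\<close> orthogonal to \<open>\<nu>\<close>.  (A Lipschitz function on the hyperplane
  extends to the whole space, so requiring \<open>\<gamma>\<close> to be globally defined is no restriction.)\<close>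

definition lipschitz_boundary :: "'a::euclidean_space set \<Rightarrow> bool" where
  "lipschitz_boundary \<Omega> \<longleftrightarrow> (\<forall>z\<in>frontier \<Omega>. \<exists>N \<nu> L (\<gamma> :: 'a \<Rightarrow> real).
     open N \<and> z \<in> N \<and> norm \<nu> = 1 \<and> L-lipschitz_on UNIV \<gamma> \<and>
     \<Omega> \<inter> N = {x \<in> N. x \<bullet> \<nu> < \<gamma> (x - (x \<bullet> \<nu>) *\<^sub>R \<nu>)})"

definition lipschitz_polyhedron :: "'a::euclidean_space set \<Rightarrow> bool" where
  "lipschitz_polyhedron \<Omega> \<longleftrightarrow> open \<Omega> \<and> bounded \<Omega> \<and> \<Omega> \<noteq> {} \<and>
     (\<exists>P. finite P \<and> (\<forall>S\<in>P. polytope S) \<and> closure \<Omega> = \<Union>P) \<and> lipschitz_boundary \<Omega>"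

definition simplicial_mesh :: "'a::euclidean_space set \<Rightarrow> 'a set set \<Rightarrow> bool" where
  "simplicial_mesh \<Omega> T \<longleftrightarrow> triangulation T \<and> (\<forall>K\<in>T. int DIM('a) simplex K) \<and> \<Union>T = closure \<Omega>"

definition h_min :: "'a::euclidean_space set set \<Rightarrow> real" where
  "h_min T = Min (diameter ` T)"

text \<open>Polynomials of total degree at most \<open>k\<close>; multi-indices assign an exponent to each vector of
  the canonical basis.\<close>

definition poly_deg_le :: "nat \<Rightarrow> ('a::euclidean_space \<Rightarrow> real) \<Rightarrow> bool" where
  "poly_deg_le k p \<longleftrightarrow> (\<exists>(A :: ('a \<Rightarrow> nat) set) c. finite A \<and>
     (\<forall>\<alpha>\<in>A. (\<Sum>b\<in>Basis. \<alpha> b) \<le> k) \<and>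
     (\<forall>x. p x = (\<Sum>\<alpha>\<in>A. c \<alpha> * (\<Prod>b\<in>Basis. (x \<bullet> b) ^ \<alpha> b))))"

definition fe_space :: "'a::euclidean_space set \<Rightarrow> 'a set set \<Rightarrow> nat \<Rightarrow> ('a \<Rightarrow> real) set" where
  "fe_space \<Omega> T k = {v. in_H10 \<Omega> v \<and> continuous_on (closure \<Omega>) v \<and>
     (\<forall>K\<in>T. \<exists>p. poly_deg_le k p \<and> (\<forall>x\<in>K. v x = p x)) \<and> (\<forall>x\<in>frontier \<Omega>. v x = 0)}"


section \<open>CFL condition and leapfrog scheme\<close>

definition m_form ::
    "'a::euclidean_space set \<Rightarrow> real \<Rightarrow> ('a \<Rightarrow> real) \<Rightarrow> ('a \<Rightarrow> real) \<Rightarrow> real" where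
  "m_form \<Omega> \<tau> v w = l2_inner \<Omega> v w - \<tau>\<^sup>2 * l2_inner \<Omega> (weak_grad \<Omega> v) (weak_grad \<Omega> w)"

text \<open>\<open>c\<close> is an admissible constant in the CFL condition \<open>\<tau> \<le> c * h_min T\<close>: all time steps allowed
  by this condition satisfy the norm equivalence.\<close>

definition cfl_constant ::
    "'a::euclidean_space set \<Rightarrow> 'a set set \<Rightarrow> nat \<Rightarrow> real \<Rightarrow> real \<Rightarrow> bool" where
  "cfl_constant \<Omega> T k \<mu>\<^sub>0 c \<longleftrightarrow> 0 < c \<and>
     (\<forall>\<tau>. 0 < \<tau> \<and> \<tau> \<le> c * h_min T \<longrightarrow> (\<forall>v\<in>fe_space \<Omega> T k.
        \<mu>\<^sub>0 * (l2_norm \<Omega> v)\<^sup>2 \<le> m_form \<Omega> \<tau> v v \<and> m_form \<Omega> \<tau> v v \<le> (l2_norm \<Omega> v)\<^sup>2))"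

definition leapfrog_solution ::
    "'a::euclidean_space set \<Rightarrow> 'a set set \<Rightarrow> nat \<Rightarrow> real \<Rightarrow> (real \<Rightarrow> 'a \<Rightarrow> real) \<Rightarrow>
     (nat \<Rightarrow> 'a \<Rightarrow> real) \<Rightarrow> bool" where
  "leapfrog_solution \<Omega> T k \<tau> f U \<longleftrightarrow> (\<forall>n. U n \<in> fe_space \<Omega> T k) \<and>
     (\<forall>n\<ge>1. \<forall>v\<in>fe_space \<Omega> T k.
        1 / \<tau>\<^sup>2 * l2_inner \<Omega> (\<lambda>x. U (n + 1) x - 2 * U n x + U (n - 1) x) v
        + l2_inner \<Omega> (weak_grad \<Omega> (U n)) (weak_grad \<Omega> v)
        = l2_inner \<Omega> (f (real n * \<tau>)) v)"


section \<open>Time regularity of L2-valued functions on the half line\<close>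

definition has_l2_deriv ::
    "'a::euclidean_space set \<Rightarrow> (real \<Rightarrow> 'a \<Rightarrow> real) \<Rightarrow> ('a \<Rightarrow> real) \<Rightarrow> real \<Rightarrow> bool" where
  "has_l2_deriv \<Omega> f g t \<longleftrightarrow> in_L2 \<Omega> g \<and>
     ((\<lambda>s. l2_norm \<Omega> (\<lambda>x. (f s x - f t x) / (s - t) - g x)) \<longlongrightarrow> 0) (at t within {0..})"

definition l2_deriv ::
    "'a::euclidean_space set \<Rightarrow> (real \<Rightarrow> 'a \<Rightarrow> real) \<Rightarrow> real \<Rightarrow> 'a \<Rightarrow> real" where
  "l2_deriv \<Omega> f t = (SOME g. has_l2_deriv \<Omega> f g t)"

definition l2_continuous :: "'a::euclidean_space set \<Rightarrow> (real \<Rightarrow> 'a \<Rightarrow> real) \<Rightarrow> bool" where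
  "l2_continuous \<Omega> f \<longleftrightarrow> (\<forall>t\<ge>0. in_L2 \<Omega> (f t) \<and>
     ((\<lambda>s. l2_norm \<Omega> (\<lambda>x. f s x - f t x)) \<longlongrightarrow> 0) (at t within {0..}))"

definition l2_bounded :: "'a::euclidean_space set \<Rightarrow> (real \<Rightarrow> 'a \<Rightarrow> real) \<Rightarrow> bool" where
  "l2_bounded \<Omega> f \<longleftrightarrow> (\<exists>M. \<forall>t\<ge>0. l2_norm \<Omega> (f t) \<le> M)"

definition l2_Cb :: "'a::euclidean_space set \<Rightarrow> nat \<Rightarrow> (real \<Rightarrow> 'a \<Rightarrow> real) \<Rightarrow> bool" where
  "l2_Cb \<Omega> r f \<longleftrightarrow> (\<forall>j\<le>r. l2_continuous \<Omega> ((l2_deriv \<Omega> ^^ j) f)) \<and>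
     (\<forall>j<r. \<forall>t\<ge>0. has_l2_deriv \<Omega> ((l2_deriv \<Omega> ^^ j) f) ((l2_deriv \<Omega> ^^ Suc j) f t) t) \<and>
     l2_bounded \<Omega> ((l2_deriv \<Omega> ^^ r) f)"

text \<open>Membership in H1 (in time) and in L-infinity (in time), and support away from zero.  This is
  only used for \<open>f\<close> of class C1 in time, for which the weak time derivative is the classical one.\<close>

definition source_term :: "'a::euclidean_space set \<Rightarrow> (real \<Rightarrow> 'a \<Rightarrow> real) \<Rightarrow> bool" where
  "source_term \<Omega> f \<longleftrightarrow>
     (\<integral>\<^sup>+t\<in>{0..}. ennreal ((l2_norm \<Omega> (f t))\<^sup>2) \<partial>lborel) < \<infinity> \<and>
     (\<integral>\<^sup>+t\<in>{0..}. ennreal ((l2_norm \<Omega> (l2_deriv \<Omega> f t))\<^sup>2) \<partial>lborel) < \<infinity> \<and>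
     l2_bounded \<Omega> f \<and>
     (\<exists>t\<^sub>0>0. \<forall>t. 0 \<le> t \<and> t < t\<^sub>0 \<longrightarrow> (AE x in lebesgue_on \<Omega>. f t x = 0))"


section \<open>Time reconstructions\<close>

definition zero_ext :: "(nat \<Rightarrow> 'a \<Rightarrow> real) \<Rightarrow> int \<Rightarrow> 'a \<Rightarrow> real" where
  "zero_ext W n x = (if n < 0 then 0 else W (nat n) x)"

definition recR :: "real \<Rightarrow> (nat \<Rightarrow> 'a \<Rightarrow> real) \<Rightarrow> real \<Rightarrow> 'a \<Rightarrow> real" where
  "recR \<tau> W t x = (let n = \<lfloor>t / \<tau>\<rfloor>; s = t - of_int n * \<tau>; w = (\<lambda>j. zero_ext W (n + j) x) in
     w 0 + (w 1 - w (-1)) / (2 * \<tau>) * s + (w 1 - 2 * w 0 + w (-1)) / \<tau>\<^sup>2 * (1/2) * s\<^sup>2)"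

definition recL :: "real \<Rightarrow> (nat \<Rightarrow> 'a \<Rightarrow> real) \<Rightarrow> real \<Rightarrow> 'a \<Rightarrow> real" where
  "recL \<tau> W t x = (let n = \<lfloor>t / \<tau>\<rfloor>; s = t - of_int n * \<tau>; w = (\<lambda>j. zero_ext W (n + j) x);
       \<alpha> = (3 * w 1 + 17 * w 0 + 5 * w (-1) - w (-2)) / 24;
       \<beta> = (5 * w 1 + 3 * w 0 - 9 * w (-1) + w (-2)) / (12 * \<tau>);
       \<gamma> = (w 1 - 2 * w 0 + w (-1)) / \<tau>\<^sup>2;
       \<theta> = (w 2 - 2 * w 1 + 2 * w (-1) - w (-2)) / (2 * \<tau> ^ 3);
       \<epsilon> = (w 2 - 4 * w 1 + 6 * w 0 - 4 * w (-1) + w (-2)) / \<tau> ^ 4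
     in \<alpha> + \<beta> * s + \<gamma> * (1/2) * s\<^sup>2 + \<theta> * (1/6) * s ^ 3 + \<epsilon> * (1/24) * s ^ 4)"

text \<open>Time derivative taken locally on the interval \<open>[n \<tau>, (n + 1) \<tau>)\<close> that contains \<open>t\<close>.\<close>

definition local_deriv :: "real \<Rightarrow> (real \<Rightarrow> 'a \<Rightarrow> real) \<Rightarrow> real \<Rightarrow> 'a \<Rightarrow> real" where
  "local_deriv \<tau> w t x = vector_derivative (\<lambda>s. w s x)
     (at t within {of_int \<lfloor>t / \<tau>\<rfloor> * \<tau> ..< (of_int \<lfloor>t / \<tau>\<rfloor> + 1) * \<tau>})"

text \<open>The integral of \<open>g t * exp (- 2 * \<rho> * t)\<close> over the half line, for nonnegative \<open>g\<close>; it is taken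
  in \<open>ennreal\<close>, so that it is meaningful without an integrability assumption.\<close>

definition damped_integral :: "real \<Rightarrow> (real \<Rightarrow> real) \<Rightarrow> ennreal" where
  "damped_integral \<rho> g = (\<integral>\<^sup>+t\<in>{0..}. ennreal (g t * exp (- 2 * \<rho> * t)) \<partial>lborel)"

end

theory Submission
  imports Defs
begin

text \<open>The mechanism is that the leapfrog scheme is linear with constant coefficients in time, so that
every forward difference quotient of the solution, extended by zero to negative indices, solves the
scheme again, with the corresponding difference quotient of the source as right-hand side
(\<open>dquot_scheme\<close>).  The extension by zero is harmless because \<open>U 0\<close> and \<open>U 1\<close> vanish and the source
vanishes for small times (\<open>leapfrog_solution_extended\<close>).

On one time slab, \<open>u - w\<close> is a combination, with coefficients of size at most \<open>\<tau>\<^sup>2\<close>, of three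
consecutive second difference quotients of the solution; its time derivative is a combination of the
same size of two third difference quotients, and the third derivative of \<open>w\<close> is a combination of
these with coefficients of order one (\<open>recR_minus_recL\<close>, \<open>local_deriv_defect\<close>,
\<open>local_deriv_3_recL\<close>).  All four estimates thus reduce to bounds on exponentially weighted sums of
the norms of third difference quotients and of the gradients of second and third ones.

Such bounds come from the discrete energy
\<open>E\<^sub>n = \<parallel>(Y\<^sub>n\<^sub>+\<^sub>1 - Y\<^sub>n) / \<tau>\<parallel>\<^sup>2 + (\<nabla>Y\<^sub>n\<^sub>+\<^sub>1, \<nabla>Y\<^sub>n)\<close> of a solution \<open>Y\<close> of the scheme.  The CFL condition enters
as \<open>\<tau>\<^sup>2 \<parallel>\<nabla>v\<parallel>\<^sup>2 \<le> \<parallel>v\<parallel>\<^sup>2\<close> on the discrete space; it makes the energy control both the discrete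
velocity and \<open>\<nabla>Y\<^sub>n\<close>.  Summing the energy identity against \<open>exp (- 2 \<rho> n \<tau>)\<close> and absorbing the
velocity with Young's inequality costs a factor \<open>1 / \<rho>\<^sup>2\<close> (\<open>damped_energy_sum\<close>,
\<open>leapfrog_energy_estimate\<close>).  The velocity of the second difference quotient is the third difference
quotient, so that the norms of the latter are paid for by \<open>f''\<close>; the gradients of the second and
third difference quotients are paid for by \<open>f''\<close> and by the
third derivative of \<open>f\<close> respectively.

Finally, the \<open>r\<close>-th difference quotient of the source over a window of length \<open>r \<tau>\<close> is bounded by
\<open>r\<close> times the mean over this window of the norm of its \<open>r\<close>-th derivative
(\<open>l2_norm_dquot_le_integral\<close>), and summing over overlapping windows gives the damped integral
(\<open>damped_window_sum\<close>).

The bilinear form is defined through chosen representatives of weak gradients.  It is bilinear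
because weak gradients are unique up to null sets, which is the fundamental lemma of the calculus of
variations (\<open>fundamental_lemma_AE\<close>).\<close>

section \<open>Square-integrable functions\<close>

lemma in_L2_inner_integrable:
  assumes "in_L2 \<Omega> g" "in_L2 \<Omega> h"
  shows "integrable (lebesgue_on \<Omega>) (\<lambda>x. g x \<bullet> h x)"
proof (rule Bochner_Integration.integrable_bound)
  show "integrable (lebesgue_on \<Omega>) (\<lambda>x. (norm (g x))\<^sup>2 + (norm (h x))\<^sup>2)"
    using assms unfolding in_L2_def by auto
  show "(\<lambda>x. g x \<bullet> h x) \<in> borel_measurable (lebesgue_on \<Omega>)"
    using assms unfolding in_L2_def by auto
  have "norm (g x \<bullet> h x) \<le> norm ((norm (g x))\<^sup>2 + (norm (h x))\<^sup>2)" for x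
  proof -
    have "\<bar>g x \<bullet> h x\<bar> \<le> norm (g x) * norm (h x)"
      by (rule Cauchy_Schwarz_ineq2)
    also have "\<dots> \<le> (norm (g x))\<^sup>2 + (norm (h x))\<^sup>2"
      using sum_squares_bound[of "norm (g x)" "norm (h x)"]
        mult_nonneg_nonneg[OF norm_ge_zero[of "g x"] norm_ge_zero[of "h x"]] by linarith
    finally show ?thesis by simp
  qed
  then show "AE x in lebesgue_on \<Omega>. norm (g x \<bullet> h x) \<le> norm ((norm (g x))\<^sup>2 + (norm (h x))\<^sup>2)"
    by simp
qed

lemma in_L2_scaleR_integrable:
  fixes v :: "'a::euclidean_space \<Rightarrow> real"
  assumes "in_L2 \<Omega> v" "in_L2 \<Omega> g"
  shows "integrable (lebesgue_on \<Omega>) (\<lambda>x. v x *\<^sub>R g x)"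
proof (rule Bochner_Integration.integrable_bound)
  show "integrable (lebesgue_on \<Omega>) (\<lambda>x. (norm (v x))\<^sup>2 + (norm (g x))\<^sup>2)"
    using assms unfolding in_L2_def by (intro Bochner_Integration.integrable_add) blast+
  show "(\<lambda>x. v x *\<^sub>R g x) \<in> borel_measurable (lebesgue_on \<Omega>)"
    using assms unfolding in_L2_def by auto
  have "norm (v x *\<^sub>R g x) \<le> norm ((norm (v x))\<^sup>2 + (norm (g x))\<^sup>2)" for x
  proof -
    have "norm (v x) * norm (g x) \<le> (norm (v x))\<^sup>2 + (norm (g x))\<^sup>2"
      using sum_squares_bound[of "norm (v x)" "norm (g x)"]
        mult_nonneg_nonneg[OF norm_ge_zero[of "v x"] norm_ge_zero[of "g x"]] by linarith
    then show ?thesis by simp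
  qed
  then show "AE x in lebesgue_on \<Omega>. norm (v x *\<^sub>R g x) \<le> norm ((norm (v x))\<^sup>2 + (norm (g x))\<^sup>2)"
    by simp
qed

lemma in_L2_lincomb:
  assumes "in_L2 \<Omega> g" "in_L2 \<Omega> h"
  shows "in_L2 \<Omega> (\<lambda>x. c *\<^sub>R g x + d *\<^sub>R h x)"
proof -
  have "(norm (c *\<^sub>R g x + d *\<^sub>R h x))\<^sup>2
      = c\<^sup>2 * (norm (g x))\<^sup>2 + 2 * c * d * (g x \<bullet> h x) + d\<^sup>2 * (norm (h x))\<^sup>2" for x
    unfolding power2_norm_eq_inner
    by (simp add: inner_add_left inner_add_right power2_eq_square inner_commute algebra_simps)
  moreover have "(\<lambda>x. c *\<^sub>R g x + d *\<^sub>R h x) \<in> borel_measurable (lebesgue_on \<Omega>)"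
    using assms unfolding in_L2_def by (intro borel_measurable_add borel_measurable_scaleR) auto
  ultimately show ?thesis
    using assms in_L2_inner_integrable[OF assms] unfolding in_L2_def by simp
qed

lemma in_L2_zero: "in_L2 \<Omega> (\<lambda>x. 0)"
  unfolding in_L2_def by simp

lemma in_L2_diff:
  assumes "in_L2 \<Omega> g" "in_L2 \<Omega> h"
  shows "in_L2 \<Omega> (\<lambda>x. g x - h x)"
  using in_L2_lincomb[OF assms, of 1 "-1"] by simp

lemma l2_inner_commute: "l2_inner \<Omega> g h = l2_inner \<Omega> h g"
  unfolding l2_inner_def by (simp add: inner_commute)

lemma l2_inner_lincomb_left:
  assumes "in_L2 \<Omega> g" "in_L2 \<Omega> h" "in_L2 \<Omega> w"
  shows "l2_inner \<Omega> (\<lambda>x. c *\<^sub>R g x + d *\<^sub>R h x) w = c * l2_inner \<Omega> g w + d * l2_inner \<Omega> h w"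
proof -
  have "l2_inner \<Omega> (\<lambda>x. c *\<^sub>R g x + d *\<^sub>R h x) w
      = (LINT x|lebesgue_on \<Omega>. c * (g x \<bullet> w x) + d * (h x \<bullet> w x))"
    unfolding l2_inner_def by (simp add: inner_add_left)
  also have "\<dots> = c * l2_inner \<Omega> g w + d * l2_inner \<Omega> h w"
    unfolding l2_inner_def using assms by (simp add: in_L2_inner_integrable)
  finally show ?thesis .
qed

lemma l2_inner_lincomb_right:
  assumes "in_L2 \<Omega> g" "in_L2 \<Omega> h" "in_L2 \<Omega> w"
  shows "l2_inner \<Omega> w (\<lambda>x. c *\<^sub>R g x + d *\<^sub>R h x) = c * l2_inner \<Omega> w g + d * l2_inner \<Omega> w h"
  using l2_inner_lincomb_left[OF assms] by (simp add: l2_inner_commute)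

lemma l2_inner_cong_AE:
  assumes "AE x in lebesgue_on \<Omega>. g x = g' x" "AE x in lebesgue_on \<Omega>. h x = h' x"
    and "in_L2 \<Omega> g" "in_L2 \<Omega> g'" "in_L2 \<Omega> h" "in_L2 \<Omega> h'"
  shows "l2_inner \<Omega> g h = l2_inner \<Omega> g' h'"
  unfolding l2_inner_def
proof (rule integral_cong_AE)
  show "AE x in lebesgue_on \<Omega>. g x \<bullet> h x = g' x \<bullet> h' x"
    using assms(1,2) by eventually_elim simp
qed (use assms in \<open>auto simp: in_L2_def\<close>)

lemma l2_inner_self_nonneg: "0 \<le> l2_inner \<Omega> g g"
  unfolding l2_inner_def by simp

lemma l2_norm_nonneg: "0 \<le> l2_norm \<Omega> g"
  unfolding l2_norm_def by (simp add: l2_inner_self_nonneg)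

lemma l2_norm_power2: "(l2_norm \<Omega> g)\<^sup>2 = l2_inner \<Omega> g g"
  unfolding l2_norm_def by (simp add: l2_inner_self_nonneg)

lemma l2_norm_zero: "l2_norm \<Omega> (\<lambda>x. 0) = 0"
  unfolding l2_norm_def l2_inner_def by simp

lemma l2_norm_lincomb_power2:
  assumes "in_L2 \<Omega> g" "in_L2 \<Omega> h"
  shows "(l2_norm \<Omega> (\<lambda>x. c *\<^sub>R g x + d *\<^sub>R h x))\<^sup>2
    = c\<^sup>2 * (l2_norm \<Omega> g)\<^sup>2 + 2 * c * d * l2_inner \<Omega> g h + d\<^sup>2 * (l2_norm \<Omega> h)\<^sup>2"
  unfolding l2_norm_power2 power2_eq_square[of c] power2_eq_square[of d] using assms
  by (simp add: l2_inner_lincomb_left l2_inner_lincomb_right in_L2_lincomb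
      l2_inner_commute[of _ h g] algebra_simps)

lemma l2_Cauchy_Schwarz:
  assumes "in_L2 \<Omega> g" "in_L2 \<Omega> h"
  shows "\<bar>l2_inner \<Omega> g h\<bar> \<le> l2_norm \<Omega> g * l2_norm \<Omega> h"
proof -
  define A B C where "A = (l2_norm \<Omega> g)\<^sup>2" and "B = (l2_norm \<Omega> h)\<^sup>2" and "C = l2_inner \<Omega> g h"
  have q: "0 \<le> c\<^sup>2 * A + 2 * c * d * C + d\<^sup>2 * B" for c d
    using l2_norm_lincomb_power2[OF assms, of c d] unfolding A_def B_def C_def
    by (metis zero_le_power2)
  have "C\<^sup>2 \<le> A * B"
  proof (cases "B = 0")
    case False
    then have "B > 0" unfolding B_def by (simp add: le_less)
    have "B * (C\<^sup>2) \<le> B * (A * B)"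
      using q[of B "- C"] by (simp add: power2_eq_square algebra_simps)
    then show ?thesis using \<open>B > 0\<close> by simp
  next
    case True
    have "C = 0"
    proof (rule ccontr)
      assume "C \<noteq> 0"
      have "0 \<le> A + 2 * (-(A + 1) / (2 * C)) * C"
        using q[of 1 "-(A + 1) / (2 * C)"] True by simp
      also have "\<dots> = - 1" using \<open>C \<noteq> 0\<close> by (simp add: field_simps)
      finally show False by simp
    qed
    then show ?thesis using True by simp
  qed
  then have "\<bar>C\<bar> \<le> sqrt (A * B)" by (metis real_sqrt_abs real_sqrt_le_iff)
  then show ?thesis
    unfolding A_def B_def C_def by (simp add: real_sqrt_mult l2_norm_nonneg)
qed

lemma l2_norm_lincomb_le:
  assumes "in_L2 \<Omega> g" "in_L2 \<Omega> h"
  shows "l2_norm \<Omega> (\<lambda>x. c *\<^sub>R g x + d *\<^sub>R h x) \<le> \<bar>c\<bar> * l2_norm \<Omega> g + \<bar>d\<bar> * l2_norm \<Omega> h"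
proof (rule power2_le_imp_le)
  have "c * d * l2_inner \<Omega> g h \<le> \<bar>c * d\<bar> * \<bar>l2_inner \<Omega> g h\<bar>"
    by (metis abs_ge_self abs_mult)
  also have "\<dots> \<le> \<bar>c * d\<bar> * (l2_norm \<Omega> g * l2_norm \<Omega> h)"
    by (intro mult_left_mono l2_Cauchy_Schwarz assms) auto
  finally show "(l2_norm \<Omega> (\<lambda>x. c *\<^sub>R g x + d *\<^sub>R h x))\<^sup>2
      \<le> (\<bar>c\<bar> * l2_norm \<Omega> g + \<bar>d\<bar> * l2_norm \<Omega> h)\<^sup>2"
    unfolding l2_norm_lincomb_power2[OF assms]
    by (simp add: power2_sum power_mult_distrib abs_mult algebra_simps)
  show "0 \<le> \<bar>c\<bar> * l2_norm \<Omega> g + \<bar>d\<bar> * l2_norm \<Omega> h"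
    by (simp add: l2_norm_nonneg)
qed

lemma l2_norm_cong_AE:
  assumes "AE x in lebesgue_on \<Omega>. g x = h x" "in_L2 \<Omega> g" "in_L2 \<Omega> h"
  shows "l2_norm \<Omega> g = l2_norm \<Omega> h"
  unfolding l2_norm_def using l2_inner_cong_AE[OF assms(1) assms(1)] assms(2,3) by simp

lemma l2_norm_eq_0_AE:
  assumes "AE x in lebesgue_on \<Omega>. g x = 0" "in_L2 \<Omega> g"
  shows "l2_norm \<Omega> g = 0"
  using l2_norm_cong_AE[OF assms in_L2_zero] by (simp add: l2_norm_zero)

section \<open>Uniqueness and linearity of the weak gradient\<close>

lemma in_L2_continuous_bounded:
  fixes g :: "'a::euclidean_space \<Rightarrow> 'b::euclidean_space"
  assumes "open \<Omega>" "bounded \<Omega>" "continuous_on UNIV g"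
  shows "in_L2 \<Omega> g"
proof -
  have meas: "g \<in> borel_measurable (lebesgue_on \<Omega>)"
    using assms(1,3)
    by (intro continuous_imp_measurable_on_sets_lebesgue)
      (auto intro: continuous_on_subset lmeasurable_open fmeasurableD borel_open)
  have "compact (g ` closure \<Omega>)"
    using assms by (intro compact_continuous_image) (auto intro: continuous_on_subset)
  then have "bounded (g ` closure \<Omega>)" by (rule compact_imp_bounded)
  then obtain M where "\<forall>y\<in>g ` closure \<Omega>. norm y \<le> M" unfolding bounded_iff by blast
  then have M: "norm (g x) \<le> M" if "x \<in> \<Omega>" for x
    using that closure_subset by blast
  have fin: "finite_measure (lebesgue_on \<Omega>)"
    using assms(1,2) by (intro finite_measure_lebesgue_on lmeasurable_open) auto
  have "integrable (lebesgue_on \<Omega>) (\<lambda>x. (norm (g x))\<^sup>2)"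
  proof (rule finite_measure.integrable_const_bound[OF fin, where B = "M\<^sup>2"])
    show "AE x in lebesgue_on \<Omega>. norm ((norm (g x))\<^sup>2) \<le> M\<^sup>2"
      using M by (intro AE_I2) (auto intro!: power_mono)
  qed (use meas in auto)
  with meas show ?thesis unfolding in_L2_def by simp
qed

lemma test_fun_in_L2:
  assumes "open \<Omega>" "bounded \<Omega>" "test_fun \<Omega> \<phi> g"
  shows "in_L2 \<Omega> \<phi>" "in_L2 \<Omega> g"
proof -
  have "continuous_on UNIV \<phi>"
    using assms(3) unfolding test_fun_def gderiv_def
    by (meson continuous_at_imp_continuous_on has_derivative_continuous)
  then show "in_L2 \<Omega> \<phi>" by (rule in_L2_continuous_bounded[OF assms(1,2)])
  show "in_L2 \<Omega> g"
    using assms(3) unfolding test_fun_def by (intro in_L2_continuous_bounded[OF assms(1,2)]) simp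
qed

lemma test_fun_lincomb:
  assumes "test_fun \<Omega> \<phi> g" "test_fun \<Omega> \<psi> h"
  shows "test_fun \<Omega> (\<lambda>x. c *\<^sub>R \<phi> x + d *\<^sub>R \<psi> x) (\<lambda>x. c *\<^sub>R g x + d *\<^sub>R h x)"
proof -
  obtain K where K: "compact K" "K \<subseteq> \<Omega>" "\<And>x. x \<notin> K \<Longrightarrow> \<phi> x = 0"
    using assms(1) unfolding test_fun_def by blast
  obtain L where L: "compact L" "L \<subseteq> \<Omega>" "\<And>x. x \<notin> L \<Longrightarrow> \<psi> x = 0"
    using assms(2) unfolding test_fun_def by blast
  have "compact (K \<union> L) \<and> K \<union> L \<subseteq> \<Omega> \<and> (\<forall>x. x \<notin> K \<union> L \<longrightarrow> c *\<^sub>R \<phi> x + d *\<^sub>R \<psi> x = 0)"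
    using K L by (auto intro: compact_Un)
  moreover have "GDERIV (\<lambda>x. c *\<^sub>R \<phi> x + d *\<^sub>R \<psi> x) x :> c *\<^sub>R g x + d *\<^sub>R h x" for x
    using assms unfolding test_fun_def gderiv_def
    by (auto intro!: derivative_eq_intros simp: inner_add_right)
  moreover have "continuous_on UNIV (\<lambda>x. c *\<^sub>R g x + d *\<^sub>R h x)"
    using assms unfolding test_fun_def by (auto intro!: continuous_intros)
  ultimately show ?thesis unfolding test_fun_def by blast
qed

text \<open>Smooth approximations from below of the indicator function of a box.  The function \<open>P\<close> is a product
of squared truncated distances to the faces, hence continuously differentiable and positive exactly
inside the box; then \<open>m P / (1 + m P)\<close> increases to the indicator function.\<close>

lemma test_fun_box:
  fixes a b :: "'a::euclidean_space"
  assumes "cbox a b \<subseteq> \<Omega>"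
  shows "\<exists>(P :: 'a \<Rightarrow> real) (g :: nat \<Rightarrow> 'a \<Rightarrow> 'a).
    (\<forall>m. test_fun \<Omega> (\<lambda>x. m * P x / (1 + m * P x)) (g m)) \<and>
    (\<forall>x\<in>box a b. P x > 0) \<and> (\<forall>x. x \<notin> box a b \<longrightarrow> P x = 0)"
proof -
  define q where "q = (\<lambda>s::real. (max 0 s)\<^sup>2)"
  have dq: "(q has_real_derivative 2 * max 0 s) (at s)" for s
  proof -
    consider "s < 0" | "s = 0" | "s > 0" by linarith
    then show ?thesis
    proof cases
      case 1
      have "((\<lambda>s. 0) has_real_derivative 0) (at s)" by simp
      then have "(q has_real_derivative 0) (at s)"
        by (rule has_field_derivative_transform_within_open[where S = "{..<0}"]) (use 1 in \<open>auto simp: q_def\<close>)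
      with 1 show ?thesis by simp
    next
      case 3
      have "((\<lambda>s. s\<^sup>2) has_real_derivative 2 * s) (at s)"
        by (auto intro!: derivative_eq_intros)
      then have "(q has_real_derivative 2 * s) (at s)"
        by (rule has_field_derivative_transform_within_open[where S = "{0<..}"]) (use 3 in \<open>auto simp: q_def\<close>)
      with 3 show ?thesis by simp
    next
      case 2
      have "((\<lambda>h. q h / h) \<longlongrightarrow> 0) (at 0)"
      proof (rule Lim_null_comparison)
        show "\<forall>\<^sub>F h in at 0. norm (q h / h) \<le> \<bar>h\<bar>"
          by (auto simp: eventually_at_filter q_def power2_eq_square max_def intro!: always_eventually)
        show "((\<lambda>h::real. \<bar>h\<bar>) \<longlongrightarrow> 0) (at 0)" by (auto intro!: tendsto_eq_intros)
      qed
      then show ?thesis using 2 unfolding DERIV_def by (simp add: q_def)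
    qed
  qed
  define F where "F = (\<lambda>i x. q ((x - a) \<bullet> i) * q ((b - x) \<bullet> i))"
  define F' where "F' = (\<lambda>i x. (q ((x - a) \<bullet> i) * - (2 * max 0 ((b - x) \<bullet> i))
     + q ((b - x) \<bullet> i) * (2 * max 0 ((x - a) \<bullet> i))) *\<^sub>R i)"
  define P where "P = (\<lambda>x. \<Prod>i\<in>Basis. F i x)"
  define P' where "P' = (\<lambda>x. \<Sum>i\<in>Basis. (\<Prod>j\<in>Basis - {i}. F j x) *\<^sub>R F' i x)"
  have dF: "(F i has_derivative (\<lambda>h. h \<bullet> F' i x)) (at x)" for i x
  proof -
    note dq' = dq[unfolded has_field_derivative_def]
    have "((\<lambda>x. q ((x - a) \<bullet> i)) has_derivative (\<lambda>h. 2 * max 0 ((x - a) \<bullet> i) * (h \<bullet> i))) (at x)"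
      by (rule has_derivative_compose[of "\<lambda>x. (x - a) \<bullet> i", OF _ dq'])
        (auto intro!: derivative_eq_intros)
    moreover have "((\<lambda>x. q ((b - x) \<bullet> i)) has_derivative (\<lambda>h. 2 * max 0 ((b - x) \<bullet> i) * (- h \<bullet> i))) (at x)"
      by (rule has_derivative_compose[of "\<lambda>x. (b - x) \<bullet> i", OF _ dq'])
        (auto intro!: derivative_eq_intros)
    ultimately show ?thesis
      unfolding F_def F'_def
      by (rule has_derivative_eq_rhs[OF has_derivative_mult]) (auto simp: fun_eq_iff algebra_simps)
  qed
  have dP: "(P has_derivative (\<lambda>h. h \<bullet> P' x)) (at x)" for x
    unfolding P_def P'_def
    by (rule has_derivative_eq_rhs[OF has_derivative_prod[OF dF]])
      (auto simp: fun_eq_iff inner_sum_right mult.commute)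
  have cq: "continuous_on UNIV q" unfolding q_def by (intro continuous_intros)
  have cqc: "continuous_on UNIV (\<lambda>x. q (u x))" if "continuous_on UNIV u" for u :: "'a \<Rightarrow> real"
    by (rule continuous_on_compose2[OF cq that]) auto
  have cF: "continuous_on UNIV (F i)" for i
    unfolding F_def by (intro continuous_intros cqc)
  have cF': "continuous_on UNIV (F' i)" for i
    unfolding F'_def by (intro continuous_intros cqc)
  have cP: "continuous_on UNIV P"
    unfolding P_def by (intro continuous_intros cF)
  have cP': "continuous_on UNIV P'"
    unfolding P'_def by (intro continuous_intros cF cF')
  have pos: "P x > 0" if "x \<in> box a b" for x
    unfolding P_def F_def q_def
    by (rule prod_pos) (use that in \<open>auto simp: mem_box inner_diff_left\<close>)
  have zero: "P x = 0" if "x \<notin> box a b" for x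
  proof -
    from that obtain i where i: "i \<in> Basis" "\<not> (a \<bullet> i < x \<bullet> i \<and> x \<bullet> i < b \<bullet> i)"
      unfolding mem_box by blast
    then have "F i x = 0" unfolding F_def q_def by (auto simp: inner_diff_left max_def)
    with i(1) show ?thesis unfolding P_def by (intro prod_zero) auto
  qed
  have nn: "P x \<ge> 0" for x using pos[of x] zero[of x] by (cases "x \<in> box a b") auto
  define g where "g = (\<lambda>(m::nat) x. (m / (1 + m * P x)\<^sup>2) *\<^sub>R P' x)"
  have "test_fun \<Omega> (\<lambda>x. m * P x / (1 + m * P x)) (g m)" for m :: nat
    unfolding test_fun_def
  proof (intro conjI allI)
    fix x
    have p: "1 + m * P x > 0" using nn[of x] by (simp add: add_pos_nonneg)
    have "((\<lambda>r. m * r / (1 + m * r)) has_real_derivative m / (1 + m * P x)\<^sup>2) (at (P x))"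
      using p by (auto intro!: derivative_eq_intros simp: power2_eq_square algebra_simps)
    with dP[of x] show "GDERIV (\<lambda>x. m * P x / (1 + m * P x)) x :> g m x"
      unfolding g_def gderiv_def[of P, symmetric] by (rule GDERIV_DERIV_compose)
  next
    have p: "1 + m * P x \<noteq> 0" for x using nn[of x] add_pos_nonneg[of 1 "m * P x"] by simp
    show "continuous_on UNIV (g m)"
      unfolding g_def by (intro continuous_intros cP cP') (use p in auto)
    show "\<exists>K. compact K \<and> K \<subseteq> \<Omega> \<and> (\<forall>x. x \<notin> K \<longrightarrow> m * P x / (1 + m * P x) = 0)"
      by (rule exI[of _ "cbox a b"])
        (use assms zero box_subset_cbox[of a b] in auto)
  qed
  then show ?thesis using pos zero by blast
qed


lemma in_L2_integrable:
  assumes "open \<Omega>" "bounded \<Omega>" "in_L2 \<Omega> G"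
  shows "integrable (lebesgue_on \<Omega>) G"
proof -
  have "in_L2 \<Omega> (\<lambda>x. 1::real)"
    by (rule in_L2_continuous_bounded[OF assms(1,2)]) simp
  from in_L2_scaleR_integrable[OF this assms(3)] show ?thesis by simp
qed

text \<open>Testing with the functions of \<open>test_fun_box\<close> and passing to the limit by dominated convergence.\<close>

lemma fundamental_lemma_box:
  fixes a b :: "'a::euclidean_space" and G :: "'a \<Rightarrow> 'a"
  assumes "open \<Omega>" "bounded \<Omega>" "in_L2 \<Omega> G"
    and test: "\<And>\<phi> g. test_fun \<Omega> \<phi> g \<Longrightarrow> (LINT x|lebesgue_on \<Omega>. \<phi> x *\<^sub>R G x) = 0"
    and ab: "cbox a b \<subseteq> \<Omega>"
  shows "integral (cbox a b) G = 0"
proof -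
  obtain P :: "'a \<Rightarrow> real" and g :: "nat \<Rightarrow> 'a \<Rightarrow> 'a" where tf: "\<And>m::nat. test_fun \<Omega> (\<lambda>x. m * P x / (1 + m * P x)) (g m)"
    and pos: "\<And>x. x \<in> box a b \<Longrightarrow> P x > 0" and zero: "\<And>x. x \<notin> box a b \<Longrightarrow> P x = 0"
    using test_fun_box[OF ab] by blast
  have G: "integrable (lebesgue_on \<Omega>) G" by (rule in_L2_integrable[OF assms(1-3)])
  have nn: "P x \<ge> 0" for x using pos[of x] zero[of x] by (cases "x \<in> box a b") auto
  have box_meas: "box a b \<inter> \<Omega> \<in> sets (lebesgue_on \<Omega>)"
    using assms(1) by (intro sets_restrict_space_iff[THEN iffD2]) auto
  let ?I = "\<lambda>x. if x \<in> box a b then G x else 0"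
  have Gm: "G \<in> borel_measurable (lebesgue_on \<Omega>)"
    using assms(3) unfolding in_L2_def by simp
  have Im: "?I \<in> borel_measurable (lebesgue_on \<Omega>)"
    by (rule measurable_If_set[OF Gm]) (use box_meas in \<open>auto simp: Int_commute\<close>)
  have lim: "(\<lambda>m. LINT x|lebesgue_on \<Omega>. (real m * P x / (1 + real m * P x)) *\<^sub>R G x)
      \<longlonglongrightarrow> (LINT x|lebesgue_on \<Omega>. ?I x)"
  proof (rule integral_dominated_convergence)
    show "integrable (lebesgue_on \<Omega>) (\<lambda>x. norm (G x))" using G by simp
    show "(\<lambda>x. (real m * P x / (1 + real m * P x)) *\<^sub>R G x) \<in> borel_measurable (lebesgue_on \<Omega>)" for m
      using in_L2_scaleR_integrable[OF test_fun_in_L2(1)[OF assms(1,2) tf[of m]] assms(3)]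
      by (rule borel_measurable_integrable)
    have "norm ((real m * P x / (1 + real m * P x)) *\<^sub>R G x) \<le> norm (G x)" for m x
    proof -
      have "\<bar>real m * P x / (1 + real m * P x)\<bar> \<le> 1"
        using nn[of x] add_pos_nonneg[of 1 "real m * P x"] by (simp add: divide_simps)
      then have "\<bar>real m * P x / (1 + real m * P x)\<bar> * norm (G x) \<le> 1 * norm (G x)"
        by (rule mult_right_mono) simp
      then show ?thesis by (simp only: norm_scaleR mult_1)
    qed
    then show "AE x in lebesgue_on \<Omega>. norm ((real m * P x / (1 + real m * P x)) *\<^sub>R G x) \<le> norm (G x)" for m
      by simp
    have "(\<lambda>m. (real m * P x / (1 + real m * P x)) *\<^sub>R G x) \<longlonglongrightarrow> ?I x" for x
    proof (cases "x \<in> box a b")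
      case True
      then have p: "P x > 0" by (rule pos)
      have "(\<lambda>m. 1 - inverse (1 + real m * P x)) \<longlonglongrightarrow> 1 - 0"
        by (intro tendsto_intros tendsto_inverse_0_at_top
            filterlim_tendsto_add_at_top[OF tendsto_const]
            filterlim_at_top_mult_tendsto_pos[OF tendsto_const p] filterlim_real_sequentially)
      moreover have "1 - inverse (1 + real m * P x) = real m * P x / (1 + real m * P x)" for m
        using add_pos_nonneg[of 1 "real m * P x"] p by (simp add: field_simps)
      ultimately have "(\<lambda>m. real m * P x / (1 + real m * P x)) \<longlonglongrightarrow> 1" by simp
      then have "(\<lambda>m. (real m * P x / (1 + real m * P x)) *\<^sub>R G x) \<longlonglongrightarrow> 1 *\<^sub>R G x"
        by (intro tendsto_intros)
      with True show ?thesis by simp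
    qed (simp add: zero)
    then show "AE x in lebesgue_on \<Omega>. (\<lambda>m. (real m * P x / (1 + real m * P x)) *\<^sub>R G x) \<longlonglongrightarrow> ?I x"
      by simp
  qed (rule Im)
  have "(LINT x|lebesgue_on \<Omega>. (real m * P x / (1 + real m * P x)) *\<^sub>R G x) = 0" for m
    by (rule test[OF tf])
  then have z: "(LINT x|lebesgue_on \<Omega>. ?I x) = 0"
    using lim by (simp only: LIMSEQ_const_iff)
  have "integrable (lebesgue_on \<Omega>) ?I"
    by (rule Bochner_Integration.integrable_bound[OF G Im]) auto
  then have "integral \<Omega> ?I = 0"
    using z assms(1) by (subst (asm) lebesgue_integral_eq_integral) auto
  moreover have "box a b \<inter> \<Omega> = box a b" using ab box_subset_cbox by blast
  ultimately have "integral (box a b) G = 0"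
    by (simp add: integral_restrict_Int Int_commute)
  then show ?thesis by (simp add: integral_open_interval)
qed

text \<open>The integrals over all small cubes vanish, so the function vanishes at its Lebesgue points.\<close>

lemma fundamental_lemma_AE:
  fixes G :: "'a::euclidean_space \<Rightarrow> 'a"
  assumes "open \<Omega>" "bounded \<Omega>" "in_L2 \<Omega> G"
    and test: "\<And>\<phi> g. test_fun \<Omega> \<phi> g \<Longrightarrow> (LINT x|lebesgue_on \<Omega>. \<phi> x *\<^sub>R G x) = 0"
  shows "AE x in lebesgue_on \<Omega>. G x = 0"
proof -
  define F where "F = (\<lambda>x. if x \<in> \<Omega> then G x else 0)"
  have \<Omega>m: "\<Omega> \<in> sets lebesgue" using assms(1) by simp
  have "G absolutely_integrable_on \<Omega>"
    using in_L2_integrable[OF assms(1-3)] \<Omega>m by (simp add: integrable_restrict_space set_integrable_def)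
  then have "F absolutely_integrable_on UNIV"
    unfolding F_def by (simp add: absolutely_integrable_restrict_UNIV)
  then have "F absolutely_integrable_on cbox a b" for a b
    by (rule set_integrable_subset) auto
  then have "F integrable_on cbox a b" for a b
    by (simp add: set_lebesgue_integral_eq_integral(1))
  then obtain N where N: "negligible N" and lim: "\<And>x e. \<lbrakk>x \<notin> N; 0 < e\<rbrakk> \<Longrightarrow>
      \<exists>d>0. \<forall>h. 0 < h \<and> h < d \<longrightarrow>
        norm (integral (cbox x (x + h *\<^sub>R One)) F /\<^sub>R h ^ DIM('a) - F x) < e"
    using integrable_ccontinuous_explicit by blast
  have Gx: "G x = 0" if x: "x \<in> \<Omega>" "x \<notin> N" for x
  proof (rule ccontr)
    assume "G x \<noteq> 0"
    then have "norm (F x) > 0" using x by (simp add: F_def)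
    from lim[OF x(2) this] obtain d where d: "d > 0" and
      dl: "\<And>h. 0 < h \<Longrightarrow> h < d \<Longrightarrow>
        norm (integral (cbox x (x + h *\<^sub>R One)) F /\<^sub>R h ^ DIM('a) - F x) < norm (F x)"
      by blast
    obtain r where r: "r > 0" "ball x r \<subseteq> \<Omega>" using assms(1) x(1) open_contains_ball by blast
    \<comment> \<open>The 1-norm bounds the Euclidean norm, so a cube with this side stays in the ball.\<close>
    define h where "h = min (d / 2) (r / (2 * DIM('a)))"
    have h: "0 < h" "h < d" using d r by (auto simp: h_def min_def)
    have hr: "real DIM('a) * h < r"
    proof -
      have "real DIM('a) * h \<le> real DIM('a) * (r / (2 * DIM('a)))"
        unfolding h_def by (intro mult_left_mono) auto
      also have "\<dots> = r / 2" by simp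
      also have "\<dots> < r" using r(1) by simp
      finally show ?thesis .
    qed
    have sub: "cbox x (x + h *\<^sub>R One) \<subseteq> \<Omega>"
    proof
      fix y assume y: "y \<in> cbox x (x + h *\<^sub>R One)"
      have "norm (y - x) \<le> (\<Sum>b\<in>Basis. \<bar>(y - x) \<bullet> b\<bar>)" by (rule norm_le_l1)
      also have "\<dots> \<le> (\<Sum>b\<in>(Basis::'a set). h)"
        using y by (intro sum_mono) (auto simp: mem_box inner_diff_left inner_add_left abs_le_iff)
      also have "\<dots> < r" using hr by simp
      finally show "y \<in> \<Omega>" using r(2) by (auto simp: dist_norm norm_minus_commute)
    qed
    have "integral (cbox x (x + h *\<^sub>R One)) F = integral (cbox x (x + h *\<^sub>R One)) G"
      by (rule Henstock_Kurzweil_Integration.integral_cong) (use sub in \<open>auto simp: F_def\<close>)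
    also have "\<dots> = 0" by (rule fundamental_lemma_box[OF assms(1-3) test sub])
    finally show False using dl[OF h] by simp
  qed
  have "AE x in lebesgue_on \<Omega>. x \<notin> N"
    using AE_not_in[OF N[unfolded negligible_iff_null_sets]] \<Omega>m
    by (auto simp: AE_restrict_space_iff elim: eventually_mono)
  moreover have "AE x in lebesgue_on \<Omega>. x \<in> \<Omega>"
    using \<Omega>m by (simp add: AE_restrict_space_iff)
  ultimately show ?thesis by eventually_elim (rule Gx)
qed

lemma has_weak_grad_lincomb:
  assumes "open \<Omega>" "bounded \<Omega>" "has_weak_grad \<Omega> v G" "has_weak_grad \<Omega> w H"
  shows "has_weak_grad \<Omega> (\<lambda>x. c *\<^sub>R v x + d *\<^sub>R w x) (\<lambda>x. c *\<^sub>R G x + d *\<^sub>R H x)"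
proof -
  have L2: "in_L2 \<Omega> v" "in_L2 \<Omega> w" "in_L2 \<Omega> G" "in_L2 \<Omega> H"
    using assms unfolding has_weak_grad_def by auto
  have "(LINT x|lebesgue_on \<Omega>. (c *\<^sub>R v x + d *\<^sub>R w x) *\<^sub>R g x)
      = - (LINT x|lebesgue_on \<Omega>. \<phi> x *\<^sub>R (c *\<^sub>R G x + d *\<^sub>R H x))" if t: "test_fun \<Omega> \<phi> g" for \<phi> g
  proof -
    note tL2 = test_fun_in_L2[OF assms(1,2) t]
    note i = in_L2_scaleR_integrable[OF L2(1) tL2(2)] in_L2_scaleR_integrable[OF L2(2) tL2(2)]
      in_L2_scaleR_integrable[OF tL2(1) L2(3)] in_L2_scaleR_integrable[OF tL2(1) L2(4)]
    have "(LINT x|lebesgue_on \<Omega>. (c *\<^sub>R v x + d *\<^sub>R w x) *\<^sub>R g x)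
        = (LINT x|lebesgue_on \<Omega>. c *\<^sub>R (v x *\<^sub>R g x) + d *\<^sub>R (w x *\<^sub>R g x))"
      by (simp add: scaleR_add_left)
    also have "\<dots> = c *\<^sub>R (LINT x|lebesgue_on \<Omega>. v x *\<^sub>R g x) + d *\<^sub>R (LINT x|lebesgue_on \<Omega>. w x *\<^sub>R g x)"
      using i by (simp del: scaleR_scaleR)
    also have "\<dots> = - (c *\<^sub>R (LINT x|lebesgue_on \<Omega>. \<phi> x *\<^sub>R G x) + d *\<^sub>R (LINT x|lebesgue_on \<Omega>. \<phi> x *\<^sub>R H x))"
      using assms(3,4) t unfolding has_weak_grad_def by simp
    also have "\<dots> = - (LINT x|lebesgue_on \<Omega>. c *\<^sub>R (\<phi> x *\<^sub>R G x) + d *\<^sub>R (\<phi> x *\<^sub>R H x))"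
      using i by (simp del: scaleR_scaleR)
    also have "\<dots> = - (LINT x|lebesgue_on \<Omega>. \<phi> x *\<^sub>R (c *\<^sub>R G x + d *\<^sub>R H x))"
      by (simp add: scaleR_add_right mult.commute)
    finally show ?thesis .
  qed
  then show ?thesis
    using in_L2_lincomb[OF L2(1,2)] in_L2_lincomb[OF L2(3,4)] unfolding has_weak_grad_def by blast
qed

lemma has_weak_grad_unique:
  assumes "open \<Omega>" "bounded \<Omega>" "has_weak_grad \<Omega> v G" "has_weak_grad \<Omega> w H"
    and "\<And>x. x \<in> \<Omega> \<Longrightarrow> v x = w x"
  shows "AE x in lebesgue_on \<Omega>. G x = H x"
proof -
  have L2: "in_L2 \<Omega> G" "in_L2 \<Omega> H"
    using assms unfolding has_weak_grad_def by auto
  have "AE x in lebesgue_on \<Omega>. G x - H x = 0"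
  proof (rule fundamental_lemma_AE[OF assms(1,2) in_L2_diff[OF L2]])
    fix \<phi> g assume t: "test_fun \<Omega> \<phi> g"
    note tL2 = test_fun_in_L2[OF assms(1,2) t]
    have "(LINT x|lebesgue_on \<Omega>. \<phi> x *\<^sub>R (G x - H x))
        = (LINT x|lebesgue_on \<Omega>. \<phi> x *\<^sub>R G x) - (LINT x|lebesgue_on \<Omega>. \<phi> x *\<^sub>R H x)"
      using in_L2_scaleR_integrable[OF tL2(1) L2(1)] in_L2_scaleR_integrable[OF tL2(1) L2(2)]
      by (simp add: scaleR_diff_right)
    also have "\<dots> = (LINT x|lebesgue_on \<Omega>. w x *\<^sub>R g x) - (LINT x|lebesgue_on \<Omega>. v x *\<^sub>R g x)"
      using assms(3,4) t unfolding has_weak_grad_def by simp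
    also have "(LINT x|lebesgue_on \<Omega>. w x *\<^sub>R g x) = (LINT x|lebesgue_on \<Omega>. v x *\<^sub>R g x)"
      by (rule Bochner_Integration.integral_cong[OF refl]) (simp add: assms(5) space_restrict_space)
    finally show "(LINT x|lebesgue_on \<Omega>. \<phi> x *\<^sub>R (G x - H x)) = 0" by simp
  qed
  then show ?thesis by simp
qed

lemma has_weak_grad_weak_grad: "has_weak_grad \<Omega> v G \<Longrightarrow> has_weak_grad \<Omega> v (weak_grad \<Omega> v)"
  unfolding weak_grad_def by (rule someI[of "has_weak_grad \<Omega> v"])

lemma has_weak_grad_zero: "has_weak_grad \<Omega> (\<lambda>x. 0) (\<lambda>x. 0)"
  unfolding has_weak_grad_def by (simp add: in_L2_zero)

section \<open>Linear structure of the finite element space\<close>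

lemma in_H10_lincomb:
  assumes "open \<Omega>" "bounded \<Omega>" "in_H10 \<Omega> v" "in_H10 \<Omega> w"
  shows "in_H10 \<Omega> (\<lambda>x. c *\<^sub>R v x + d *\<^sub>R w x)"
proof -
  obtain G where G: "has_weak_grad \<Omega> v G" and apG: "\<And>e. e > 0 \<Longrightarrow> \<exists>\<phi> g. test_fun \<Omega> \<phi> g \<and>
      l2_norm \<Omega> (\<lambda>x. \<phi> x - v x) < e \<and> l2_norm \<Omega> (\<lambda>x. g x - G x) < e"
    using assms(3) unfolding in_H10_def by blast
  obtain H where H: "has_weak_grad \<Omega> w H" and apH: "\<And>e. e > 0 \<Longrightarrow> \<exists>\<phi> g. test_fun \<Omega> \<phi> g \<and>
      l2_norm \<Omega> (\<lambda>x. \<phi> x - w x) < e \<and> l2_norm \<Omega> (\<lambda>x. g x - H x) < e"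
    using assms(4) unfolding in_H10_def by blast
  have L2: "in_L2 \<Omega> v" "in_L2 \<Omega> w" "in_L2 \<Omega> G" "in_L2 \<Omega> H"
    using G H unfolding has_weak_grad_def by auto
  have "\<exists>\<phi> g. test_fun \<Omega> \<phi> g \<and> l2_norm \<Omega> (\<lambda>x. \<phi> x - (c *\<^sub>R v x + d *\<^sub>R w x)) < e
      \<and> l2_norm \<Omega> (\<lambda>x. g x - (c *\<^sub>R G x + d *\<^sub>R H x)) < e" if e: "e > 0" for e
  proof -
    define \<epsilon> where "\<epsilon> = e / (\<bar>c\<bar> + \<bar>d\<bar> + 1)"
    have \<epsilon>: "\<epsilon> > 0" unfolding \<epsilon>_def using e by (simp add: add_nonneg_pos)
    have small: "\<bar>c\<bar> * s + \<bar>d\<bar> * t < e" if "s < \<epsilon>" "t < \<epsilon>" for s t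
    proof -
      have "\<bar>c\<bar> * s + \<bar>d\<bar> * t \<le> \<bar>c\<bar> * \<epsilon> + \<bar>d\<bar> * \<epsilon>"
        using that by (intro add_mono mult_left_mono) auto
      also have "\<dots> < (\<bar>c\<bar> + \<bar>d\<bar> + 1) * \<epsilon>" using \<epsilon> by (simp add: algebra_simps)
      also have "\<dots> = e" unfolding \<epsilon>_def by (simp add: add_nonneg_pos less_imp_neq[symmetric])
      finally show ?thesis .
    qed
    obtain \<phi> g where 1: "test_fun \<Omega> \<phi> g" "l2_norm \<Omega> (\<lambda>x. \<phi> x - v x) < \<epsilon>" "l2_norm \<Omega> (\<lambda>x. g x - G x) < \<epsilon>"
      using apG[OF \<epsilon>] by blast
    obtain \<psi> h where 2: "test_fun \<Omega> \<psi> h" "l2_norm \<Omega> (\<lambda>x. \<psi> x - w x) < \<epsilon>" "l2_norm \<Omega> (\<lambda>x. h x - H x) < \<epsilon>"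
      using apH[OF \<epsilon>] by blast
    note tL2 = test_fun_in_L2[OF assms(1,2) 1(1)] test_fun_in_L2[OF assms(1,2) 2(1)]
    have "l2_norm \<Omega> (\<lambda>x. c *\<^sub>R (\<phi> x - v x) + d *\<^sub>R (\<psi> x - w x)) < e"
      using l2_norm_lincomb_le[OF in_L2_diff[OF tL2(1) L2(1)] in_L2_diff[OF tL2(3) L2(2)], of c d]
        small[OF 1(2) 2(2)] by linarith
    moreover have "l2_norm \<Omega> (\<lambda>x. c *\<^sub>R (g x - G x) + d *\<^sub>R (h x - H x)) < e"
      using l2_norm_lincomb_le[OF in_L2_diff[OF tL2(2) L2(3)] in_L2_diff[OF tL2(4) L2(4)], of c d]
        small[OF 1(3) 2(3)] by linarith
    ultimately have "l2_norm \<Omega> (\<lambda>x. (c *\<^sub>R \<phi> x + d *\<^sub>R \<psi> x) - (c *\<^sub>R v x + d *\<^sub>R w x)) < e"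
      "l2_norm \<Omega> (\<lambda>x. (c *\<^sub>R g x + d *\<^sub>R h x) - (c *\<^sub>R G x + d *\<^sub>R H x)) < e"
      by (simp_all add: algebra_simps)
    with test_fun_lincomb[OF 1(1) 2(1), of c d] show ?thesis by blast
  qed
  then show ?thesis
    using has_weak_grad_lincomb[OF assms(1,2) G H, of c d] unfolding in_H10_def by blast
qed

lemma poly_deg_le_lincomb:
  fixes p q :: "'a::euclidean_space \<Rightarrow> real"
  assumes "poly_deg_le k p" "poly_deg_le k q"
  shows "poly_deg_le k (\<lambda>x. c *\<^sub>R p x + d *\<^sub>R q x)"
proof -
  obtain A a where A: "finite A" "\<And>\<alpha>. \<alpha> \<in> A \<Longrightarrow> (\<Sum>b\<in>Basis. \<alpha> b) \<le> k"
    "\<And>x. p x = (\<Sum>\<alpha>\<in>A. a \<alpha> * (\<Prod>b\<in>Basis. (x \<bullet> b) ^ \<alpha> b))"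
    using assms(1) unfolding poly_deg_le_def by blast
  obtain B b where B: "finite B" "\<And>\<alpha>. \<alpha> \<in> B \<Longrightarrow> (\<Sum>b\<in>Basis. \<alpha> b) \<le> k"
    "\<And>x. q x = (\<Sum>\<alpha>\<in>B. b \<alpha> * (\<Prod>b\<in>Basis. (x \<bullet> b) ^ \<alpha> b))"
    using assms(2) unfolding poly_deg_le_def by blast
  define e where "e \<alpha> = c * (if \<alpha> \<in> A then a \<alpha> else 0) + d * (if \<alpha> \<in> B then b \<alpha> else 0)" for \<alpha>
  have "c *\<^sub>R p x + d *\<^sub>R q x = (\<Sum>\<alpha>\<in>A \<union> B. e \<alpha> * (\<Prod>b\<in>Basis. (x \<bullet> b) ^ \<alpha> b))" for x
  proof -
    define M where "M = (\<lambda>\<alpha>::'a \<Rightarrow> nat. \<Prod>b\<in>Basis. (x \<bullet> b) ^ \<alpha> b)"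
    have "p x = (\<Sum>\<alpha>\<in>A \<union> B. (if \<alpha> \<in> A then a \<alpha> else 0) * M \<alpha>)"
      unfolding A(3) M_def using A(1) B(1) by (intro sum.mono_neutral_cong_left) auto
    moreover have "q x = (\<Sum>\<alpha>\<in>A \<union> B. (if \<alpha> \<in> B then b \<alpha> else 0) * M \<alpha>)"
      unfolding B(3) M_def using A(1) B(1) by (intro sum.mono_neutral_cong_left) auto
    ultimately show ?thesis
      by (simp add: e_def M_def sum_distrib_left distrib_right sum.distrib mult.assoc)
  qed
  then show ?thesis
    unfolding poly_deg_le_def using A(1,2) B(1,2) by (intro exI[of _ "A \<union> B"] exI[of _ e]) auto
qed

lemma fe_space_lincomb:
  assumes "open \<Omega>" "bounded \<Omega>" "v \<in> fe_space \<Omega> T k" "w \<in> fe_space \<Omega> T k"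
  shows "(\<lambda>x. c *\<^sub>R v x + d *\<^sub>R w x) \<in> fe_space \<Omega> T k"
proof -
  have "\<exists>p. poly_deg_le k p \<and> (\<forall>x\<in>K. c *\<^sub>R v x + d *\<^sub>R w x = p x)" if K: "K \<in> T" for K
  proof -
    obtain p q where "poly_deg_le k p" "\<forall>x\<in>K. v x = p x" "poly_deg_le k q" "\<forall>x\<in>K. w x = q x"
      using assms(3,4) K unfolding fe_space_def by blast
    then show ?thesis
      by (intro exI[of _ "\<lambda>x. c *\<^sub>R p x + d *\<^sub>R q x"] conjI poly_deg_le_lincomb) auto
  qed
  moreover have "continuous_on (closure \<Omega>) (\<lambda>x. c *\<^sub>R v x + d *\<^sub>R w x)"
    using assms(3,4) unfolding fe_space_def by (auto intro!: continuous_intros)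
  ultimately show ?thesis
    using assms(3,4) in_H10_lincomb[OF assms(1,2), of v w c d] unfolding fe_space_def by simp
qed

lemma zero_in_fe_space: "(\<lambda>x. 0) \<in> fe_space \<Omega> T k"
proof -
  have "test_fun \<Omega> (\<lambda>x. 0) (\<lambda>x. 0)"
    unfolding test_fun_def by (auto intro!: exI[of _ "{}"] GDERIV_const)
  then have "in_H10 \<Omega> (\<lambda>x. 0)"
    unfolding in_H10_def using has_weak_grad_zero
    by (intro exI[of _ "\<lambda>x. 0"] conjI allI impI) (auto intro!: exI simp: l2_norm_zero)
  moreover have "poly_deg_le k (\<lambda>x. 0)"
    unfolding poly_deg_le_def by (intro exI[of _ "{}"]) simp
  ultimately show ?thesis unfolding fe_space_def by auto
qed

lemma fe_space_weak_grad:
  assumes "v \<in> fe_space \<Omega> T k"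
  shows "has_weak_grad \<Omega> v (weak_grad \<Omega> v)"
  using assms has_weak_grad_weak_grad unfolding fe_space_def in_H10_def by blast

section \<open>Exponentially damped energy estimate for the leapfrog scheme\<close>

text \<open>Comparison of \<open>1 - exp (- 2 \<rho> \<tau>)\<close> with \<open>\<rho> \<tau>\<close>; this is where \<open>\<rho> \<tau> \<le> 1\<close> enters the energy estimate.\<close>

lemma one_minus_exp_lower:
  fixes x :: real
  assumes "0 \<le> x" "x \<le> 2"
  shows "x / 3 \<le> 1 - exp (- x)"
proof -
  have "exp (- x) \<le> 1 / (1 + x)"
    using exp_ge_add_one_self[of x] assms by (simp add: exp_minus field_simps)
  moreover have "x / 3 \<le> 1 - 1 / (1 + x)"
    using assms by (simp add: field_simps) (simp add: mult_mono)
  ultimately show ?thesis by linarith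
qed

lemma Young_damped:
  fixes g x y \<rho> :: real
  assumes "\<rho> > 0"
  shows "g * (x + y) \<le> 4 / \<rho> * g\<^sup>2 + \<rho> / 8 * (x\<^sup>2 + y\<^sup>2)"
proof -
  have *: "g * z \<le> 2 / \<rho> * g\<^sup>2 + \<rho> / 8 * z\<^sup>2" for z
  proof -
    have "0 \<le> (4 * g - \<rho> * z)\<^sup>2 / (8 * \<rho>)" using assms by simp
    also have "\<dots> = 2 / \<rho> * g\<^sup>2 + \<rho> / 8 * z\<^sup>2 - g * z"
      using assms by (simp add: field_simps power2_eq_square)
    finally show ?thesis by simp
  qed
  have "g * (x + y) = g * x + g * y" by (simp add: algebra_simps)
  also have "\<dots> \<le> 2 / \<rho> * g\<^sup>2 + \<rho> / 8 * x\<^sup>2 + (2 / \<rho> * g\<^sup>2 + \<rho> / 8 * y\<^sup>2)"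
    by (intro add_mono *)
  also have "\<dots> = 4 / \<rho> * g\<^sup>2 + \<rho> / 8 * (x\<^sup>2 + y\<^sup>2)" by (simp add: algebra_simps)
  finally show ?thesis .
qed

text \<open>A discrete Gronwall argument.  Summation by parts of the weighted energy increments produces
\<open>(1 - q) (\<Sum>n\<le>N. q ^ n * E n)\<close> and a boundary term of the good sign, and \<open>1 - q\<close> is of order \<open>\<rho> \<tau>\<close>.
Young's inequality splits the right-hand side into the source and a small multiple of the squared
velocities, which coercivity allows to absorb.\<close>

lemma damped_energy_sum:
  fixes E a g :: "nat \<Rightarrow> real" and \<tau> \<rho> :: real
  assumes pos: "0 < \<tau>" "0 < \<rho>" "\<rho> * \<tau> \<le> 1"
    and init: "E 0 = 0"
    and coercive: "\<And>n. 3 / 4 * (a n)\<^sup>2 \<le> E n"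
    and step: "\<And>n. E (Suc n) - E n \<le> \<tau> * (g n * (a (Suc n) + a n))"
  defines "q \<equiv> exp (- 2 * \<rho> * \<tau>)"
  shows "(\<Sum>n\<le>N. q ^ n * E n) \<le> 12 / \<rho>\<^sup>2 * (\<Sum>n\<le>N. q ^ n * (g n)\<^sup>2)"
proof -
  have q: "0 < q" "q \<le> 1" using pos by (auto simp: q_def)
  define S where "S = (\<lambda>N. \<Sum>n\<le>N. q ^ n * E n)"
  define A where "A = (\<lambda>N. \<Sum>n\<le>N. q ^ n * (a n)\<^sup>2)"
  define G where "G = (\<lambda>N. \<Sum>n\<le>N. q ^ n * (g n)\<^sup>2)"
  have E: "0 \<le> E n" for n by (rule order_trans[OF _ coercive[of n]]) simp
  have a0: "(a 0)\<^sup>2 = 0" using coercive[of 0] init by simp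
  \<comment> \<open>Half of the last velocity term is held back: the step from \<open>N\<close> to \<open>N + 1\<close> uses the
    velocities at both ends, each with weight one half.\<close>
  have claim: "(1 - q) * S N + q ^ Suc N * E N
      \<le> \<tau> * (4 / \<rho> * (G N - q ^ N * (g N)\<^sup>2) + \<rho> / 4 * (A N - q ^ N * (a N)\<^sup>2 / 2))" for N
  proof (induction N)
    case 0
    show ?case by (simp add: S_def G_def A_def init a0)
  next
    case (Suc N)
    have "q ^ Suc N * (E (Suc N) - E N)
        \<le> q ^ Suc N * (\<tau> * (4 / \<rho> * (g N)\<^sup>2 + \<rho> / 8 * ((a (Suc N))\<^sup>2 + (a N)\<^sup>2)))"
      using step[of N] Young_damped[OF pos(2), of "g N" "a (Suc N)" "a N"] q pos(1)
      by (intro mult_left_mono) (auto intro: order_trans mult_left_mono)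
    also have "\<dots> = \<tau> * (4 / \<rho> * (q ^ Suc N * (g N)\<^sup>2) + \<rho> / 8 * (q ^ Suc N * (a (Suc N))\<^sup>2 + q ^ Suc N * (a N)\<^sup>2))"
      by (simp add: algebra_simps)
    also have "\<dots> \<le> \<tau> * (4 / \<rho> * (q ^ N * (g N)\<^sup>2) + \<rho> / 8 * (q ^ Suc N * (a (Suc N))\<^sup>2 + q ^ N * (a N)\<^sup>2))"
      using q pos by (intro mult_left_mono add_mono mult_right_mono order_refl power_decreasing) auto
    finally have inc: "q ^ Suc N * (E (Suc N) - E N)
      \<le> \<tau> * (4 / \<rho> * (q ^ N * (g N)\<^sup>2) + \<rho> / 8 * (q ^ Suc N * (a (Suc N))\<^sup>2 + q ^ N * (a N)\<^sup>2))" .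
    have "(1 - q) * S (Suc N) + q ^ Suc (Suc N) * E (Suc N)
        = ((1 - q) * S N + q ^ Suc N * E N) + q ^ Suc N * (E (Suc N) - E N)"
      by (simp add: S_def algebra_simps)
    also have "\<dots> \<le> \<tau> * (4 / \<rho> * (G N - q ^ N * (g N)\<^sup>2) + \<rho> / 4 * (A N - q ^ N * (a N)\<^sup>2 / 2))
      + \<tau> * (4 / \<rho> * (q ^ N * (g N)\<^sup>2) + \<rho> / 8 * (q ^ Suc N * (a (Suc N))\<^sup>2 + q ^ N * (a N)\<^sup>2))"
      by (intro add_mono Suc.IH inc)
    also have "\<dots> = \<tau> * (4 / \<rho> * G N + \<rho> / 4 * (A N + q ^ Suc N * (a (Suc N))\<^sup>2 / 2))"
      by (simp add: algebra_simps)
    also have "\<dots> = \<tau> * (4 / \<rho> * (G (Suc N) - q ^ Suc N * (g (Suc N))\<^sup>2)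
        + \<rho> / 4 * (A (Suc N) - q ^ Suc N * (a (Suc N))\<^sup>2 / 2))"
      by (simp add: G_def A_def)
    finally show ?case .
  qed
  have nn: "0 \<le> q ^ n * z\<^sup>2" for n and z :: real using q by simp
  have SN: "0 \<le> S N" unfolding S_def by (intro sum_nonneg) (use q E in auto)
  have "A N \<le> (\<Sum>n\<le>N. 4 / 3 * (q ^ n * E n))"
    unfolding A_def
  proof (rule sum_mono)
    fix n
    have "q ^ n * (3 / 4 * (a n)\<^sup>2) \<le> q ^ n * E n" using q coercive by (intro mult_left_mono) auto
    then show "q ^ n * (a n)\<^sup>2 \<le> 4 / 3 * (q ^ n * E n)" by simp
  qed
  then have AS: "A N \<le> 4 / 3 * S N" by (simp add: S_def sum_distrib_left)
  have "2 * \<rho> * \<tau> / 3 \<le> 1 - q"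
    unfolding q_def using one_minus_exp_lower[of "2 * \<rho> * \<tau>"] pos by simp
  then have "2 * \<rho> * \<tau> / 3 * S N \<le> (1 - q) * S N" using SN by (rule mult_right_mono)
  also have "\<dots> \<le> (1 - q) * S N + q ^ Suc N * E N" using q E by simp
  also note claim[of N]
  also have "\<tau> * (4 / \<rho> * (G N - q ^ N * (g N)\<^sup>2) + \<rho> / 4 * (A N - q ^ N * (a N)\<^sup>2 / 2))
      \<le> \<tau> * (4 / \<rho> * G N + \<rho> / 4 * (4 / 3 * S N))"
    using pos AS nn[of N "g N"] nn[of N "a N"] by (intro mult_left_mono add_mono) auto
  finally have "\<tau> * (2 * \<rho> / 3 * S N) \<le> \<tau> * (4 / \<rho> * G N + \<rho> / 4 * (4 / 3 * S N))"
    by (simp add: algebra_simps)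
  then have "2 * \<rho> / 3 * S N \<le> 4 / \<rho> * G N + \<rho> / 4 * (4 / 3 * S N)"
    using pos(1) by (simp only: mult_le_cancel_left_pos)
  then have "\<rho> * S N \<le> 12 / \<rho> * G N" by simp
  then have "S N \<le> 12 / \<rho>\<^sup>2 * G N"
    using pos(2) by (simp add: field_simps power2_eq_square)
  then show ?thesis unfolding S_def G_def .
qed

lemma l2_inner_diff_left:
  assumes "in_L2 \<Omega> g" "in_L2 \<Omega> h" "in_L2 \<Omega> w"
  shows "l2_inner \<Omega> (\<lambda>x. g x - h x) w = l2_inner \<Omega> g w - l2_inner \<Omega> h w"
  using l2_inner_lincomb_left[OF assms, of 1 "-1"] by simp

lemma l2_inner_diff_right:
  assumes "in_L2 \<Omega> g" "in_L2 \<Omega> h" "in_L2 \<Omega> w"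
  shows "l2_inner \<Omega> w (\<lambda>x. g x - h x) = l2_inner \<Omega> w g - l2_inner \<Omega> w h"
  using l2_inner_lincomb_right[OF assms, of 1 "-1"] by simp

text \<open>The test function \<open>Y (n + 2) - Y n\<close> turns the scheme into an identity for the increments of
\<open>E\<^sub>n = \<parallel>(Y\<^sub>n\<^sub>+\<^sub>1 - Y\<^sub>n) / \<tau>\<parallel>\<^sup>2 + (Z\<^sub>n\<^sub>+\<^sub>1, Z\<^sub>n)\<close>.  With \<open>D = Z\<^sub>n\<^sub>+\<^sub>1 - Z\<^sub>n\<close>, the last product is
\<open>\<parallel>Z\<^sub>n\<parallel>\<^sup>2 + (D, Z\<^sub>n)\<close>, and the CFL condition bounds \<open>\<parallel>D\<parallel>\<close> by the norm of the velocity, so that completing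
squares shows that the energy dominates both \<open>3/4\<close> of the squared velocity and \<open>\<parallel>Z\<^sub>n\<parallel>\<^sup>2 / 2\<close>.\<close>

lemma leapfrog_energy_estimate:
  fixes Y h :: "nat \<Rightarrow> 'a::euclidean_space \<Rightarrow> real" and Z :: "nat \<Rightarrow> 'a \<Rightarrow> 'a"
    and \<tau> \<rho> :: real
  assumes pos: "0 < \<tau>" "0 < \<rho>" "\<rho> * \<tau> \<le> 1"
    and L2: "\<And>n. in_L2 \<Omega> (Y n)" "\<And>n. in_L2 \<Omega> (Z n)" "\<And>n. in_L2 \<Omega> (h n)"
    and cfl: "\<And>n. \<tau>\<^sup>2 * (l2_norm \<Omega> (\<lambda>x. Z (Suc n) x - Z n x))\<^sup>2
        \<le> (l2_norm \<Omega> (\<lambda>x. Y (Suc n) x - Y n x))\<^sup>2"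
    and scheme: "\<And>n. let v = (\<lambda>x. Y (Suc (Suc n)) x - Y n x); G = (\<lambda>x. Z (Suc (Suc n)) x - Z n x) in
      (l2_inner \<Omega> (Y (Suc (Suc n))) v - 2 * l2_inner \<Omega> (Y (Suc n)) v + l2_inner \<Omega> (Y n) v) / \<tau>\<^sup>2
        + l2_inner \<Omega> (Z (Suc n)) G = l2_inner \<Omega> (h n) v"
    and init: "l2_norm \<Omega> (\<lambda>x. Y 1 x - Y 0 x) = 0" "l2_norm \<Omega> (Z 0) = 0"
  defines "q \<equiv> exp (- 2 * \<rho> * \<tau>)"
  shows "(\<Sum>n\<le>N. q ^ n * (l2_norm \<Omega> (\<lambda>x. (Y (Suc n) x - Y n x) /\<^sub>R \<tau>))\<^sup>2)
        \<le> 24 / \<rho>\<^sup>2 * (\<Sum>n\<le>N. q ^ n * (l2_norm \<Omega> (h n))\<^sup>2)"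
    and "(\<Sum>n\<le>N. q ^ n * (l2_norm \<Omega> (Z n))\<^sup>2)
        \<le> 24 / \<rho>\<^sup>2 * (\<Sum>n\<le>N. q ^ n * (l2_norm \<Omega> (h n))\<^sup>2)"
proof -
  define P where "P = (\<lambda>n x. Y (Suc n) x - Y n x)"
  define D where "D = (\<lambda>n x. Z (Suc n) x - Z n x)"
  define a where "a = (\<lambda>n. l2_norm \<Omega> (P n) / \<tau>)"
  define E where "E = (\<lambda>n. (a n)\<^sup>2 + l2_inner \<Omega> (Z (Suc n)) (Z n))"
  have LP: "in_L2 \<Omega> (P n)" and LD: "in_L2 \<Omega> (D n)" for n
    unfolding P_def D_def by (auto intro: in_L2_diff L2)
  have q: "0 < q" by (simp add: q_def)
  have D_le: "(l2_norm \<Omega> (D n))\<^sup>2 \<le> (a n)\<^sup>2" for n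
    using cfl[of n] pos(1) unfolding D_def a_def P_def
    by (simp add: power_divide field_simps)
  have ZZ: "l2_inner \<Omega> (Z (Suc n)) (Z n) = l2_inner \<Omega> (D n) (Z n) + (l2_norm \<Omega> (Z n))\<^sup>2" for n
    unfolding D_def by (simp add: l2_inner_diff_left L2 l2_norm_power2)
  have coercive: "3 / 4 * (a n)\<^sup>2 \<le> E n" for n
  proof -
    have "0 \<le> (l2_norm \<Omega> (\<lambda>x. (1/2) *\<^sub>R D n x + 1 *\<^sub>R Z n x))\<^sup>2" by simp
    also have "\<dots> = (l2_norm \<Omega> (D n))\<^sup>2 / 4 + l2_inner \<Omega> (D n) (Z n) + (l2_norm \<Omega> (Z n))\<^sup>2"
      unfolding l2_norm_lincomb_power2[OF LD L2(2)] by (simp add: power2_eq_square)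
    finally show ?thesis using D_le[of n] unfolding E_def ZZ by linarith
  qed
  have grad: "(l2_norm \<Omega> (Z n))\<^sup>2 \<le> 2 * E n" for n
  proof -
    have "0 \<le> (l2_norm \<Omega> (\<lambda>x. 1 *\<^sub>R D n x + 1 *\<^sub>R Z n x))\<^sup>2" by simp
    also have "\<dots> = (l2_norm \<Omega> (D n))\<^sup>2 + 2 * l2_inner \<Omega> (D n) (Z n) + (l2_norm \<Omega> (Z n))\<^sup>2"
      unfolding l2_norm_lincomb_power2[OF LD L2(2)] by simp
    finally have "0 \<le> (l2_norm \<Omega> (D n))\<^sup>2 + 2 * l2_inner \<Omega> (D n) (Z n) + (l2_norm \<Omega> (Z n))\<^sup>2" .
    moreover have "0 \<le> (a n)\<^sup>2" by simp
    ultimately show ?thesis using D_le[of n] unfolding E_def ZZ distrib_left by linarith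
  qed
  have step: "E (Suc n) - E n \<le> \<tau> * (l2_norm \<Omega> (h n) * (a (Suc n) + a n))" for n
  proof -
    let ?v = "\<lambda>x. Y (Suc (Suc n)) x - Y n x"
    have v: "?v = (\<lambda>x. 1 *\<^sub>R P (Suc n) x + 1 *\<^sub>R P n x)" by (simp add: P_def fun_eq_iff)
    have Lv: "in_L2 \<Omega> ?v" by (intro in_L2_diff L2)
    have "l2_inner \<Omega> (Y (Suc (Suc n))) ?v - 2 * l2_inner \<Omega> (Y (Suc n)) ?v + l2_inner \<Omega> (Y n) ?v
        = l2_inner \<Omega> (P (Suc n)) ?v - l2_inner \<Omega> (P n) ?v"
      unfolding P_def by (simp add: l2_inner_diff_left L2 Lv)
    also have "\<dots> = (l2_norm \<Omega> (P (Suc n)))\<^sup>2 - (l2_norm \<Omega> (P n))\<^sup>2"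
      unfolding v using l2_inner_commute[of \<Omega> "P n" "P (Suc n)"]
      by (simp only: l2_inner_lincomb_right LP l2_norm_power2 mult_1)
    finally have kinetic: "(l2_inner \<Omega> (Y (Suc (Suc n))) ?v - 2 * l2_inner \<Omega> (Y (Suc n)) ?v
        + l2_inner \<Omega> (Y n) ?v) / \<tau>\<^sup>2 = (a (Suc n))\<^sup>2 - (a n)\<^sup>2"
      unfolding a_def by (simp add: power_divide diff_divide_distrib)
    have "E (Suc n) - E n = (a (Suc n))\<^sup>2 - (a n)\<^sup>2
        + l2_inner \<Omega> (Z (Suc n)) (\<lambda>x. Z (Suc (Suc n)) x - Z n x)"
      unfolding E_def by (simp add: l2_inner_diff_right L2 l2_inner_commute[of _ "Z (Suc (Suc n))"])
    also have "\<dots> = l2_inner \<Omega> (h n) ?v"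
      using scheme[of n] kinetic by (simp add: Let_def)
    also have "\<dots> \<le> l2_norm \<Omega> (h n) * l2_norm \<Omega> ?v"
      using l2_Cauchy_Schwarz[OF L2(3) Lv, of n] by linarith
    also have "\<dots> \<le> l2_norm \<Omega> (h n) * (l2_norm \<Omega> (P (Suc n)) + l2_norm \<Omega> (P n))"
      using l2_norm_lincomb_le[OF LP LP, of 1 "Suc n" 1 n] unfolding v
      by (intro mult_left_mono l2_norm_nonneg) simp
    also have "\<dots> = \<tau> * (l2_norm \<Omega> (h n) * (a (Suc n) + a n))"
      unfolding a_def using pos(1) by (simp add: field_simps)
    finally show ?thesis .
  qed
  have "l2_norm \<Omega> (P 0) = 0" using init(1) unfolding P_def by simp
  moreover have "l2_inner \<Omega> (Z 1) (Z 0) = 0"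
    using l2_Cauchy_Schwarz[OF L2(2) L2(2), of 1 0] init(2) by simp
  ultimately have E0: "E 0 = 0" unfolding E_def a_def by simp
  define T where "T = (\<Sum>n\<le>N. q ^ n * (l2_norm \<Omega> (h n))\<^sup>2)"
  have main: "(\<Sum>n\<le>N. q ^ n * E n) \<le> 12 / \<rho>\<^sup>2 * T"
    unfolding q_def T_def by (rule damped_energy_sum[OF pos E0 coercive step])
  have bound: "(\<Sum>n\<le>N. q ^ n * z n) \<le> 24 / \<rho>\<^sup>2 * T" if "\<And>n. z n \<le> 2 * E n" for z
  proof -
    have "(\<Sum>n\<le>N. q ^ n * z n) \<le> (\<Sum>n\<le>N. q ^ n * (2 * E n))"
      using that q by (intro sum_mono mult_left_mono) auto
    also have "\<dots> = 2 * (\<Sum>n\<le>N. q ^ n * E n)"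
      by (simp add: sum_distrib_left algebra_simps)
    finally show ?thesis using main by simp
  qed
  have "l2_norm \<Omega> (\<lambda>x. (Y (Suc n) x - Y n x) /\<^sub>R \<tau>) \<le> a n" for n
    using l2_norm_lincomb_le[OF LP LP, of "inverse \<tau>" n 0 n] pos(1)
    unfolding a_def P_def by (simp add: divide_inverse mult.commute)
  then have "(l2_norm \<Omega> (\<lambda>x. (Y (Suc n) x - Y n x) /\<^sub>R \<tau>))\<^sup>2 \<le> (a n)\<^sup>2" for n
    by (rule power_mono) (rule l2_norm_nonneg)
  moreover have "(a n)\<^sup>2 \<le> 2 * E n" for n
    using coercive[of n] zero_le_power2[of "a n"] by linarith
  ultimately have "(l2_norm \<Omega> (\<lambda>x. (Y (Suc n) x - Y n x) /\<^sub>R \<tau>))\<^sup>2 \<le> 2 * E n" for n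
    by (rule order_trans)
  then show "(\<Sum>n\<le>N. q ^ n * (l2_norm \<Omega> (\<lambda>x. (Y (Suc n) x - Y n x) /\<^sub>R \<tau>))\<^sup>2)
        \<le> 24 / \<rho>\<^sup>2 * (\<Sum>n\<le>N. q ^ n * (l2_norm \<Omega> (h n))\<^sup>2)"
    unfolding T_def[symmetric] by (rule bound)
  show "(\<Sum>n\<le>N. q ^ n * (l2_norm \<Omega> (Z n))\<^sup>2)
        \<le> 24 / \<rho>\<^sup>2 * (\<Sum>n\<le>N. q ^ n * (l2_norm \<Omega> (h n))\<^sup>2)"
    unfolding T_def[symmetric] by (rule bound[OF grad])
qed

section \<open>Difference quotients of sequences\<close>

text \<open>Iterated forward difference quotients of a sequence of functions.  Sequences are indexed by the
integers, so that shifts need no case distinction at the initial time.\<close>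

primrec dquot :: "real \<Rightarrow> nat \<Rightarrow> (int \<Rightarrow> 'a \<Rightarrow> 'b::real_vector) \<Rightarrow> int \<Rightarrow> 'a \<Rightarrow> 'b" where
  "dquot \<tau> 0 W = W"
| "dquot \<tau> (Suc r) W = (\<lambda>n x. (dquot \<tau> r W (n + 1) x - dquot \<tau> r W n x) /\<^sub>R \<tau>)"

lemma dquot_Suc_lincomb:
  "dquot \<tau> (Suc r) W n = (\<lambda>x. inverse \<tau> *\<^sub>R dquot \<tau> r W (n + 1) x + (- inverse \<tau>) *\<^sub>R dquot \<tau> r W n x)"
  by (simp add: fun_eq_iff algebra_simps)

lemma in_L2_dquot:
  assumes "\<And>n. in_L2 \<Omega> (W n)"
  shows "in_L2 \<Omega> (dquot \<tau> r W n)"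
proof (induction r arbitrary: n)
  case (Suc r)
  show ?case unfolding dquot_Suc_lincomb by (rule in_L2_lincomb[OF Suc Suc])
qed (simp add: assms)

lemma dquot_eq_0:
  assumes "\<And>n. n \<le> m \<Longrightarrow> W n x = 0" "n + int r \<le> m"
  shows "dquot \<tau> r W n x = 0"
  using assms(2) by (induction r arbitrary: n) (auto simp: assms(1))

lemma dquot_AE_0:
  assumes "\<And>n. n \<le> m \<Longrightarrow> AE x in M. W n x = 0" "n + int r \<le> m"
  shows "AE x in M. dquot \<tau> r W n x = 0"
  using assms(2)
proof (induction r arbitrary: n)
  case (Suc r)
  then have "AE x in M. dquot \<tau> r W (n + 1) x = 0" "AE x in M. dquot \<tau> r W n x = 0"
    by auto
  then show ?case by eventually_elim simp
qed (simp add: assms(1))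

lemma dquot_fe_space:
  assumes "open \<Omega>" "bounded \<Omega>" "\<And>n. W n \<in> fe_space \<Omega> T k"
  shows "dquot \<tau> r W n \<in> fe_space \<Omega> T k"
proof (induction r arbitrary: n)
  case (Suc r)
  show ?case unfolding dquot_Suc_lincomb by (rule fe_space_lincomb[OF assms(1,2) Suc Suc])
qed (simp add: assms(3))

lemma dquot_has_weak_grad:
  assumes "open \<Omega>" "bounded \<Omega>" "\<And>n. has_weak_grad \<Omega> (W n) (G n)"
  shows "has_weak_grad \<Omega> (dquot \<tau> r W n) (dquot \<tau> r G n)"
proof (induction r arbitrary: n)
  case (Suc r)
  show ?case unfolding dquot_Suc_lincomb by (rule has_weak_grad_lincomb[OF assms(1,2) Suc Suc])
qed (simp add: assms(3))

lemma l2_inner_dquot_Suc: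
  assumes "\<And>n. in_L2 \<Omega> (W n)" "in_L2 \<Omega> v"
  shows "l2_inner \<Omega> (dquot \<tau> (Suc r) W n) v
    = (l2_inner \<Omega> (dquot \<tau> r W (n + 1)) v - l2_inner \<Omega> (dquot \<tau> r W n) v) / \<tau>"
  unfolding dquot_Suc_lincomb
    l2_inner_lincomb_left[OF in_L2_dquot[OF assms(1)] in_L2_dquot[OF assms(1)] assms(2)]
  by (simp add: divide_inverse algebra_simps)

text \<open>The scheme is linear and invariant under shifts of the time index.\<close>

lemma dquot_scheme:
  assumes "\<And>n. in_L2 \<Omega> (W n)" "\<And>n. in_L2 \<Omega> (Z n)" "\<And>n. in_L2 \<Omega> (h n)" "in_L2 \<Omega> v" "in_L2 \<Omega> G"
    and "\<And>n. (l2_inner \<Omega> (W (n + 2)) v - 2 * l2_inner \<Omega> (W (n + 1)) v + l2_inner \<Omega> (W n) v) / \<tau>\<^sup>2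
      + l2_inner \<Omega> (Z (n + 1)) G = l2_inner \<Omega> (h n) v"
  shows "(l2_inner \<Omega> (dquot \<tau> r W (n + 2)) v - 2 * l2_inner \<Omega> (dquot \<tau> r W (n + 1)) v
      + l2_inner \<Omega> (dquot \<tau> r W n) v) / \<tau>\<^sup>2
      + l2_inner \<Omega> (dquot \<tau> r Z (n + 1)) G = l2_inner \<Omega> (dquot \<tau> r h n) v"
proof (induction r arbitrary: n)
  case (Suc r)
  have e: "n + 2 + 1 = n + 1 + 2" by simp
  show ?case
    unfolding l2_inner_dquot_Suc[OF assms(1,4)] l2_inner_dquot_Suc[OF assms(2,5)]
      l2_inner_dquot_Suc[OF assms(3,4)] Suc[of "n + 1", symmetric] Suc[of n, symmetric] e
    by (simp add: algebra_simps diff_divide_distrib add_divide_distrib)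
qed (simp add: assms(6))

section \<open>Time regularity of the source\<close>

definition fdiff :: "real \<Rightarrow> (real \<Rightarrow> real) \<Rightarrow> real \<Rightarrow> real" where
  "fdiff \<tau> \<phi> t = \<phi> (t + \<tau>) - \<phi> t"

lemma fdiff_pow_has_derivative:
  assumes "\<And>t. (\<phi> has_real_derivative \<phi>' t) (at t)"
  shows "((fdiff \<tau> ^^ r) \<phi> has_real_derivative (fdiff \<tau> ^^ r) \<phi>' t) (at t)"
proof (induction r arbitrary: t)
  case (Suc r)
  have "((\<lambda>t. (fdiff \<tau> ^^ r) \<phi> (t + \<tau>)) has_real_derivative (fdiff \<tau> ^^ r) \<phi>' (t + \<tau>)) (at t)"
    using Suc[of "t + \<tau>"] by (simp add: DERIV_shift)
  then have "((\<lambda>t. (fdiff \<tau> ^^ r) \<phi> (t + \<tau>) - (fdiff \<tau> ^^ r) \<phi> t) has_real_derivative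
      (fdiff \<tau> ^^ r) \<phi>' (t + \<tau>) - (fdiff \<tau> ^^ r) \<phi>' t) (at t)"
    by (intro DERIV_diff Suc)
  then show ?case by (simp add: fdiff_def[abs_def])
qed (simp add: assms)

text \<open>Induction on the order: the mean value theorem expresses one more difference of \<open>\<phi> 0\<close> as \<open>\<tau>\<close> times
a difference of lower order of its derivative, taken at a point that keeps the window of integration
inside the larger one.  The fundamental theorem of calculus is used only at the first order.\<close>

lemma fdiff_pow_le_integral:
  fixes \<phi> :: "nat \<Rightarrow> real \<Rightarrow> real" and N :: "real \<Rightarrow> real"
  assumes \<tau>: "0 < \<tau>"
    and deriv: "\<And>j t. j \<le> r \<Longrightarrow> (\<phi> j has_real_derivative \<phi> (Suc j) t) (at t)"
    and N: "continuous_on UNIV N" "\<And>t. \<bar>\<phi> (Suc r) t\<bar> \<le> N t"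
  shows "\<bar>(fdiff \<tau> ^^ Suc r) (\<phi> 0) t\<bar> \<le> \<tau> ^ r * integral {t..t + real (Suc r) * \<tau>} N"
  using deriv N(2)
proof (induction r arbitrary: \<phi> t)
  case 0
  have int: "N integrable_on {t..t + \<tau>}"
    by (intro integrable_continuous_interval continuous_on_subset[OF N(1)]) simp
  have "(\<phi> 1 has_integral (\<phi> 0 (t + \<tau>) - \<phi> 0 t)) {t..t + \<tau>}"
    using \<tau> 0(1)[of 0]
    by (intro fundamental_theorem_of_calculus)
      (auto simp: has_real_derivative_iff_has_vector_derivative[symmetric]
        intro: has_field_derivative_at_within)
  then have "\<bar>\<phi> 0 (t + \<tau>) - \<phi> 0 t\<bar> \<le> integral {t..t + \<tau>} N"
    using integral_norm_bound_integral[of "\<phi> 1" "{t..t + \<tau>}" N] int 0(2)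
    by (auto simp: integral_unique has_integral_integrable)
  then show ?case by (simp add: fdiff_def)
next
  case (Suc r)
  let ?\<psi> = "(fdiff \<tau> ^^ Suc r) (\<phi> 0)" and ?\<psi>' = "(fdiff \<tau> ^^ Suc r) (\<phi> 1)"
  have "(?\<psi> has_real_derivative ?\<psi>' s) (at s)" for s
    by (rule fdiff_pow_has_derivative) (use Suc.prems(1)[of 0] in auto)
  then obtain s where s: "t < s" "s < t + \<tau>" "?\<psi> (t + \<tau>) - ?\<psi> t = (t + \<tau> - t) * ?\<psi>' s"
    using MVT2[of t "t + \<tau>" ?\<psi> ?\<psi>'] \<tau> by auto
  have "\<bar>?\<psi>' s\<bar> \<le> \<tau> ^ r * integral {s..s + real (Suc r) * \<tau>} N"
    using Suc.IH[of "\<lambda>j. \<phi> (Suc j)" s] Suc.prems by simp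
  also have "integral {s..s + real (Suc r) * \<tau>} N \<le> integral {t..t + real (Suc (Suc r)) * \<tau>} N"
  proof (rule integral_subset_le)
    show "{s..s + real (Suc r) * \<tau>} \<subseteq> {t..t + real (Suc (Suc r)) * \<tau>}"
      using s by (auto simp: algebra_simps)
    have "0 \<le> N x" for x using Suc.prems(2)[of x] by linarith
    then show "\<forall>x\<in>{t..t + real (Suc (Suc r)) * \<tau>}. 0 \<le> N x" by blast
  qed (auto intro!: integrable_continuous_interval continuous_on_subset[OF N(1)])
  finally have "\<bar>?\<psi>' s\<bar> \<le> \<tau> ^ r * integral {t..t + real (Suc (Suc r)) * \<tau>} N"
    using \<tau> by simp
  then have "\<tau> * \<bar>?\<psi>' s\<bar> \<le> \<tau> * (\<tau> ^ r * integral {t..t + real (Suc (Suc r)) * \<tau>} N)"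
    using \<tau> by (intro mult_left_mono) auto
  moreover have "(fdiff \<tau> ^^ Suc (Suc r)) (\<phi> 0) t = \<tau> * ?\<psi>' s"
    using s(3) by (simp only: funpow.simps o_apply fdiff_def[of \<tau> "(fdiff \<tau> ^^ Suc r) (\<phi> 0)"]
        fdiff_def[of \<tau> "fdiff \<tau> ((fdiff \<tau> ^^ r) (\<phi> 0))"]) simp
  ultimately show ?case using \<tau> by (simp add: abs_mult mult.assoc del: funpow.simps)
qed

text \<open>Pairing with the difference quotient itself reduces the claim to a real-valued function of time, so
that no vector-valued integral is needed.\<close>

lemma l2_norm_dquot_le_integral:
  fixes F :: "nat \<Rightarrow> real \<Rightarrow> 'a::euclidean_space \<Rightarrow> real"
  assumes \<tau>: "0 < \<tau>"
    and L2: "\<And>t. in_L2 \<Omega> (F 0 t)" "\<And>t. in_L2 \<Omega> (F (Suc r) t)"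
    and deriv: "\<And>v j t. in_L2 \<Omega> v \<Longrightarrow> j \<le> r \<Longrightarrow>
      ((\<lambda>s. l2_inner \<Omega> (F j s) v) has_real_derivative l2_inner \<Omega> (F (Suc j) t) v) (at t)"
    and cont: "continuous_on UNIV (\<lambda>t. l2_norm \<Omega> (F (Suc r) t))"
  shows "l2_norm \<Omega> (dquot \<tau> (Suc r) (\<lambda>m. F 0 (of_int (m + 1) * \<tau>)) n)
    \<le> integral {of_int (n + 1) * \<tau>..of_int (n + 1) * \<tau> + real (Suc r) * \<tau>}
        (\<lambda>t. l2_norm \<Omega> (F (Suc r) t)) / \<tau>"
    (is "l2_norm \<Omega> ?G \<le> ?I / \<tau>")
proof -
  have LG: "in_L2 \<Omega> ?G" by (intro in_L2_dquot L2)
  define \<phi> where "\<phi> = (\<lambda>j s. l2_inner \<Omega> (F j s) ?G)"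
  have inner: "l2_inner \<Omega> (dquot \<tau> m (\<lambda>m. F 0 (of_int (m + 1) * \<tau>)) i) ?G
      = (fdiff \<tau> ^^ m) (\<phi> 0) (of_int (i + 1) * \<tau>) / \<tau> ^ m" for m i
  proof (induction m arbitrary: i)
    case (Suc m)
    have e: "of_int (i + 1 + 1) * \<tau> = of_int (i + 1) * \<tau> + \<tau>" by (simp add: algebra_simps)
    show ?case
      unfolding l2_inner_dquot_Suc[OF L2(1) LG] Suc[of "i + 1"] Suc[of i] e
      by (simp add: fdiff_def[of \<tau> "(fdiff \<tau> ^^ m) (\<phi> 0)"] diff_divide_distrib mult.commute)
  qed (simp add: \<phi>_def)
  have "\<bar>(fdiff \<tau> ^^ Suc r) (\<phi> 0) (of_int (n + 1) * \<tau>)\<bar>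
      \<le> \<tau> ^ r * integral {of_int (n + 1) * \<tau>..of_int (n + 1) * \<tau> + real (Suc r) * \<tau>}
          (\<lambda>t. l2_norm \<Omega> (F (Suc r) t) * l2_norm \<Omega> ?G)"
  proof (rule fdiff_pow_le_integral[OF \<tau>])
    show "(\<phi> j has_real_derivative \<phi> (Suc j) t) (at t)" if "j \<le> r" for j t
      unfolding \<phi>_def by (rule deriv[OF LG that])
    show "continuous_on UNIV (\<lambda>t. l2_norm \<Omega> (F (Suc r) t) * l2_norm \<Omega> ?G)"
      by (intro continuous_intros cont)
    show "\<bar>\<phi> (Suc r) t\<bar> \<le> l2_norm \<Omega> (F (Suc r) t) * l2_norm \<Omega> ?G" for t
      unfolding \<phi>_def by (rule l2_Cauchy_Schwarz[OF L2(2) LG])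
  qed
  also have "\<dots> = \<tau> ^ r * (?I * l2_norm \<Omega> ?G)" by simp
  finally have "\<bar>(fdiff \<tau> ^^ Suc r) (\<phi> 0) (of_int (n + 1) * \<tau>)\<bar> / \<tau> ^ Suc r
      \<le> (?I / \<tau>) * l2_norm \<Omega> ?G"
    using \<tau> by (simp add: field_simps del: funpow.simps)
  moreover have "(l2_norm \<Omega> ?G)\<^sup>2 \<le> \<bar>(fdiff \<tau> ^^ Suc r) (\<phi> 0) (of_int (n + 1) * \<tau>)\<bar> / \<tau> ^ Suc r"
    unfolding l2_norm_power2 inner using \<tau> by (intro divide_right_mono) auto
  ultimately have sq: "l2_norm \<Omega> ?G * l2_norm \<Omega> ?G \<le> (?I / \<tau>) * l2_norm \<Omega> ?G"
    by (simp add: power2_eq_square del: funpow.simps dquot.simps)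
  have "0 \<le> ?I" by (intro integral_nonneg integrable_continuous_interval
        continuous_on_subset[OF cont]) (auto simp: l2_norm_nonneg)
  then have nonneg: "0 \<le> ?I / \<tau>" using \<tau> by simp
  show ?thesis
  proof (cases "l2_norm \<Omega> ?G = 0")
    case True
    then show ?thesis using nonneg by simp
  next
    case False
    then have "0 < l2_norm \<Omega> ?G" using l2_norm_nonneg[of \<Omega> ?G] by linarith
    then show ?thesis by (rule mult_right_le_imp_le[OF sq])
  qed
qed

text \<open>Strong differentiability in time implies weak differentiability.\<close>

lemma has_l2_deriv_inner:
  assumes d: "has_l2_deriv \<Omega> f g t" and t: "t \<ge> 0"
    and f: "\<And>s. s \<ge> 0 \<Longrightarrow> in_L2 \<Omega> (f s)" and v: "in_L2 \<Omega> v"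
  shows "((\<lambda>s. l2_inner \<Omega> (f s) v) has_real_derivative l2_inner \<Omega> g v) (at t within {0..})"
proof -
  have g: "in_L2 \<Omega> g" and lim: "((\<lambda>s. l2_norm \<Omega> (\<lambda>x. (f s x - f t x) / (s - t) - g x)) \<longlongrightarrow> 0) (at t within {0..})"
    using d unfolding has_l2_deriv_def by auto
  have "((\<lambda>s. (l2_inner \<Omega> (f s) v - l2_inner \<Omega> (f t) v) / (s - t) - l2_inner \<Omega> g v) \<longlongrightarrow> 0)
      (at t within {0..})"
  proof (rule Lim_null_comparison)
    show "((\<lambda>s. l2_norm \<Omega> (\<lambda>x. (f s x - f t x) / (s - t) - g x) * l2_norm \<Omega> v) \<longlongrightarrow> 0) (at t within {0..})"
      by (rule tendsto_mult_left_zero[OF lim])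
    have "norm ((l2_inner \<Omega> (f s) v - l2_inner \<Omega> (f t) v) / (s - t) - l2_inner \<Omega> g v)
        \<le> l2_norm \<Omega> (\<lambda>x. (f s x - f t x) / (s - t) - g x) * l2_norm \<Omega> v" if s: "s \<ge> 0" for s
    proof -
      have e: "(\<lambda>x. (f s x - f t x) / (s - t) - g x)
          = (\<lambda>x. inverse (s - t) *\<^sub>R (f s x - f t x) + (-1) *\<^sub>R g x)"
        by (simp add: divide_inverse fun_eq_iff)
      have L: "in_L2 \<Omega> (\<lambda>x. f s x - f t x)" by (intro in_L2_diff f s t)
      have "l2_inner \<Omega> (\<lambda>x. (f s x - f t x) / (s - t) - g x) v
          = (l2_inner \<Omega> (f s) v - l2_inner \<Omega> (f t) v) / (s - t) - l2_inner \<Omega> g v"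
        unfolding e l2_inner_lincomb_left[OF L g v] l2_inner_diff_left[OF f[OF s] f[OF t] v]
        by (simp add: divide_inverse)
      moreover have "in_L2 \<Omega> (\<lambda>x. (f s x - f t x) / (s - t) - g x)"
        unfolding e by (intro in_L2_lincomb L g)
      ultimately show ?thesis using l2_Cauchy_Schwarz[OF _ v] by (metis real_norm_def)
    qed
    then show "\<forall>\<^sub>F s in at t within {0..}. norm ((l2_inner \<Omega> (f s) v - l2_inner \<Omega> (f t) v) / (s - t)
        - l2_inner \<Omega> g v) \<le> l2_norm \<Omega> (\<lambda>x. (f s x - f t x) / (s - t) - g x) * l2_norm \<Omega> v"
      by (auto simp: eventually_at_filter)
  qed
  then show ?thesis unfolding has_field_derivative_iff by (rule LIM_zero_cancel)
qed

lemma at_within_atLeast_neq_bot: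
  fixes t :: real
  assumes "0 \<le> t"
  shows "at t within {0..} \<noteq> bot"
proof -
  have "at_right t \<le> at t within {0..}" by (rule at_le) (use assms in auto)
  then show ?thesis using trivial_limit_at_right_real[of t] by (metis le_bot)
qed

definition ext_deriv :: "'a::euclidean_space set \<Rightarrow> (real \<Rightarrow> 'a \<Rightarrow> real) \<Rightarrow> nat \<Rightarrow> real \<Rightarrow> 'a \<Rightarrow> real" where
  "ext_deriv \<Omega> f j t = (if t < 0 then (\<lambda>x. 0) else (l2_deriv \<Omega> ^^ j) f t)"

text \<open>Since the source vanishes near time zero, so do its derivatives, because a derivative of a vanishing
function is orthogonal to every square-integrable function.  Therefore the extension by zero creates
no jump and is as regular as the source.\<close>

lemma ext_deriv_regularity:
  assumes src: "source_term \<Omega> f" and Cb: "l2_Cb \<Omega> r f"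
  shows "\<And>j t. j \<le> r \<Longrightarrow> in_L2 \<Omega> (ext_deriv \<Omega> f j t)"
    and "\<And>j t. j \<le> r \<Longrightarrow> t \<le> 0 \<Longrightarrow> l2_norm \<Omega> (ext_deriv \<Omega> f j t) = 0"
    and "\<And>v j t. in_L2 \<Omega> v \<Longrightarrow> j < r \<Longrightarrow>
      ((\<lambda>s. l2_inner \<Omega> (ext_deriv \<Omega> f j s) v) has_real_derivative
        l2_inner \<Omega> (ext_deriv \<Omega> f (Suc j) t) v) (at t)"
    and "\<And>j. j \<le> r \<Longrightarrow> continuous_on UNIV (\<lambda>t. l2_norm \<Omega> (ext_deriv \<Omega> f j t))"
proof -
  let ?F = "\<lambda>j. (l2_deriv \<Omega> ^^ j) f"
  have FL2: "in_L2 \<Omega> (?F j t)" if "j \<le> r" "t \<ge> 0" for j t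
    using Cb that unfolding l2_Cb_def l2_continuous_def by blast
  have Fd: "has_l2_deriv \<Omega> (?F j) (?F (Suc j) t) t" if "j < r" "t \<ge> 0" for j t
    using Cb that unfolding l2_Cb_def by blast
  have Fc: "((\<lambda>s. l2_norm \<Omega> (\<lambda>x. ?F j s x - ?F j t x)) \<longlongrightarrow> 0) (at t within {0..})"
    if "j \<le> r" "t \<ge> 0" for j t
    using Cb that unfolding l2_Cb_def l2_continuous_def by blast
  obtain t0 where t0: "t0 > 0" and z0: "\<And>t. 0 \<le> t \<Longrightarrow> t < t0 \<Longrightarrow> AE x in lebesgue_on \<Omega>. f t x = 0"
    using src unfolding source_term_def by blast
  show L2: "in_L2 \<Omega> (ext_deriv \<Omega> f j t)" if "j \<le> r" for j t
    using FL2[OF that] in_L2_zero unfolding ext_deriv_def by auto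
  have Fz: "l2_inner \<Omega> (?F j t) v = 0" if "j \<le> r" "0 \<le> t" "t < t0" "in_L2 \<Omega> v" for j t v
    using that(1-3)
  proof (induction j arbitrary: t)
    case 0
    have "l2_norm \<Omega> (f t) = 0"
      using l2_norm_eq_0_AE[OF z0] FL2[of 0 t] 0 by simp
    then show ?case
      using l2_Cauchy_Schwarz[OF FL2[of 0 t] that(4)] 0 by simp
  next
    case (Suc j)
    have "((\<lambda>s. l2_inner \<Omega> (?F j s) v) has_real_derivative l2_inner \<Omega> (?F (Suc j) t) v) (at t within {0..})"
      using Suc.prems by (intro has_l2_deriv_inner Fd FL2 that(4)) auto
    moreover have "((\<lambda>s. l2_inner \<Omega> (?F j s) v) has_real_derivative 0) (at t within {0..})"
    proof (rule has_field_derivative_transform_within[where f = "\<lambda>s. 0"])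
      show "0 < t0 - t" using Suc.prems by simp
      show "0 = l2_inner \<Omega> (?F j s) v" if "s \<in> {0..}" "dist s t < t0 - t" for s
        using Suc.IH[of s] Suc.prems that by (auto simp: dist_real_def)
    qed (use Suc.prems in auto)
    ultimately show ?case
      using tendsto_unique[OF at_within_atLeast_neq_bot[OF Suc.prems(2)]]
      unfolding has_field_derivative_iff by blast
  qed
  have z: "l2_inner \<Omega> (ext_deriv \<Omega> f j t) v = 0" if "j \<le> r" "t < t0" "in_L2 \<Omega> v" for j t v
    using Fz[of j t v] that unfolding ext_deriv_def
    by (cases "t < 0") (auto simp: l2_inner_def)
  have nz: "l2_norm \<Omega> (ext_deriv \<Omega> f j t) = 0" if "j \<le> r" "t < t0" for j t
    using z[OF that L2[OF that(1)]] unfolding l2_norm_def by simp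
  show "l2_norm \<Omega> (ext_deriv \<Omega> f j t) = 0" if "j \<le> r" "t \<le> 0" for j t
    using nz that t0 by simp
  \<comment> \<open>At positive times the one-sided and the two-sided limits are the same.\<close>
  have at_eq: "at t within {0<..} = at t" if "t > 0" for t :: real
    using that by (intro at_within_open) auto
  show "((\<lambda>s. l2_inner \<Omega> (ext_deriv \<Omega> f j s) v) has_real_derivative
        l2_inner \<Omega> (ext_deriv \<Omega> f (Suc j) t) v) (at t)" if v: "in_L2 \<Omega> v" and j: "j < r" for v j t
  proof (cases "t < t0")
    case True
    have "((\<lambda>s. l2_inner \<Omega> (ext_deriv \<Omega> f j s) v) has_real_derivative 0) (at t)"
    proof (rule has_field_derivative_transform_within_open[where f = "\<lambda>s. 0" and S = "{..<t0}"])
      show "0 = l2_inner \<Omega> (ext_deriv \<Omega> f j s) v" if "s \<in> {..<t0}" for s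
        using z[of j s v] that v j by simp
    qed (use True in auto)
    then show ?thesis using z[of "Suc j" t v] True v j by simp
  next
    case False
    then have t: "t > 0" using t0 by simp
    have "((\<lambda>s. l2_inner \<Omega> (?F j s) v) has_real_derivative l2_inner \<Omega> (?F (Suc j) t) v) (at t within {0..})"
      using j t by (intro has_l2_deriv_inner Fd FL2 v) auto
    then have "((\<lambda>s. l2_inner \<Omega> (?F j s) v) has_real_derivative l2_inner \<Omega> (?F (Suc j) t) v) (at t within {0<..})"
      by (rule DERIV_subset) auto
    then have "((\<lambda>s. l2_inner \<Omega> (?F j s) v) has_real_derivative l2_inner \<Omega> (?F (Suc j) t) v) (at t)"
      unfolding at_eq[OF t] .
    then have "((\<lambda>s. l2_inner \<Omega> (ext_deriv \<Omega> f j s) v) has_real_derivative l2_inner \<Omega> (?F (Suc j) t) v) (at t)"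
      by (rule has_field_derivative_transform_within_open[where S = "{0<..}"])
        (use t in \<open>auto simp: ext_deriv_def\<close>)
    then show ?thesis using t by (simp add: ext_deriv_def del: funpow.simps)
  qed
  show "continuous_on UNIV (\<lambda>t. l2_norm \<Omega> (ext_deriv \<Omega> f j t))" if j: "j \<le> r" for j
  proof (intro continuous_at_imp_continuous_on ballI)
    fix t :: real
    show "isCont (\<lambda>t. l2_norm \<Omega> (ext_deriv \<Omega> f j t)) t"
    proof (cases "t < t0")
      case True
      have "\<forall>\<^sub>F s in at t. s \<in> {..<t0}"
        using True by (intro eventually_at_in_open') auto
      then have "((\<lambda>s. l2_norm \<Omega> (ext_deriv \<Omega> f j s)) \<longlongrightarrow> 0) (at t)"
        by (intro tendsto_eventually) (auto elim!: eventually_mono simp: nz[OF j])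
      then show ?thesis unfolding isCont_def using nz[OF j True] by simp
    next
      case False
      then have t: "t > 0" using t0 by simp
      have "((\<lambda>s. l2_norm \<Omega> (\<lambda>x. ?F j s x - ?F j t x)) \<longlongrightarrow> 0) (at t within {0<..})"
        using t by (intro tendsto_within_subset[OF Fc[OF j]]) auto
      then have lim: "((\<lambda>s. l2_norm \<Omega> (\<lambda>x. ?F j s x - ?F j t x)) \<longlongrightarrow> 0) (at t)"
        unfolding at_eq[OF t] .
      have "((\<lambda>s. l2_norm \<Omega> (ext_deriv \<Omega> f j s) - l2_norm \<Omega> (ext_deriv \<Omega> f j t)) \<longlongrightarrow> 0) (at t)"
      proof (rule Lim_null_comparison[OF _ lim])
        have "norm (l2_norm \<Omega> (ext_deriv \<Omega> f j s) - l2_norm \<Omega> (ext_deriv \<Omega> f j t))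
            \<le> l2_norm \<Omega> (\<lambda>x. ?F j s x - ?F j t x)" if s: "s > 0" for s
        proof -
          have a: "in_L2 \<Omega> (?F j s)" and b: "in_L2 \<Omega> (?F j t)" using FL2[OF j] s t by auto
          note d = in_L2_diff[OF a b]
          have "l2_norm \<Omega> (?F j s) \<le> l2_norm \<Omega> (\<lambda>x. ?F j s x - ?F j t x) + l2_norm \<Omega> (?F j t)"
            using l2_norm_lincomb_le[OF d b, of 1 1] by simp
          moreover have "l2_norm \<Omega> (?F j t) \<le> l2_norm \<Omega> (?F j s) + l2_norm \<Omega> (\<lambda>x. ?F j s x - ?F j t x)"
            using l2_norm_lincomb_le[OF a d, of 1 "-1"] by simp
          ultimately show ?thesis using s t by (simp add: ext_deriv_def)
        qed
        moreover have "\<forall>\<^sub>F s in at t. s \<in> {0<..}"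
          using t by (intro eventually_at_in_open') auto
        ultimately show "\<forall>\<^sub>F s in at t. norm (l2_norm \<Omega> (ext_deriv \<Omega> f j s) - l2_norm \<Omega> (ext_deriv \<Omega> f j t))
            \<le> l2_norm \<Omega> (\<lambda>x. ?F j s x - ?F j t x)"
          by (auto elim!: eventually_mono)
      qed
      then show ?thesis unfolding isCont_def by (rule LIM_zero_cancel)
    qed
  qed
qed

text \<open>The Cauchy-Schwarz inequality with a constant, in the form that the variance of \<open>N\<close> is nonnegative.\<close>

lemma integral_power2_le:
  fixes N :: "real \<Rightarrow> real"
  assumes "continuous_on {a..b} N" "a < b"
  shows "(integral {a..b} N)\<^sup>2 \<le> (b - a) * integral {a..b} (\<lambda>t. (N t)\<^sup>2)"
proof -
  define I where "I = integral {a..b} N"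
  define c where "c = I / (b - a)"
  have int: "N integrable_on {a..b}" "(\<lambda>t. (N t)\<^sup>2) integrable_on {a..b}"
    using assms(1) by (auto intro!: integrable_continuous_interval continuous_intros)
  have "0 \<le> integral {a..b} (\<lambda>t. (N t - c)\<^sup>2)"
    by (intro integral_nonneg integrable_continuous_interval continuous_intros assms(1)) auto
  also have "(\<lambda>t. (N t - c)\<^sup>2) = (\<lambda>t. (N t)\<^sup>2 - 2 * c * N t + c\<^sup>2)"
    by (simp add: fun_eq_iff power2_diff)
  also have "integral {a..b} (\<lambda>t. (N t)\<^sup>2 - 2 * c * N t + c\<^sup>2)
      = integral {a..b} (\<lambda>t. (N t)\<^sup>2) - 2 * c * I + c\<^sup>2 * (b - a)"
  proof -
    have 1: "(\<lambda>t. 2 * c * N t) integrable_on {a..b}" by (intro integrable_on_mult_right int)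
    then have 2: "(\<lambda>t. (N t)\<^sup>2 - 2 * c * N t) integrable_on {a..b}" by (intro integrable_diff int)
    show ?thesis
      unfolding Henstock_Kurzweil_Integration.integral_add[OF 2 integrable_const_ivl]
        Henstock_Kurzweil_Integration.integral_diff[OF int(2) 1] I_def using assms(2) by simp
  qed
  finally have "2 * c * I - c\<^sup>2 * (b - a) \<le> integral {a..b} (\<lambda>t. (N t)\<^sup>2)" by simp
  also have "2 * c * I - c\<^sup>2 * (b - a) = I\<^sup>2 / (b - a)"
  proof -
    have "2 * (I / L) * I - (I / L)\<^sup>2 * L = I\<^sup>2 / L" if "L > 0" for L
      using that by (simp add: field_simps power2_eq_square)
    then show ?thesis using assms(2) unfolding c_def by simp
  qed
  finally have "I\<^sup>2 / (b - a) * (b - a) \<le> integral {a..b} (\<lambda>t. (N t)\<^sup>2) * (b - a)"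
    using assms(2) by (intro mult_right_mono) auto
  then show ?thesis using assms(2) unfolding I_def by (simp add: mult.commute)
qed

lemma sum_telescope_3:
  fixes P :: "nat \<Rightarrow> real"
  assumes "\<And>k. 0 \<le> P k"
  shows "(\<Sum>n\<le>K. P (n + 3) - P n) \<le> P (K + 3) + P (K + 2) + P (K + 1)"
proof (induction K)
  case 0
  show ?case using assms[of 0] assms[of 1] assms[of 2] by (simp add: numeral_3_eq_3 numeral_2_eq_2)
next
  case (Suc K)
  have "(\<Sum>n\<le>Suc K. P (n + 3) - P n) \<le> P (K + 3) + P (K + 2) + P (K + 1) + (P (Suc K + 3) - P (Suc K))"
    using Suc by simp
  then show ?case by (simp add: eval_nat_numeral)
qed

text \<open>Each window \<open>[(n - 2) \<tau>, (n + 1) \<tau>]\<close> has length \<open>3 \<tau>\<close>, the weight varies on it by a bounded factor,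
and each point of the half line lies in three windows.  The windows start at \<open>- 2 \<tau>\<close>, where \<open>N\<close>
vanishes.\<close>

lemma damped_window_sum:
  fixes N :: "real \<Rightarrow> real" and s :: "nat \<Rightarrow> real"
  assumes pos: "0 < \<tau>" "0 < \<rho>" "\<rho> * \<tau> \<le> 1"
    and N: "continuous_on UNIV N" "\<And>t. t \<le> 0 \<Longrightarrow> N t = 0"
    and s: "\<And>n. 0 \<le> s n" "\<And>n. s n \<le> integral {(real n - 2) * \<tau>..(real n + 1) * \<tau>} N / \<tau>"
  shows "\<tau> * (\<Sum>n\<le>K. exp (- 2 * \<rho> * \<tau>) ^ n * (s n)\<^sup>2)
    \<le> 9 * exp 2 * integral {0..(real K + 1) * \<tau>} (\<lambda>t. (N t)\<^sup>2 * exp (- 2 * \<rho> * t))"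
proof -
  define M where "M = (\<lambda>t. (N t)\<^sup>2 * exp (- 2 * \<rho> * t))"
  have M: "continuous_on UNIV M" unfolding M_def by (intro continuous_intros N(1))
  have M0: "0 \<le> M t" for t by (simp add: M_def)
  have Mi: "M integrable_on {a..b}" for a b
    by (intro integrable_continuous_interval continuous_on_subset[OF M]) simp
  have N2i: "(\<lambda>t. (N t)\<^sup>2) integrable_on {a..b}" for a b
    by (intro integrable_continuous_interval continuous_intros continuous_on_subset[OF N(1)]) simp
  \<comment> \<open>The integral over the window with index \<open>n\<close> is \<open>P (n + 3) - P n\<close>, so that the sum telescopes.\<close>
  define P where "P = (\<lambda>k::nat. integral {- 2 * \<tau>..(real k - 2) * \<tau>} M)"
  have P0: "0 \<le> P k" for k unfolding P_def by (intro integral_nonneg Mi M0)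
  have weighted: "\<tau> * (exp (- 2 * \<rho> * \<tau>) ^ n * (s n)\<^sup>2) \<le> 3 * exp 2 * (P (n + 3) - P n)" for n
  proof -
    let ?a = "(real n - 2) * \<tau>" and ?b = "(real n + 1) * \<tau>"
    have ab: "?a < ?b" and len: "?b - ?a = 3 * \<tau>" using pos(1) by (auto simp: algebra_simps)
    have "(\<tau> * s n)\<^sup>2 \<le> (integral {?a..?b} N)\<^sup>2"
      using s[of n] pos(1) by (intro power_mono) (auto simp: field_simps)
    also have "\<dots> \<le> 3 * \<tau> * integral {?a..?b} (\<lambda>t. (N t)\<^sup>2)"
      using integral_power2_le[OF continuous_on_subset[OF N(1)] ab] unfolding len by simp
    finally have "\<tau> * (\<tau> * (s n)\<^sup>2) \<le> \<tau> * (3 * integral {?a..?b} (\<lambda>t. (N t)\<^sup>2))"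
      by (simp add: power2_eq_square algebra_simps)
    then have sn: "\<tau> * (s n)\<^sup>2 \<le> 3 * integral {?a..?b} (\<lambda>t. (N t)\<^sup>2)"
      using pos(1) by (simp only: mult_le_cancel_left_pos)
    have qn: "exp (- 2 * \<rho> * \<tau>) ^ n = exp (- 2 * \<rho> * (real n * \<tau>))"
      by (simp add: exp_of_nat_mult[symmetric] algebra_simps)
    have "exp (- 2 * \<rho> * \<tau>) ^ n * integral {?a..?b} (\<lambda>t. (N t)\<^sup>2)
        = integral {?a..?b} (\<lambda>t. exp (- 2 * \<rho> * \<tau>) ^ n * (N t)\<^sup>2)" by simp
    also have "\<dots> \<le> integral {?a..?b} (\<lambda>t. exp 2 * M t)"
    proof (rule integral_le)
      fix t assume t: "t \<in> {?a..?b}"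
      then have "\<rho> * t \<le> \<rho> * (real n * \<tau>) + \<rho> * \<tau>"
        using mult_left_mono[of t ?b \<rho>] pos(2) by (auto simp: algebra_simps)
      then have "- 2 * \<rho> * (real n * \<tau>) \<le> 2 + - 2 * \<rho> * t" using pos(3) by simp
      then have "exp (- 2 * \<rho> * (real n * \<tau>)) \<le> exp (2 + - 2 * \<rho> * t)" by (simp only: exp_le_cancel_iff)
      then have "exp (- 2 * \<rho> * (real n * \<tau>)) \<le> exp 2 * exp (- 2 * \<rho> * t)" by (simp only: exp_add)
      then have "exp (- 2 * \<rho> * (real n * \<tau>)) * (N t)\<^sup>2 \<le> exp 2 * exp (- 2 * \<rho> * t) * (N t)\<^sup>2"
        by (rule mult_right_mono) simp
      then show "exp (- 2 * \<rho> * \<tau>) ^ n * (N t)\<^sup>2 \<le> exp 2 * M t"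
        unfolding qn M_def by (simp only: mult_ac)
    qed (intro integrable_on_mult_right N2i Mi)+
    also have "\<dots> = exp 2 * integral {?a..?b} M" by simp
    finally have w: "exp (- 2 * \<rho> * \<tau>) ^ n * integral {?a..?b} (\<lambda>t. (N t)\<^sup>2) \<le> exp 2 * integral {?a..?b} M" .
    have "P n + integral {?a..?b} M = P (n + 3)"
      unfolding P_def using pos(1)
      by (subst Henstock_Kurzweil_Integration.integral_combine) (auto intro: Mi simp: algebra_simps)
    then have W: "integral {?a..?b} M = P (n + 3) - P n" by simp
    have "\<tau> * (exp (- 2 * \<rho> * \<tau>) ^ n * (s n)\<^sup>2) = exp (- 2 * \<rho> * \<tau>) ^ n * (\<tau> * (s n)\<^sup>2)"
      by (simp only: mult_ac)
    also have "\<dots> \<le> exp (- 2 * \<rho> * \<tau>) ^ n * (3 * integral {?a..?b} (\<lambda>t. (N t)\<^sup>2))"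
      by (intro mult_left_mono sn) simp
    also have "\<dots> \<le> 3 * exp 2 * integral {?a..?b} M" using w by simp
    finally show ?thesis unfolding W .
  qed
  have mono: "P i \<le> P (K + 3)" if "i \<le> K + 3" for i
    unfolding P_def
  proof (rule integral_subset_le[OF _ Mi Mi])
    have "(real i - 2) * \<tau> \<le> (real (K + 3) - 2) * \<tau>"
      using that pos(1) by (intro mult_right_mono) auto
    then show "{- 2 * \<tau>..(real i - 2) * \<tau>} \<subseteq> {- 2 * \<tau>..(real (K + 3) - 2) * \<tau>}" by auto
  qed (use M0 in blast)
  have "\<tau> * (\<Sum>n\<le>K. exp (- 2 * \<rho> * \<tau>) ^ n * (s n)\<^sup>2) \<le> (\<Sum>n\<le>K. 3 * exp 2 * (P (n + 3) - P n))"
    unfolding sum_distrib_left by (intro sum_mono weighted)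
  also have "\<dots> = 3 * exp 2 * (\<Sum>n\<le>K. P (n + 3) - P n)" by (simp only: sum_distrib_left)
  also have "\<dots> \<le> 3 * exp 2 * (3 * P (K + 3))"
    using sum_telescope_3[of P K, OF P0] mono[of "K + 2"] mono[of "K + 1"]
    by (intro mult_left_mono) auto
  also have "P (K + 3) = integral {0..(real K + 1) * \<tau>} M"
  proof -
    have "integral {- 2 * \<tau>..0} M = integral {- 2 * \<tau>..0} (\<lambda>t. 0)"
      by (rule Henstock_Kurzweil_Integration.integral_cong) (auto simp: M_def N(2))
    moreover have "integral {- 2 * \<tau>..0} M + integral {0..(real K + 1) * \<tau>} M = integral {- 2 * \<tau>..(real K + 1) * \<tau>} M"
      using pos(1) by (intro Henstock_Kurzweil_Integration.integral_combine Mi) auto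
    ultimately show ?thesis unfolding P_def by (simp add: algebra_simps)
  qed
  finally show ?thesis unfolding M_def by simp
qed

lemma integral_le_damped_integral:
  fixes N :: "real \<Rightarrow> real"
  assumes "continuous_on UNIV N"
  shows "ennreal (integral {0..T} (\<lambda>t. (N t)\<^sup>2 * exp (- 2 * \<rho> * t))) \<le> damped_integral \<rho> (\<lambda>t. (N t)\<^sup>2)"
proof -
  define M where "M = (\<lambda>t. (N t)\<^sup>2 * exp (- 2 * \<rho> * t))"
  have M: "continuous_on UNIV M" unfolding M_def by (intro continuous_intros assms)
  have "(M has_integral integral {0..T} M) {0..T}"
    by (intro integrable_integral integrable_continuous_interval continuous_on_subset[OF M]) simp
  then have "(\<integral>\<^sup>+t. ennreal (M t) * indicator {0..T} t \<partial>lborel) = ennreal (integral {0..T} M)"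
    by (intro nn_integral_has_integral_lebesgue') (simp add: M_def)
  moreover have "(\<integral>\<^sup>+t. ennreal (M t) * indicator {0..T} t \<partial>lborel) \<le> (\<integral>\<^sup>+t. ennreal (M t) * indicator {0..} t \<partial>lborel)"
    by (intro nn_integral_mono mult_left_mono) (auto split: split_indicator)
  ultimately show ?thesis unfolding damped_integral_def M_def by simp
qed

section \<open>Time reconstructions in terms of difference quotients\<close>

text \<open>On the half-open time slab a point is not isolated, so a local derivative is the derivative of any
function that is differentiable on the line and agrees on the slab.\<close>

lemma local_deriv_eq:
  assumes \<tau>: "0 < \<tau>" and n: "\<lfloor>t / \<tau>\<rfloor> = n"
    and w: "\<And>s. \<lfloor>s / \<tau>\<rfloor> = n \<Longrightarrow> w s x = p (s - of_int n * \<tau>)"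
    and p: "(p has_real_derivative d) (at (t - of_int n * \<tau>))"
  shows "local_deriv \<tau> w t x = d"
proof -
  let ?J = "{of_int n * \<tau> ..< (of_int n + 1) * \<tau>}"
  have J: "s \<in> ?J \<longleftrightarrow> \<lfloor>s / \<tau>\<rfloor> = n" for s
    using \<tau> by (simp add: floor_eq_iff pos_le_divide_eq pos_divide_less_eq)
  then have t: "t \<in> ?J" using n by blast
  have "((\<lambda>s. p (s - of_int n * \<tau>)) has_real_derivative d) (at t)"
    using p DERIV_shift[of p d t "- (of_int n * \<tau>)"] by simp
  then have p': "((\<lambda>s. p (s - of_int n * \<tau>)) has_vector_derivative d) (at t within ?J)"
    by (simp add: has_real_derivative_iff_has_vector_derivative has_vector_derivative_at_within)
  have "((\<lambda>s. w s x) has_vector_derivative d) (at t within ?J)"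
    by (rule has_vector_derivative_transform[OF t _ p']) (use J w in blast)
  moreover have "at t within ?J \<noteq> bot"
  proof
    assume bot: "at t within ?J = bot"
    have "at_right t = at t within {t<..<(of_int n + 1) * \<tau>}"
      using t by (intro at_within_nhd[where S = "{..<(of_int n + 1) * \<tau>}"]) auto
    also have "\<dots> \<le> at t within ?J" by (rule at_le) (use t in auto)
    finally show False using bot trivial_limit_at_right_real[of t] by (metis le_bot)
  qed
  ultimately show ?thesis
    unfolding local_deriv_def n by (intro vector_derivative_within)
qed

text \<open>The coefficients, in the local time \<open>s\<close>, of the difference of the two reconstructions with respect
to the second difference quotients with indices \<open>n - i\<close>, where \<open>i\<close> is \<open>0\<close>, \<open>1\<close> or \<open>2\<close>.\<close>

definition defect_coeff :: "real \<Rightarrow> nat \<Rightarrow> real \<Rightarrow> real" where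
  "defect_coeff \<tau> i s =
     (if i = 0 then - (s ^ 3 / (12 * \<tau>) + s ^ 4 / (24 * \<tau>\<^sup>2))
      else if i = 1 then - \<tau>\<^sup>2 / 8 + \<tau> * s / 12 + s ^ 4 / (12 * \<tau>\<^sup>2)
      else \<tau>\<^sup>2 / 24 - \<tau> * s / 12 + s ^ 3 / (12 * \<tau>) - s ^ 4 / (24 * \<tau>\<^sup>2))"

text \<open>The coefficients of the time derivative of this difference with respect to the third difference
quotients with indices \<open>n - 1\<close> (for \<open>i = 0\<close>) and \<open>n - 2\<close>.  They arise from the derivatives of
\<open>defect_coeff\<close>, whose sum vanishes, by summation by parts.\<close>

definition defect_coeff_deriv :: "real \<Rightarrow> nat \<Rightarrow> real \<Rightarrow> real" where
  "defect_coeff_deriv \<tau> i s =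
     (if i = 0 then - (s\<^sup>2 / 4 + s ^ 3 / (6 * \<tau>))
      else \<tau>\<^sup>2 / 12 - s\<^sup>2 / 4 + s ^ 3 / (6 * \<tau>))"

lemma scaled_time_powers_le:
  fixes s \<tau> :: real
  assumes "0 < \<tau>" "0 \<le> s" "s \<le> \<tau>"
  shows "0 \<le> \<tau> * s" "\<tau> * s \<le> \<tau>\<^sup>2" "0 \<le> s\<^sup>2" "s\<^sup>2 \<le> \<tau>\<^sup>2" "0 \<le> s ^ 3 / \<tau>" "s ^ 3 / \<tau> \<le> \<tau>\<^sup>2"
    "0 \<le> s ^ 4 / \<tau>\<^sup>2" "s ^ 4 / \<tau>\<^sup>2 \<le> \<tau>\<^sup>2"
proof -
  show "\<tau> * s \<le> \<tau>\<^sup>2" using assms by (simp add: power2_eq_square)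
  show "s\<^sup>2 \<le> \<tau>\<^sup>2" using assms by (simp add: power_mono)
  have "s ^ 3 \<le> \<tau> ^ 3" using assms by (intro power_mono)
  also have "\<tau> ^ 3 = \<tau>\<^sup>2 * \<tau>" by (simp add: eval_nat_numeral)
  finally show "s ^ 3 / \<tau> \<le> \<tau>\<^sup>2" using assms by (simp add: pos_divide_le_eq)
  have "s ^ 4 \<le> \<tau> ^ 4" using assms by (intro power_mono)
  also have "\<tau> ^ 4 = \<tau>\<^sup>2 * \<tau>\<^sup>2" by (simp add: eval_nat_numeral)
  finally show "s ^ 4 / \<tau>\<^sup>2 \<le> \<tau>\<^sup>2" using assms by (simp add: pos_divide_le_eq)
qed (use assms in auto)

lemma defect_coeff_bound:
  assumes "0 < \<tau>" "0 \<le> s" "s \<le> \<tau>"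
  shows "\<bar>defect_coeff \<tau> i s\<bar> \<le> \<tau>\<^sup>2"
proof -
  have e: "s ^ 3 / (12 * \<tau>) = (s ^ 3 / \<tau>) / 12" "s ^ 4 / (24 * \<tau>\<^sup>2) = (s ^ 4 / \<tau>\<^sup>2) / 24"
    "s ^ 4 / (12 * \<tau>\<^sup>2) = (s ^ 4 / \<tau>\<^sup>2) / 12" by simp_all
  note b = scaled_time_powers_le[OF assms]
  have 0: "\<bar>- (c / 12 + d / 24)\<bar> \<le> T" if "0 \<le> c" "c \<le> T" "0 \<le> d" "d \<le> T" for c d T :: real
    using that by linarith
  have 1: "\<bar>- T / 8 + a / 12 + d / 12\<bar> \<le> T" if "0 \<le> a" "a \<le> T" "0 \<le> d" "d \<le> T" for a d T :: real
    using that by linarith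
  have 2: "\<bar>T / 24 - a / 12 + c / 12 - d / 24\<bar> \<le> T"
    if "0 \<le> a" "a \<le> T" "0 \<le> c" "c \<le> T" "0 \<le> d" "d \<le> T" for a c d T :: real
    using that by linarith
  show ?thesis
    unfolding defect_coeff_def e using 0[OF b(5-8)] 1[OF b(1,2,7,8)] 2[OF b(1,2,5-8)] by presburger
qed

lemma defect_coeff_deriv_bound:
  assumes "0 < \<tau>" "0 \<le> s" "s \<le> \<tau>"
  shows "\<bar>defect_coeff_deriv \<tau> i s\<bar> \<le> \<tau>\<^sup>2"
proof -
  have e: "s ^ 3 / (6 * \<tau>) = (s ^ 3 / \<tau>) / 6" by simp
  note b = scaled_time_powers_le[OF assms]
  have 0: "\<bar>- (a / 4 + c / 6)\<bar> \<le> T" if "0 \<le> a" "a \<le> T" "0 \<le> c" "c \<le> T" for a c T :: real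
    using that by linarith
  have 1: "\<bar>T / 12 - a / 4 + c / 6\<bar> \<le> T" if "0 \<le> a" "a \<le> T" "0 \<le> c" "c \<le> T" for a c T :: real
    using that by linarith
  show ?thesis
    unfolding defect_coeff_deriv_def e using 0[OF b(3-6)] 1[OF b(3-6)] by presburger
qed

lemma dquot_2: "dquot \<tau> 2 W n x = (W (n + 2) x - 2 * W (n + 1) x + W n x) / \<tau>\<^sup>2"
  for W :: "int \<Rightarrow> 'a \<Rightarrow> real"
  by (simp add: numeral_2_eq_2 divide_inverse algebra_simps)

lemma dquot_3: "dquot \<tau> 3 W n x = (dquot \<tau> 2 W (n + 1) x - dquot \<tau> 2 W n x) / \<tau>"
  for W :: "int \<Rightarrow> 'a \<Rightarrow> real"
  by (simp add: numeral_3_eq_3 numeral_2_eq_2 divide_inverse mult.commute)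

text \<open>Both reconstructions have the same quadratic coefficient.  The differences of the two lower
coefficients, and the cubic and quartic coefficients of \<open>L\<close>, annihilate constant and linear
sequences, hence are combinations of second differences.\<close>

lemma recR_minus_recL:
  fixes U :: "nat \<Rightarrow> 'a \<Rightarrow> real"
  assumes \<tau>: "0 < \<tau>" and n: "\<lfloor>t / \<tau>\<rfloor> = n"
  defines "s \<equiv> t - of_int n * \<tau>" and "A \<equiv> dquot \<tau> 2 (zero_ext U)"
  shows "recR \<tau> U t x - recL \<tau> U t x = defect_coeff \<tau> 0 s * A n x
    + defect_coeff \<tau> 1 s * A (n - 1) x + defect_coeff \<tau> 2 s * A (n - 2) x"
proof -
  define a b c d e where "a = zero_ext U (n + 2) x" and "b = zero_ext U (n + 1) x"
    and "c = zero_ext U n x" and "d = zero_ext U (n - 1) x" and "e = zero_ext U (n - 2) x"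
  have index: "n - 1 + 1 = n" "n - 1 + 2 = n + 1" "n - 2 + 1 = n - 1" "n - 2 + 2 = n" by simp_all
  have A: "A n x = (a - 2 * b + c) / \<tau>\<^sup>2" "A (n - 1) x = (b - 2 * c + d) / \<tau>\<^sup>2"
    "A (n - 2) x = (c - 2 * d + e) / \<tau>\<^sup>2"
    unfolding A_def dquot_2 index a_def b_def c_def d_def e_def by (rule refl)+
  have R: "recR \<tau> U t x = c + (b - d) / (2 * \<tau>) * s + (b - 2 * c + d) / \<tau>\<^sup>2 * (1 / 2) * s\<^sup>2"
    unfolding recR_def n Let_def s_def[symmetric] a_def b_def c_def d_def e_def by simp
  have L: "recL \<tau> U t x = (3 * b + 17 * c + 5 * d - e) / 24 + (5 * b + 3 * c - 9 * d + e) / (12 * \<tau>) * s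
      + (b - 2 * c + d) / \<tau>\<^sup>2 * (1 / 2) * s\<^sup>2 + (a - 2 * b + 2 * d - e) / (2 * \<tau> ^ 3) * (1 / 6) * s ^ 3
      + (a - 4 * b + 6 * c - 4 * d + e) / \<tau> ^ 4 * (1 / 24) * s ^ 4"
    unfolding recL_def n Let_def s_def[symmetric] a_def b_def c_def d_def e_def by simp
  show ?thesis
    unfolding A R L defect_coeff_def using \<tau>
    by (simp add: field_simps eval_nat_numeral)
qed

lemma local_deriv_defect:
  fixes U :: "nat \<Rightarrow> 'a \<Rightarrow> real"
  assumes \<tau>: "0 < \<tau>" and n: "\<lfloor>t / \<tau>\<rfloor> = n"
  defines "s \<equiv> t - of_int n * \<tau>" and "B \<equiv> dquot \<tau> 3 (zero_ext U)"
  shows "local_deriv \<tau> (\<lambda>t x. recR \<tau> U t x - recL \<tau> U t x) t x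
    = defect_coeff_deriv \<tau> 0 s * B (n - 1) x + defect_coeff_deriv \<tau> 1 s * B (n - 2) x"
proof -
  let ?A = "dquot \<tau> 2 (zero_ext U)"
  let ?p = "\<lambda>s. defect_coeff \<tau> 0 s * ?A n x + defect_coeff \<tau> 1 s * ?A (n - 1) x
    + defect_coeff \<tau> 2 s * ?A (n - 2) x"
  show ?thesis
  proof (rule local_deriv_eq[OF \<tau> n, where p = ?p])
    show "recR \<tau> U s x - recL \<tau> U s x = ?p (s - of_int n * \<tau>)" if "\<lfloor>s / \<tau>\<rfloor> = n" for s
      by (rule recR_minus_recL[OF \<tau> that])
    have B: "B (n - 1) x = (?A n x - ?A (n - 1) x) / \<tau>" "B (n - 2) x = (?A (n - 1) x - ?A (n - 2) x) / \<tau>"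
      unfolding B_def dquot_3 by simp_all
    have d: "(defect_coeff \<tau> 0 has_real_derivative defect_coeff_deriv \<tau> 0 s / \<tau>) (at s)"
      "(defect_coeff \<tau> 1 has_real_derivative (defect_coeff_deriv \<tau> 1 s - defect_coeff_deriv \<tau> 0 s) / \<tau>) (at s)"
      "(defect_coeff \<tau> 2 has_real_derivative - defect_coeff_deriv \<tau> 1 s / \<tau>) (at s)"
      unfolding defect_coeff_def[abs_def] defect_coeff_deriv_def
      using \<tau> by (auto intro!: derivative_eq_intros simp: field_simps eval_nat_numeral)
    have "(?p has_real_derivative defect_coeff_deriv \<tau> 0 s / \<tau> * ?A n x
        + (defect_coeff_deriv \<tau> 1 s - defect_coeff_deriv \<tau> 0 s) / \<tau> * ?A (n - 1) x
        + - defect_coeff_deriv \<tau> 1 s / \<tau> * ?A (n - 2) x) (at s)"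
      by (intro DERIV_add DERIV_cmult_right d)
    then show "(?p has_real_derivative defect_coeff_deriv \<tau> 0 s * B (n - 1) x
        + defect_coeff_deriv \<tau> 1 s * B (n - 2) x) (at (t - of_int n * \<tau>))"
      unfolding s_def[symmetric] B
      by (rule DERIV_cong) (simp add: diff_divide_distrib algebra_simps)
  qed
qed

lemma local_deriv_3_recL:
  fixes U :: "nat \<Rightarrow> 'a \<Rightarrow> real"
  assumes \<tau>: "0 < \<tau>" and n: "\<lfloor>t / \<tau>\<rfloor> = n"
  defines "s \<equiv> t - of_int n * \<tau>" and "B \<equiv> dquot \<tau> 3 (zero_ext U)"
  shows "(local_deriv \<tau> ^^ 3) (recL \<tau> U) t x
    = (1 / 2 + s / \<tau>) * B (n - 1) x + (1 / 2 - s / \<tau>) * B (n - 2) x"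
proof -
  define a b c d e where "a = zero_ext U (n + 2) x" and "b = zero_ext U (n + 1) x"
    and "c = zero_ext U n x" and "d = zero_ext U (n - 1) x" and "e = zero_ext U (n - 2) x"
  define \<alpha> \<beta> \<gamma> \<theta> \<epsilon> where "\<alpha> = (3 * b + 17 * c + 5 * d - e) / 24"
    and "\<beta> = (5 * b + 3 * c - 9 * d + e) / (12 * \<tau>)" and "\<gamma> = (b - 2 * c + d) / \<tau>\<^sup>2"
    and "\<theta> = (a - 2 * b + 2 * d - e) / (2 * \<tau> ^ 3)" and "\<epsilon> = (a - 4 * b + 6 * c - 4 * d + e) / \<tau> ^ 4"
  let ?p0 = "\<lambda>s. \<alpha> + \<beta> * s + \<gamma> * (1/2) * s\<^sup>2 + \<theta> * (1/6) * s ^ 3 + \<epsilon> * (1/24) * s ^ 4"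
  let ?p1 = "\<lambda>s. \<beta> + \<gamma> * s + \<theta> * (1/2) * s\<^sup>2 + \<epsilon> * (1/6) * s ^ 3"
  let ?p2 = "\<lambda>s. \<gamma> + \<theta> * s + \<epsilon> * (1/2) * s\<^sup>2"
  let ?p3 = "\<lambda>s. \<theta> + \<epsilon> * s"
  have L: "recL \<tau> U r x = ?p0 (r - of_int n * \<tau>)" if "\<lfloor>r / \<tau>\<rfloor> = n" for r
    unfolding recL_def that Let_def \<alpha>_def \<beta>_def \<gamma>_def \<theta>_def \<epsilon>_def a_def b_def c_def d_def e_def by simp
  have p: "(?p0 has_real_derivative ?p1 z) (at z)" "(?p1 has_real_derivative ?p2 z) (at z)"
    "(?p2 has_real_derivative ?p3 z) (at z)" for z
    by (auto intro!: derivative_eq_intros simp: field_simps eval_nat_numeral)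
  have L1: "local_deriv \<tau> (recL \<tau> U) r x = ?p1 (r - of_int n * \<tau>)" if r: "\<lfloor>r / \<tau>\<rfloor> = n" for r
    by (rule local_deriv_eq[OF \<tau> r, where w = "recL \<tau> U" and p = ?p0], erule L)
      (rule p)
  have L2: "local_deriv \<tau> (local_deriv \<tau> (recL \<tau> U)) r x = ?p2 (r - of_int n * \<tau>)"
    if r: "\<lfloor>r / \<tau>\<rfloor> = n" for r
    by (rule local_deriv_eq[OF \<tau> r, where w = "local_deriv \<tau> (recL \<tau> U)" and p = ?p1], erule L1)
      (rule p)
  have L3: "local_deriv \<tau> (local_deriv \<tau> (local_deriv \<tau> (recL \<tau> U))) t x = ?p3 (t - of_int n * \<tau>)"
    by (rule local_deriv_eq[OF \<tau> n, where w = "local_deriv \<tau> (local_deriv \<tau> (recL \<tau> U))" and p = ?p2], erule L2)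
      (rule p)
  have index: "n - 1 + 1 = n" "n - 1 + 2 = n + 1" "n - 2 + 1 = n - 1" "n - 2 + 2 = n" by simp_all
  have B: "B (n - 1) x = (a - 3 * b + 3 * c - d) / \<tau> ^ 3" "B (n - 2) x = (b - 3 * c + 3 * d - e) / \<tau> ^ 3"
    unfolding B_def dquot_3 dquot_2 index a_def[symmetric] b_def[symmetric] c_def[symmetric]
      d_def[symmetric] e_def[symmetric] using \<tau>
    by (simp_all add: field_simps eval_nat_numeral)
  have "?p3 s = (1 / 2 + s / \<tau>) * B (n - 1) x + (1 / 2 - s / \<tau>) * B (n - 2) x"
    unfolding B \<theta>_def \<epsilon>_def using \<tau> by (simp add: field_simps eval_nat_numeral)
  then show ?thesis using L3 by (simp add: numeral_3_eq_3 s_def)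
qed

section \<open>From weighted sums to damped integrals\<close>

text \<open>The integrand is dominated by a step function.  Only this majorant has to be measurable, and the
shifts of the index by at most three cost the factor \<open>exp 6\<close>.\<close>

lemma damped_integral_le_steps:
  fixes \<phi> :: "real \<Rightarrow> real" and s :: "nat \<Rightarrow> real"
  assumes pos: "0 < \<tau>" "0 < \<rho>" "\<rho> * \<tau> \<le> 1"
    and s: "\<And>n. 0 \<le> s n"
    and step: "\<And>t n. 0 \<le> t \<Longrightarrow> \<lfloor>t / \<tau>\<rfloor> = int n \<Longrightarrow> \<phi> t \<le> s (n + 1) + s (n + 2) + s (n + 3)"
    and total: "\<And>N. (\<Sum>n\<le>N. exp (- 2 * \<rho> * \<tau>) ^ n * s n) \<le> S"
  shows "damped_integral \<rho> \<phi> \<le> ennreal (3 * exp 6 * \<tau> * S)"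
proof -
  define q where "q = exp (- 2 * \<rho> * \<tau>)"
  have q: "0 < q" by (simp add: q_def)
  define c where "c = (\<lambda>n. s (n + 1) + s (n + 2) + s (n + 3))"
  have c: "0 \<le> c n" for n using s by (simp add: c_def)
  have qn: "q ^ n = exp (- 2 * \<rho> * (real n * \<tau>))" for n
    unfolding q_def by (simp add: exp_of_nat_mult[symmetric] algebra_simps)
  let ?f = "\<lambda>n t. ennreal (c n * q ^ n) * indicator {real n * \<tau>..<(real n + 1) * \<tau>} t"
  have "damped_integral \<rho> \<phi> \<le> (\<integral>\<^sup>+t. (\<Sum>n. ?f n t) \<partial>lborel)"
    unfolding damped_integral_def
  proof (rule nn_integral_mono)
    fix t :: real
    show "ennreal (\<phi> t * exp (- 2 * \<rho> * t)) * indicator {0..} t \<le> (\<Sum>n. ?f n t)"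
    proof (cases "0 \<le> t")
      case True
      define n where "n = nat \<lfloor>t / \<tau>\<rfloor>"
      have n: "\<lfloor>t / \<tau>\<rfloor> = int n" using True pos(1) by (simp add: n_def)
      then have t: "real n * \<tau> \<le> t" "t < (real n + 1) * \<tau>"
        using pos(1) by (auto simp: floor_eq_iff pos_le_divide_eq pos_divide_less_eq)
      have "\<rho> * (real n * \<tau>) \<le> \<rho> * t" using t(1) pos(2) by (intro mult_left_mono) auto
      then have "exp (- 2 * \<rho> * t) \<le> q ^ n" unfolding qn by simp
      then have "\<phi> t * exp (- 2 * \<rho> * t) \<le> c n * q ^ n"
        using step[OF True n] c[of n] unfolding c_def[symmetric]
        by (intro mult_mono) (auto simp: c_def)
      then have "ennreal (\<phi> t * exp (- 2 * \<rho> * t)) * indicator {0..} t \<le> ?f n t"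
        using t True by (simp add: ennreal_leI)
      also have "\<dots> \<le> (\<Sum>n. ?f n t)"
      proof -
        have "F n \<le> suminf F" for F :: "nat \<Rightarrow> ennreal"
          using sum_le_suminf[of F "{n}"] by (simp add: summableI)
        then show ?thesis .
      qed
      finally show ?thesis .
    qed simp
  qed
  also have "\<dots> = (\<Sum>n. \<integral>\<^sup>+t. ?f n t \<partial>lborel)"
    by (rule nn_integral_suminf) simp
  also have "\<dots> = (\<Sum>n. ennreal (\<tau> * (c n * q ^ n)))"
  proof (rule suminf_cong)
    fix n
    have "(\<integral>\<^sup>+t. ?f n t \<partial>lborel) = ennreal (c n * q ^ n) * ennreal ((real n + 1) * \<tau> - real n * \<tau>)"
      using pos(1) by (subst nn_integral_cmult_indicator) (auto simp: algebra_simps)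
    also have "(real n + 1) * \<tau> - real n * \<tau> = \<tau>" by (simp add: algebra_simps)
    finally show "(\<integral>\<^sup>+t. ?f n t \<partial>lborel) = ennreal (\<tau> * (c n * q ^ n))"
      using pos(1) c[of n] q by (simp add: ennreal_mult mult.commute)
  qed
  also have "\<dots> \<le> ennreal (3 * exp 6 * \<tau> * S)"
  proof (rule suminf_le_const)
    fix N
    have shift: "(\<Sum>n<N. s (n + j) * q ^ n) \<le> exp 6 * S" if j: "j \<le> 3" for j
    proof -
      have "exp (2 * (\<rho> * \<tau>) * real j) \<le> exp (2 * 1 * real 3)"
        using pos j by (simp only: exp_le_cancel_iff) (intro mult_mono; simp)
      then have ej: "exp (2 * (\<rho> * \<tau>) * real j) \<le> exp 6" by simp
      have "exp (2 * (\<rho> * \<tau>) * real j) * q ^ j = 1"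
        unfolding qn by (simp add: exp_add[symmetric] algebra_simps)
      then have qs: "q ^ n = exp (2 * (\<rho> * \<tau>) * real j) * q ^ (n + j)" for n
        by (simp add: power_add)
      have "(\<Sum>n<N. s (n + j) * q ^ n) = exp (2 * (\<rho> * \<tau>) * real j) * (\<Sum>n<N. q ^ (n + j) * s (n + j))"
        unfolding sum_distrib_left by (intro sum.cong refl) (subst qs, simp only: mult_ac)
      also have "\<dots> \<le> exp 6 * (\<Sum>n<N. q ^ (n + j) * s (n + j))"
        using ej q s by (intro mult_right_mono sum_nonneg) auto
      also have "(\<Sum>n<N. q ^ (n + j) * s (n + j)) = (\<Sum>n\<in>{j..<N + j}. q ^ n * s n)"
        using sum.shift_bounds_nat_ivl[of "\<lambda>n. q ^ n * s n" 0 j N] by (simp add: lessThan_atLeast0)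
      also have "exp 6 * \<dots> \<le> exp 6 * (\<Sum>n\<le>N + j. q ^ n * s n)"
        using q s by (intro mult_left_mono sum_mono2) auto
      also have "\<dots> \<le> exp 6 * S" using total[of "N + j"] unfolding q_def by simp
      finally show ?thesis .
    qed
    have "(\<Sum>n<N. \<tau> * (c n * q ^ n)) = \<tau> * ((\<Sum>n<N. s (n + 1) * q ^ n) + (\<Sum>n<N. s (n + 2) * q ^ n) + (\<Sum>n<N. s (n + 3) * q ^ n))"
      unfolding c_def by (simp add: sum_distrib_left sum.distrib algebra_simps)
    also have "\<dots> \<le> \<tau> * (exp 6 * S + exp 6 * S + exp 6 * S)"
      using pos(1) by (intro mult_left_mono add_mono shift) auto
    also have "\<dots> = 3 * exp 6 * \<tau> * S" by simp
    finally have "(\<Sum>n<N. \<tau> * (c n * q ^ n)) \<le> 3 * exp 6 * \<tau> * S" .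
    then show "(\<Sum>n<N. ennreal (\<tau> * (c n * q ^ n))) \<le> ennreal (3 * exp 6 * \<tau> * S)"
      using pos(1) c q by (subst sum_ennreal) (auto intro!: ennreal_leI)
  qed (rule summableI)
  finally show ?thesis .
qed

lemma l2_norm_lincomb_3_power2_le:
  assumes "in_L2 \<Omega> f" "in_L2 \<Omega> g" "in_L2 \<Omega> h"
    and "\<bar>a\<bar> \<le> K" "\<bar>b\<bar> \<le> K" "\<bar>c\<bar> \<le> K"
  shows "(l2_norm \<Omega> (\<lambda>x. a *\<^sub>R f x + b *\<^sub>R g x + c *\<^sub>R h x))\<^sup>2
    \<le> 3 * K\<^sup>2 * ((l2_norm \<Omega> f)\<^sup>2 + (l2_norm \<Omega> g)\<^sup>2 + (l2_norm \<Omega> h)\<^sup>2)"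
proof -
  define u v w where "u = l2_norm \<Omega> f" and "v = l2_norm \<Omega> g" and "w = l2_norm \<Omega> h"
  have nn: "0 \<le> u" "0 \<le> v" "0 \<le> w" unfolding u_def v_def w_def by (rule l2_norm_nonneg)+
  have "l2_norm \<Omega> (\<lambda>x. 1 *\<^sub>R (a *\<^sub>R f x + b *\<^sub>R g x) + c *\<^sub>R h x)
      \<le> \<bar>1\<bar> * l2_norm \<Omega> (\<lambda>x. a *\<^sub>R f x + b *\<^sub>R g x) + \<bar>c\<bar> * w"
    unfolding w_def by (intro l2_norm_lincomb_le in_L2_lincomb assms)
  also have "\<dots> \<le> (\<bar>a\<bar> * u + \<bar>b\<bar> * v) + \<bar>c\<bar> * w"
    using l2_norm_lincomb_le[OF assms(1,2), of a b] unfolding u_def v_def by simp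
  also have "\<dots> \<le> (K * u + K * v) + K * w"
    using nn assms(4-6) by (intro add_mono mult_right_mono)
  finally have "l2_norm \<Omega> (\<lambda>x. a *\<^sub>R f x + b *\<^sub>R g x + c *\<^sub>R h x) \<le> K * (u + v + w)"
    by (simp add: algebra_simps)
  then have "(l2_norm \<Omega> (\<lambda>x. a *\<^sub>R f x + b *\<^sub>R g x + c *\<^sub>R h x))\<^sup>2 \<le> (K * (u + v + w))\<^sup>2"
    by (intro power_mono l2_norm_nonneg)
  also have "\<dots> = K\<^sup>2 * (u + v + w)\<^sup>2" by (simp add: power_mult_distrib)
  also have "\<dots> \<le> K\<^sup>2 * (3 * (u\<^sup>2 + v\<^sup>2 + w\<^sup>2))"
  proof (rule mult_left_mono)
    have "3 * (u\<^sup>2 + v\<^sup>2 + w\<^sup>2) - (u + v + w)\<^sup>2 = (u - v)\<^sup>2 + (u - w)\<^sup>2 + (v - w)\<^sup>2"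
      by (simp add: power2_eq_square algebra_simps)
    moreover have "0 \<le> (u - v)\<^sup>2 + (u - w)\<^sup>2 + (v - w)\<^sup>2" by simp
    ultimately show "(u + v + w)\<^sup>2 \<le> 3 * (u\<^sup>2 + v\<^sup>2 + w\<^sup>2)" by linarith
  qed simp
  finally show ?thesis unfolding u_def v_def w_def by (simp add: algebra_simps)
qed

text \<open>The common end of the proofs of all four estimates.  The index \<open>int n - 3\<close> moves the first nonzero
term of the sequence, which may have a negative index, into the range of the natural numbers.\<close>

lemma damped_estimate:
  fixes X :: "int \<Rightarrow> 'a::euclidean_space \<Rightarrow> 'b::euclidean_space" and v :: "real \<Rightarrow> 'a \<Rightarrow> 'b"
    and N :: "real \<Rightarrow> real" and g :: "nat \<Rightarrow> real" and c0 c1 c2 :: "real \<Rightarrow> real"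
  assumes pos: "0 < \<tau>" "0 < \<rho>" "\<rho> * \<tau> \<le> 1" and K: "0 < K"
    and X: "\<And>n. in_L2 \<Omega> (X n)"
    and energy: "\<And>M. (\<Sum>n\<le>M. exp (- 2 * \<rho> * \<tau>) ^ n * (l2_norm \<Omega> (X (int n - 3)))\<^sup>2)
      \<le> 24 / \<rho>\<^sup>2 * (\<Sum>n\<le>M. exp (- 2 * \<rho> * \<tau>) ^ n * (g n)\<^sup>2)"
    and N: "continuous_on UNIV N" "\<And>t. t \<le> 0 \<Longrightarrow> N t = 0"
    and g: "\<And>n. 0 \<le> g n" "\<And>n. g n \<le> integral {(real n - 2) * \<tau>..(real n + 1) * \<tau>} N / \<tau>"
    and v: "\<And>t n. 0 \<le> t \<Longrightarrow> \<lfloor>t / \<tau>\<rfloor> = n \<Longrightarrow> in_L2 \<Omega> (v t) \<and> (AE x in lebesgue_on \<Omega>.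
      v t x = c0 (t - of_int n * \<tau>) *\<^sub>R X n x + c1 (t - of_int n * \<tau>) *\<^sub>R X (n - 1) x
        + c2 (t - of_int n * \<tau>) *\<^sub>R X (n - 2) x)"
    and c: "\<And>s. 0 \<le> s \<Longrightarrow> s \<le> \<tau> \<Longrightarrow> \<bar>c0 s\<bar> \<le> K \<and> \<bar>c1 s\<bar> \<le> K \<and> \<bar>c2 s\<bar> \<le> K"
  shows "damped_integral \<rho> (\<lambda>t. (l2_norm \<Omega> (v t))\<^sup>2)
    \<le> ennreal (1944 * exp 8 * (K\<^sup>2 / \<rho>\<^sup>2)) * damped_integral \<rho> (\<lambda>t. (N t)\<^sup>2)"
proof (cases "damped_integral \<rho> (\<lambda>t. (N t)\<^sup>2) = \<infinity>")
  case True
  have "0 < 1944 * exp 8 * (K\<^sup>2 / \<rho>\<^sup>2)" using K pos(2) by simp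
  then have "ennreal (1944 * exp 8 * (K\<^sup>2 / \<rho>\<^sup>2)) \<noteq> 0" by (simp only: ennreal_eq_0_iff not_le)
  then show ?thesis
    unfolding True by (simp only: infinity_ennreal_def ennreal_mult_top if_False top_greatest)
next
  case False
  then obtain d where d: "0 \<le> d" "damped_integral \<rho> (\<lambda>t. (N t)\<^sup>2) = ennreal d"
    by (metis ennreal_cases infinity_ennreal_def)
  define s where "s = (\<lambda>n. 3 * K\<^sup>2 * (l2_norm \<Omega> (X (int n - 3)))\<^sup>2)"
  define S where "S = 3 * K\<^sup>2 * (24 / \<rho>\<^sup>2 * (9 * exp 2 * d / \<tau>))"
  have "damped_integral \<rho> (\<lambda>t. (l2_norm \<Omega> (v t))\<^sup>2) \<le> ennreal (3 * exp 6 * \<tau> * S)"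
  proof (rule damped_integral_le_steps[OF pos, where s = s])
    show "0 \<le> s n" for n by (simp add: s_def)
    show "(l2_norm \<Omega> (v t))\<^sup>2 \<le> s (n + 1) + s (n + 2) + s (n + 3)" if t: "0 \<le> t" "\<lfloor>t / \<tau>\<rfloor> = int n" for t n
    proof -
      let ?r = "t - of_int (int n) * \<tau>"
      have r: "0 \<le> ?r" "?r \<le> \<tau>"
        using t pos(1) by (auto simp: floor_eq_iff pos_le_divide_eq pos_divide_less_eq algebra_simps)
      have "l2_norm \<Omega> (v t) = l2_norm \<Omega> (\<lambda>x. c0 ?r *\<^sub>R X (int n) x + c1 ?r *\<^sub>R X (int n - 1) x + c2 ?r *\<^sub>R X (int n - 2) x)"
        using v[OF t] in_L2_lincomb[OF in_L2_lincomb[OF X X] X, of 1 "c0 ?r" "int n" "c1 ?r" "int n - 1" "c2 ?r" "int n - 2"]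
        by (intro l2_norm_cong_AE) simp_all
      then have "(l2_norm \<Omega> (v t))\<^sup>2 \<le> 3 * K\<^sup>2 * ((l2_norm \<Omega> (X (int n)))\<^sup>2
          + (l2_norm \<Omega> (X (int n - 1)))\<^sup>2 + (l2_norm \<Omega> (X (int n - 2)))\<^sup>2)"
        using l2_norm_lincomb_3_power2_le[OF X X X, of "c0 ?r" K "c1 ?r" "c2 ?r"] c[OF r] by simp
      also have "\<dots> = s (n + 1) + s (n + 2) + s (n + 3)"
        unfolding s_def by (simp add: algebra_simps)
      finally show ?thesis .
    qed
    show "(\<Sum>n\<le>M. exp (- 2 * \<rho> * \<tau>) ^ n * s n) \<le> S" for M
    proof -
      have "ennreal (integral {0..(real M + 1) * \<tau>} (\<lambda>t. (N t)\<^sup>2 * exp (- 2 * \<rho> * t))) \<le> ennreal d"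
        using integral_le_damped_integral[OF N(1), of "(real M + 1) * \<tau>" \<rho>] unfolding d(2) .
      then have "integral {0..(real M + 1) * \<tau>} (\<lambda>t. (N t)\<^sup>2 * exp (- 2 * \<rho> * t)) \<le> d"
        using d(1) by simp
      then have "9 * exp 2 * integral {0..(real M + 1) * \<tau>} (\<lambda>t. (N t)\<^sup>2 * exp (- 2 * \<rho> * t)) \<le> 9 * exp 2 * d"
        by (intro mult_left_mono) auto
      with damped_window_sum[OF pos N g, of M]
      have "\<tau> * (\<Sum>n\<le>M. exp (- 2 * \<rho> * \<tau>) ^ n * (g n)\<^sup>2) \<le> 9 * exp 2 * d" by linarith
      then have G: "(\<Sum>n\<le>M. exp (- 2 * \<rho> * \<tau>) ^ n * (g n)\<^sup>2) \<le> 9 * exp 2 * d / \<tau>"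
        using pos(1) by (simp add: pos_le_divide_eq mult.commute)
      have "(\<Sum>n\<le>M. exp (- 2 * \<rho> * \<tau>) ^ n * s n)
          = 3 * K\<^sup>2 * (\<Sum>n\<le>M. exp (- 2 * \<rho> * \<tau>) ^ n * (l2_norm \<Omega> (X (int n - 3)))\<^sup>2)"
        unfolding s_def sum_distrib_left by (intro sum.cong refl) (simp only: mult_ac)
      also have "\<dots> \<le> 3 * K\<^sup>2 * (24 / \<rho>\<^sup>2 * (\<Sum>n\<le>M. exp (- 2 * \<rho> * \<tau>) ^ n * (g n)\<^sup>2))"
        by (intro mult_left_mono energy) simp
      also have "\<dots> \<le> S"
        unfolding S_def by (intro mult_left_mono G) auto
      finally show ?thesis .
    qed
  qed
  also have "3 * exp 6 * \<tau> * S = 1944 * exp 8 * (K\<^sup>2 / \<rho>\<^sup>2) * d"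
  proof -
    have "exp (8::real) = exp 6 * exp 2" by (simp add: exp_add[symmetric])
    then show ?thesis using pos(1) unfolding S_def by simp
  qed
  finally show ?thesis unfolding d(2) using d(1) by (simp add: ennreal_mult[symmetric])
qed

section \<open>Energy estimate for the difference quotients of the discrete solution\<close>

lemma l2_norm_eq_0_on:
  assumes "\<And>x. x \<in> \<Omega> \<Longrightarrow> g x = 0" "in_L2 \<Omega> g"
  shows "l2_norm \<Omega> g = 0"
  by (rule l2_norm_eq_0_AE[OF AE_I2 assms(2)]) (simp add: space_restrict_space assms(1))

text \<open>A difference quotient of order at most three involves only values at indices at most \<open>1\<close> when its own
index is at most \<open>- 2\<close>; so the sequence shifted by three starts from two vanishing terms, as the
energy estimate requires.\<close>

lemma dquot_energy_estimate:
  fixes W h :: "int \<Rightarrow> 'a::euclidean_space \<Rightarrow> real" and Z :: "int \<Rightarrow> 'a \<Rightarrow> 'a"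
  assumes pos: "0 < \<tau>" "0 < \<rho>" "\<rho> * \<tau> \<le> 1" and \<Omega>: "open \<Omega>" "bounded \<Omega>" and r: "r \<le> 3"
    and W: "\<And>n. W n \<in> fe_space \<Omega> T k" "\<And>n. has_weak_grad \<Omega> (W n) (Z n)"
    and h: "\<And>n. in_L2 \<Omega> (h n)"
    and cfl: "\<And>v G. v \<in> fe_space \<Omega> T k \<Longrightarrow> has_weak_grad \<Omega> v G \<Longrightarrow>
      \<tau>\<^sup>2 * (l2_norm \<Omega> G)\<^sup>2 \<le> (l2_norm \<Omega> v)\<^sup>2"
    and scheme: "\<And>n v G. v \<in> fe_space \<Omega> T k \<Longrightarrow> has_weak_grad \<Omega> v G \<Longrightarrow>
      (l2_inner \<Omega> (W (n + 2)) v - 2 * l2_inner \<Omega> (W (n + 1)) v + l2_inner \<Omega> (W n) v) / \<tau>\<^sup>2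
        + l2_inner \<Omega> (Z (n + 1)) G = l2_inner \<Omega> (h n) v"
    and init: "\<And>n x. n \<le> 1 \<Longrightarrow> x \<in> \<Omega> \<Longrightarrow> W n x = 0"
      "\<And>n. n \<le> 0 \<Longrightarrow> AE x in lebesgue_on \<Omega>. Z n x = 0"
  defines "q \<equiv> exp (- 2 * \<rho> * \<tau>)"
  shows "(\<Sum>n\<le>M. q ^ n * (l2_norm \<Omega> (dquot \<tau> (Suc r) W (int n - 3)))\<^sup>2)
      \<le> 24 / \<rho>\<^sup>2 * (\<Sum>n\<le>M. q ^ n * (l2_norm \<Omega> (dquot \<tau> r h (int n - 3)))\<^sup>2)"
    and "(\<Sum>n\<le>M. q ^ n * (l2_norm \<Omega> (dquot \<tau> r Z (int n - 3)))\<^sup>2)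
      \<le> 24 / \<rho>\<^sup>2 * (\<Sum>n\<le>M. q ^ n * (l2_norm \<Omega> (dquot \<tau> r h (int n - 3)))\<^sup>2)"
proof -
  define Y where "Y = (\<lambda>n. dquot \<tau> r W (int n - 3))"
  define D where "D = (\<lambda>n. dquot \<tau> r Z (int n - 3))"
  define H where "H = (\<lambda>n. dquot \<tau> r h (int n - 3))"
  have L2: "in_L2 \<Omega> (W n)" "in_L2 \<Omega> (Z n)" for n
    using W(2)[of n] unfolding has_weak_grad_def by auto
  have YL2: "in_L2 \<Omega> (Y n)" and DL2: "in_L2 \<Omega> (D n)" and HL2: "in_L2 \<Omega> (H n)" for n
    unfolding Y_def D_def H_def by (intro in_L2_dquot L2 h)+
  have Y: "Y n \<in> fe_space \<Omega> T k" and YD: "has_weak_grad \<Omega> (Y n) (D n)" for n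
    unfolding Y_def D_def using dquot_fe_space[OF \<Omega> W(1)] dquot_has_weak_grad[OF \<Omega> W(2)] by auto
  have diff: "(\<lambda>x. Y m x - Y n x) \<in> fe_space \<Omega> T k"
    "has_weak_grad \<Omega> (\<lambda>x. Y m x - Y n x) (\<lambda>x. D m x - D n x)" for m n
    using fe_space_lincomb[OF \<Omega> Y Y, of 1 m "-1" n] has_weak_grad_lincomb[OF \<Omega> YD YD, of 1 m "-1" n]
    by simp_all
  have idx: "int (Suc n) - 3 = int n - 3 + 1" "int n - 3 + 1 + 1 = int n - 3 + 2" for n
    by simp_all
  have scheme': "let v = (\<lambda>x. Y (Suc (Suc n)) x - Y n x); G = (\<lambda>x. D (Suc (Suc n)) x - D n x) in
      (l2_inner \<Omega> (Y (Suc (Suc n))) v - 2 * l2_inner \<Omega> (Y (Suc n)) v + l2_inner \<Omega> (Y n) v) / \<tau>\<^sup>2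
        + l2_inner \<Omega> (D (Suc n)) G = l2_inner \<Omega> (H n) v" for n
  proof -
    note d = diff[of "Suc (Suc n)" n]
    have dL2: "in_L2 \<Omega> (\<lambda>x. Y (Suc (Suc n)) x - Y n x)" "in_L2 \<Omega> (\<lambda>x. D (Suc (Suc n)) x - D n x)"
      using d(2) unfolding has_weak_grad_def by auto
    show ?thesis
      using dquot_scheme[OF L2 h dL2 scheme[OF d], of r "int n - 3"]
      unfolding Let_def Y_def D_def H_def idx .
  qed
  have init': "l2_norm \<Omega> (\<lambda>x. Y 1 x - Y 0 x) = 0" "l2_norm \<Omega> (D 0) = 0"
  proof -
    have "Y m x = 0" if "x \<in> \<Omega>" "m \<le> 1" for x m
      unfolding Y_def using that r by (intro dquot_eq_0[of 1] init) auto
    then show "l2_norm \<Omega> (\<lambda>x. Y 1 x - Y 0 x) = 0"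
      by (intro l2_norm_eq_0_on in_L2_diff YL2) simp
    have "AE x in lebesgue_on \<Omega>. D 0 x = 0"
      unfolding D_def using r by (intro dquot_AE_0[of 0] init) auto
    then show "l2_norm \<Omega> (D 0) = 0" by (rule l2_norm_eq_0_AE) (rule DL2)
  qed
  note est = leapfrog_energy_estimate[OF pos YL2 DL2 HL2 cfl[OF diff] scheme' init', of M]
  have "dquot \<tau> (Suc r) W (int n - 3) = (\<lambda>x. (Y (Suc n) x - Y n x) /\<^sub>R \<tau>)" for n
    unfolding Y_def idx by simp
  then show "(\<Sum>n\<le>M. q ^ n * (l2_norm \<Omega> (dquot \<tau> (Suc r) W (int n - 3)))\<^sup>2)
      \<le> 24 / \<rho>\<^sup>2 * (\<Sum>n\<le>M. q ^ n * (l2_norm \<Omega> (dquot \<tau> r h (int n - 3)))\<^sup>2)"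
    using est(1) unfolding q_def H_def by (simp only:)
  show "(\<Sum>n\<le>M. q ^ n * (l2_norm \<Omega> (dquot \<tau> r Z (int n - 3)))\<^sup>2)
      \<le> 24 / \<rho>\<^sup>2 * (\<Sum>n\<le>M. q ^ n * (l2_norm \<Omega> (dquot \<tau> r h (int n - 3)))\<^sup>2)"
    using est(2) unfolding q_def D_def H_def .
qed

definition solution_grad :: "'a::euclidean_space set \<Rightarrow> (nat \<Rightarrow> 'a \<Rightarrow> real) \<Rightarrow> int \<Rightarrow> 'a \<Rightarrow> 'a" where
  "solution_grad \<Omega> U n = (if n < 0 then (\<lambda>x. 0) else weak_grad \<Omega> (U (nat n)))"

text \<open>For indices \<open>n \<ge> 0\<close> this is the given scheme at \<open>n + 1\<close>.  For \<open>n < 0\<close> every term vanishes: the solution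
because of the initial conditions, and the source because it is extended by zero.\<close>

lemma leapfrog_solution_extended:
  assumes \<Omega>: "open \<Omega>" "bounded \<Omega>" and sol: "leapfrog_solution \<Omega> T k \<tau> f U" and \<tau>: "0 < \<tau>"
    and U0: "\<And>x. x \<in> \<Omega> \<Longrightarrow> U 0 x = 0" "\<And>x. x \<in> \<Omega> \<Longrightarrow> U 1 x = 0"
    and F: "\<And>t. in_L2 \<Omega> (F t)" "\<And>t. 0 \<le> t \<Longrightarrow> F t = f t" "\<And>t. t \<le> 0 \<Longrightarrow> l2_norm \<Omega> (F t) = 0"
  shows "zero_ext U n \<in> fe_space \<Omega> T k" "has_weak_grad \<Omega> (zero_ext U n) (solution_grad \<Omega> U n)"
    and "n \<le> 1 \<Longrightarrow> x \<in> \<Omega> \<Longrightarrow> zero_ext U n x = 0"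
    and "n \<le> 0 \<Longrightarrow> AE x in lebesgue_on \<Omega>. solution_grad \<Omega> U n x = 0"
    and "v \<in> fe_space \<Omega> T k \<Longrightarrow> has_weak_grad \<Omega> v G \<Longrightarrow>
      (l2_inner \<Omega> (zero_ext U (n + 2)) v - 2 * l2_inner \<Omega> (zero_ext U (n + 1)) v + l2_inner \<Omega> (zero_ext U n) v) / \<tau>\<^sup>2
        + l2_inner \<Omega> (solution_grad \<Omega> U (n + 1)) G = l2_inner \<Omega> (F (of_int (n + 1) * \<tau>)) v"
proof -
  have U: "U m \<in> fe_space \<Omega> T k" for m using sol unfolding leapfrog_solution_def by blast
  have ze: "zero_ext U n = (if n < 0 then (\<lambda>x. 0) else U (nat n))" for n
    by (simp add: fun_eq_iff zero_ext_def)
  show "zero_ext U n \<in> fe_space \<Omega> T k" unfolding ze using U zero_in_fe_space[of \<Omega> T k] by simp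
  have grad: "has_weak_grad \<Omega> (zero_ext U n) (solution_grad \<Omega> U n)" for n
    unfolding ze solution_grad_def using fe_space_weak_grad[OF U] has_weak_grad_zero by auto
  then show "has_weak_grad \<Omega> (zero_ext U n) (solution_grad \<Omega> U n)" .
  have zero: "zero_ext U n x = 0" if "n \<le> 1" "x \<in> \<Omega>" for n x
  proof -
    have "n < 0 \<or> nat n = 0 \<or> nat n = 1" using that(1) by linarith
    then show ?thesis unfolding ze using U0 that(2) by auto
  qed
  then show "n \<le> 1 \<Longrightarrow> x \<in> \<Omega> \<Longrightarrow> zero_ext U n x = 0" .
  have gzero: "AE x in lebesgue_on \<Omega>. solution_grad \<Omega> U n x = 0" if "n \<le> 0" for n
    by (rule has_weak_grad_unique[OF \<Omega> grad has_weak_grad_zero]) (use zero that in auto)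
  then show "n \<le> 0 \<Longrightarrow> AE x in lebesgue_on \<Omega>. solution_grad \<Omega> U n x = 0" .
  have L2: "in_L2 \<Omega> (zero_ext U n)" "in_L2 \<Omega> (solution_grad \<Omega> U n)" for n
    using grad[of n] unfolding has_weak_grad_def by auto
  assume v: "v \<in> fe_space \<Omega> T k" "has_weak_grad \<Omega> v G"
  have vL2: "in_L2 \<Omega> v" "in_L2 \<Omega> G" using v(2) unfolding has_weak_grad_def by auto
  have inner0: "l2_inner \<Omega> g w = 0" if "l2_norm \<Omega> g = 0" "in_L2 \<Omega> g" "in_L2 \<Omega> w"
    for g w :: "'a \<Rightarrow> 'c::euclidean_space"
    using l2_Cauchy_Schwarz[OF that(2,3)] that(1) by simp
  show "(l2_inner \<Omega> (zero_ext U (n + 2)) v - 2 * l2_inner \<Omega> (zero_ext U (n + 1)) v + l2_inner \<Omega> (zero_ext U n) v) / \<tau>\<^sup>2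
        + l2_inner \<Omega> (solution_grad \<Omega> U (n + 1)) G = l2_inner \<Omega> (F (of_int (n + 1) * \<tau>)) v"
  proof (cases "n < 0")
    case True
    have 1: "l2_inner \<Omega> (zero_ext U m) v = 0" if "m \<le> 1" for m
      using zero[OF that] by (intro inner0 l2_norm_eq_0_on L2 vL2) auto
    have "l2_inner \<Omega> (solution_grad \<Omega> U (n + 1)) G = 0"
      using True by (intro inner0 l2_norm_eq_0_AE L2 vL2 gzero) simp
    moreover have "l2_inner \<Omega> (F (of_int (n + 1) * \<tau>)) v = 0"
    proof (rule inner0[OF _ F(1) vL2(1)])
      have "of_int (n + 1) * \<tau> \<le> 0" using True \<tau> by (intro mult_nonpos_nonneg) auto
      then show "l2_norm \<Omega> (F (of_int (n + 1) * \<tau>)) = 0" by (rule F(3))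
    qed
    ultimately show ?thesis using True by (simp add: 1)
  next
    case False
    then obtain m where m: "n = int m" by (metis nonneg_int_cases not_less)
    have UL2: "in_L2 \<Omega> (U i)" for i using L2(1)[of "int i"] unfolding ze by simp
    have Z: "zero_ext U n = U m" "zero_ext U (n + 1) = U (m + 1)" "zero_ext U (n + 2) = U (m + 2)"
      "solution_grad \<Omega> U (n + 1) = weak_grad \<Omega> (U (m + 1))"
      unfolding ze solution_grad_def m by (simp_all add: nat_add_distrib)
    have WG: "l2_inner \<Omega> (weak_grad \<Omega> (U (m + 1))) (weak_grad \<Omega> v) = l2_inner \<Omega> (weak_grad \<Omega> (U (m + 1))) G"
    proof (rule l2_inner_cong_AE)
      show "AE x in lebesgue_on \<Omega>. weak_grad \<Omega> v x = G x"
        by (rule has_weak_grad_unique[OF \<Omega> fe_space_weak_grad[OF v(1)] v(2)]) simp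
      show "in_L2 \<Omega> (weak_grad \<Omega> v)"
        using fe_space_weak_grad[OF v(1)] unfolding has_weak_grad_def by simp
    qed (use L2(2)[of "n + 1"] vL2(2) in \<open>auto simp: Z\<close>)
    have Feq: "F (of_int (n + 1) * \<tau>) = f (real (m + 1) * \<tau>)"
      using F(2)[of "real (m + 1) * \<tau>"] \<tau> by (simp add: m add.commute)
    have "1 / \<tau>\<^sup>2 * l2_inner \<Omega> (\<lambda>x. U (m + 1 + 1) x - 2 * U (m + 1) x + U (m + 1 - 1) x) v
        + l2_inner \<Omega> (weak_grad \<Omega> (U (m + 1))) (weak_grad \<Omega> v) = l2_inner \<Omega> (f (real (m + 1) * \<tau>)) v"
      using sol v(1) unfolding leapfrog_solution_def by (meson le_add2)
    moreover have "l2_inner \<Omega> (\<lambda>x. U (m + 1 + 1) x - 2 * U (m + 1) x + U (m + 1 - 1) x) v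
        = l2_inner \<Omega> (U (m + 2)) v - 2 * l2_inner \<Omega> (U (m + 1)) v + l2_inner \<Omega> (U m) v"
      using l2_inner_lincomb_left[OF in_L2_lincomb[OF UL2 UL2] UL2 vL2(1), of 1 1 "m + 2" "-2" "m + 1" 1 m]
        l2_inner_lincomb_left[OF UL2 UL2 vL2(1), of 1 "m + 2" "-2" "m + 1"]
      by simp
    ultimately show ?thesis unfolding Z Feq WG by simp
  qed
qed

theorem lemma3p9:
  fixes \<Omega> :: "'a::euclidean_space set" and k :: nat and \<mu>\<^sub>0 :: real
  assumes "lipschitz_polyhedron \<Omega>" and "k \<ge> 1" and "0 < \<mu>\<^sub>0" and "\<mu>\<^sub>0 < 1"
  shows "\<exists>C>0. \<forall>(T :: 'a set set) (\<tau>::real) (\<rho>::real) (c::real)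
             (f :: real \<Rightarrow> 'a \<Rightarrow> real) (U :: nat \<Rightarrow> 'a \<Rightarrow> real).
     simplicial_mesh \<Omega> T \<and> 0 < \<tau> \<and> 0 < \<rho> \<and> \<rho> * \<tau> \<le> 1 \<and>
     cfl_constant \<Omega> T k \<mu>\<^sub>0 c \<and> \<tau> \<le> c * h_min T \<and>
     source_term \<Omega> f \<and> l2_Cb \<Omega> 3 f \<and>
     leapfrog_solution \<Omega> T k \<tau> f U \<and> (\<forall>x\<in>\<Omega>. U 0 x = 0) \<and> (\<forall>x\<in>\<Omega>. U 1 x = 0)
     \<longrightarrow>
     (let u = recR \<tau> U;
          w = recL \<tau> U;
          \<delta> = (\<lambda>t x. u t x - w t x);
          d\<delta> = local_deriv \<tau> \<delta>;
          d3w = (local_deriv \<tau> ^^ 3) w;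
          f2 = (l2_deriv \<Omega> ^^ 2) f;
          f3 = (l2_deriv \<Omega> ^^ 3) f
      in
        damped_integral \<rho> (\<lambda>t. (l2_norm \<Omega> (d\<delta> t))\<^sup>2)
          \<le> ennreal (C * (\<tau> ^ 4 / \<rho>\<^sup>2)) * damped_integral \<rho> (\<lambda>t. (l2_norm \<Omega> (f2 t))\<^sup>2) \<and>
        damped_integral \<rho> (\<lambda>t. (l2_norm \<Omega> (weak_grad \<Omega> (\<delta> t)))\<^sup>2)
          \<le> ennreal (C * (\<tau> ^ 4 / \<rho>\<^sup>2)) *
             damped_integral \<rho> (\<lambda>t. (l2_norm \<Omega> (f2 t))\<^sup>2 + \<tau>\<^sup>2 * (l2_norm \<Omega> (f3 t))\<^sup>2) \<and>
        damped_integral \<rho> (\<lambda>t. (l2_norm \<Omega> (weak_grad \<Omega> (d\<delta> t)))\<^sup>2)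
          \<le> ennreal (C * (\<tau> ^ 4 / \<rho>\<^sup>2)) * damped_integral \<rho> (\<lambda>t. (l2_norm \<Omega> (f3 t))\<^sup>2) \<and>
        damped_integral \<rho> (\<lambda>t. (l2_norm \<Omega> (d3w t))\<^sup>2)
          \<le> ennreal (C * (1 / \<rho>\<^sup>2)) * damped_integral \<rho> (\<lambda>t. (l2_norm \<Omega> (f2 t))\<^sup>2))"
  \<comment> \<open>\<open>1944 * exp 8\<close> is the constant of \<open>damped_estimate\<close>; the factor \<open>4 = 2\<^sup>2\<close> covers the fourth
    estimate, where the coefficients are bounded by \<open>2\<close>.\<close>
proof (intro exI[of _ "7776 * exp 8"] conjI allI impI)
  show "0 < 7776 * exp (8::real)" by simp
  fix T :: "'a set set" and \<tau> \<rho> c :: real and f :: "real \<Rightarrow> 'a \<Rightarrow> real" and U :: "nat \<Rightarrow> 'a \<Rightarrow> real"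
  assume asm: "simplicial_mesh \<Omega> T \<and> 0 < \<tau> \<and> 0 < \<rho> \<and> \<rho> * \<tau> \<le> 1 \<and>
     cfl_constant \<Omega> T k \<mu>\<^sub>0 c \<and> \<tau> \<le> c * h_min T \<and>
     source_term \<Omega> f \<and> l2_Cb \<Omega> 3 f \<and>
     leapfrog_solution \<Omega> T k \<tau> f U \<and> (\<forall>x\<in>\<Omega>. U 0 x = 0) \<and> (\<forall>x\<in>\<Omega>. U 1 x = 0)"
  have \<Omega>: "open \<Omega>" "bounded \<Omega>" using assms(1) unfolding lipschitz_polyhedron_def by auto
  have pos: "0 < \<tau>" "0 < \<rho>" "\<rho> * \<tau> \<le> 1" using asm by auto
  define F where "F = ext_deriv \<Omega> f"
  define N where "N = (\<lambda>j t. l2_norm \<Omega> (F j t))"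
  have src: "source_term \<Omega> f" "l2_Cb \<Omega> 3 f" using asm by auto
  note reg = ext_deriv_regularity[OF src, folded F_def]
  have F0: "F 0 t = f t" if "0 \<le> t" for t using that by (simp add: F_def ext_deriv_def)
  have sol: "leapfrog_solution \<Omega> T k \<tau> f U" "\<And>x. x \<in> \<Omega> \<Longrightarrow> U 0 x = 0" "\<And>x. x \<in> \<Omega> \<Longrightarrow> U 1 x = 0"
    using asm by auto
  note extended = leapfrog_solution_extended[OF \<Omega> sol(1) pos(1) sol(2,3),
      where F = "F 0", OF _ _ reg(1)[OF le0] F0 reg(2)[OF le0]]
  define W where "W = zero_ext U"
  define Z where "Z = solution_grad \<Omega> U"
  define h where "h = (\<lambda>n::int. F 0 (of_int (n + 1) * \<tau>))"
  have cfl: "\<tau>\<^sup>2 * (l2_norm \<Omega> G)\<^sup>2 \<le> (l2_norm \<Omega> v)\<^sup>2" if v: "v \<in> fe_space \<Omega> T k" "has_weak_grad \<Omega> v G" for v G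
  proof -
    have "\<mu>\<^sub>0 * (l2_norm \<Omega> v)\<^sup>2 \<le> m_form \<Omega> \<tau> v v"
      using asm v(1) unfolding cfl_constant_def by blast
    then have "0 \<le> m_form \<Omega> \<tau> v v" using assms(3) by (smt (verit) mult_nonneg_nonneg zero_le_power2)
    then have "\<tau>\<^sup>2 * (l2_norm \<Omega> (weak_grad \<Omega> v))\<^sup>2 \<le> (l2_norm \<Omega> v)\<^sup>2"
      unfolding m_form_def l2_norm_power2 by simp
    moreover have "l2_norm \<Omega> (weak_grad \<Omega> v) = l2_norm \<Omega> G"
      using has_weak_grad_unique[OF \<Omega> fe_space_weak_grad[OF v(1)] v(2)] fe_space_weak_grad[OF v(1)] v(2)
      by (intro l2_norm_cong_AE) (auto simp: has_weak_grad_def)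
    ultimately show ?thesis by simp
  qed
  have WZ: "W n \<in> fe_space \<Omega> T k" "has_weak_grad \<Omega> (W n) (Z n)" for n
    unfolding W_def Z_def by (rule extended; simp)+
  have L2: "in_L2 \<Omega> (W n)" "in_L2 \<Omega> (Z n)" for n
    using WZ(2)[of n] unfolding has_weak_grad_def by auto
  have hL2: "in_L2 \<Omega> (h n)" for n unfolding h_def by (rule reg(1)) simp
  have energy: "(\<Sum>n\<le>M. exp (- 2 * \<rho> * \<tau>) ^ n * (l2_norm \<Omega> (dquot \<tau> (Suc r) W (int n - 3)))\<^sup>2)
      \<le> 24 / \<rho>\<^sup>2 * (\<Sum>n\<le>M. exp (- 2 * \<rho> * \<tau>) ^ n * (l2_norm \<Omega> (dquot \<tau> r h (int n - 3)))\<^sup>2)"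
    "(\<Sum>n\<le>M. exp (- 2 * \<rho> * \<tau>) ^ n * (l2_norm \<Omega> (dquot \<tau> r Z (int n - 3)))\<^sup>2)
      \<le> 24 / \<rho>\<^sup>2 * (\<Sum>n\<le>M. exp (- 2 * \<rho> * \<tau>) ^ n * (l2_norm \<Omega> (dquot \<tau> r h (int n - 3)))\<^sup>2)"
    if r: "r \<le> 3" for r M
    unfolding W_def Z_def h_def
    by (rule dquot_energy_estimate[OF pos \<Omega> r, where T = T and k = k]; (rule extended cfl reg(1)[OF le0]; assumption?))+
  have Ncont: "continuous_on UNIV (N j)" and N0: "t \<le> 0 \<Longrightarrow> N j t = 0" if "j \<le> 3" for j t
    unfolding N_def using reg(2,4) that by auto
  have g: "l2_norm \<Omega> (dquot \<tau> j h (int n - 3))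
      \<le> integral {(real n - 2) * \<tau>..(real n + 1) * \<tau>} (N j) / \<tau>" if j: "j \<le> 3" "1 \<le> j" for j n
  proof -
    obtain r where r: "j = Suc r" using j(2) by (cases j) auto
    have e: "of_int (int n - 3 + 1) * \<tau> = (real n - 2) * \<tau>" by simp
    have "l2_norm \<Omega> (dquot \<tau> (Suc r) h (int n - 3))
        \<le> integral {(real n - 2) * \<tau>..(real n - 2) * \<tau> + real (Suc r) * \<tau>} (\<lambda>t. l2_norm \<Omega> (F (Suc r) t)) / \<tau>"
      unfolding h_def e[symmetric]
      by (rule l2_norm_dquot_le_integral[OF pos(1)]) (use j r reg in auto)
    also have "\<dots> \<le> integral {(real n - 2) * \<tau>..(real n + 1) * \<tau>} (N j) / \<tau>"
    proof (rule divide_right_mono)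
      have "real (Suc r) * \<tau> \<le> 3 * \<tau>" using j r pos(1) by (intro mult_right_mono) auto
      then have sub: "{(real n - 2) * \<tau>..(real n - 2) * \<tau> + real (Suc r) * \<tau>} \<subseteq> {(real n - 2) * \<tau>..(real n + 1) * \<tau>}"
        by (auto simp: algebra_simps)
      show "integral {(real n - 2) * \<tau>..(real n - 2) * \<tau> + real (Suc r) * \<tau>} (\<lambda>t. l2_norm \<Omega> (F (Suc r) t))
          \<le> integral {(real n - 2) * \<tau>..(real n + 1) * \<tau>} (N j)"
        unfolding r N_def
        by (rule integral_subset_le[OF sub])
          (auto intro!: integrable_continuous_interval continuous_on_subset[OF Ncont[OF j(1), unfolded N_def r]]
            simp: l2_norm_nonneg)
    qed (use pos(1) in simp)
    finally show ?thesis unfolding r .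
  qed
  have A: "in_L2 \<Omega> (dquot \<tau> j W n)" "in_L2 \<Omega> (dquot \<tau> j Z n)"
    "has_weak_grad \<Omega> (dquot \<tau> j W n) (dquot \<tau> j Z n)" for j n
    using in_L2_dquot[OF L2(1)] in_L2_dquot[OF L2(2)] dquot_has_weak_grad[OF \<Omega> WZ(2)] by auto
  have grad_eq: "in_L2 \<Omega> (weak_grad \<Omega> v) \<and> (AE x in lebesgue_on \<Omega>. weak_grad \<Omega> v x = G x)"
    if "has_weak_grad \<Omega> v G" for v G
    using has_weak_grad_weak_grad[OF that] has_weak_grad_unique[OF \<Omega> has_weak_grad_weak_grad[OF that] that]
    unfolding has_weak_grad_def by auto
  have f_eq: "damped_integral \<rho> (\<lambda>t. (N j t)\<^sup>2) = damped_integral \<rho> (\<lambda>t. (l2_norm \<Omega> ((l2_deriv \<Omega> ^^ j) f t))\<^sup>2)" for j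
    unfolding damped_integral_def
    by (intro nn_integral_cong) (auto simp: N_def F_def ext_deriv_def split: split_indicator)
  let ?\<delta> = "\<lambda>t x. recR \<tau> U t x - recL \<tau> U t x"
  let ?f2 = "(l2_deriv \<Omega> ^^ 2) f" and ?f3 = "(l2_deriv \<Omega> ^^ 3) f"
  have \<tau>4: "(\<tau>\<^sup>2)\<^sup>2 = \<tau> ^ 4" by simp
  have const: "ennreal (1944 * exp 8 * (\<tau> ^ 4 / \<rho>\<^sup>2)) \<le> ennreal (7776 * exp 8 * (\<tau> ^ 4 / \<rho>\<^sup>2))"
    by (intro ennreal_leI mult_right_mono) auto
  have energy3: "(\<Sum>n\<le>M. exp (- 2 * \<rho> * \<tau>) ^ n * (l2_norm \<Omega> (dquot \<tau> 3 W (int n - 3)))\<^sup>2)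
      \<le> 24 / \<rho>\<^sup>2 * (\<Sum>n\<le>M. exp (- 2 * \<rho> * \<tau>) ^ n * (l2_norm \<Omega> (dquot \<tau> 2 h (int n - 3)))\<^sup>2)" for M
    using energy(1)[of 2 M] by (simp add: numeral_3_eq_3 numeral_2_eq_2 del: dquot.simps)
  have dd: "local_deriv \<tau> ?\<delta> t = (\<lambda>x. defect_coeff_deriv \<tau> 0 (t - of_int n * \<tau>) *\<^sub>R dquot \<tau> 3 W (n - 1) x
      + defect_coeff_deriv \<tau> 1 (t - of_int n * \<tau>) *\<^sub>R dquot \<tau> 3 W (n - 2) x)" if "\<lfloor>t / \<tau>\<rfloor> = n" for t n
    using local_deriv_defect[OF pos(1) that, of U] by (simp add: fun_eq_iff W_def)
  have d: "?\<delta> t = (\<lambda>x. 1 *\<^sub>R (defect_coeff \<tau> 0 (t - of_int n * \<tau>) *\<^sub>R dquot \<tau> 2 W n x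
      + defect_coeff \<tau> 1 (t - of_int n * \<tau>) *\<^sub>R dquot \<tau> 2 W (n - 1) x)
      + defect_coeff \<tau> 2 (t - of_int n * \<tau>) *\<^sub>R dquot \<tau> 2 W (n - 2) x)" if "\<lfloor>t / \<tau>\<rfloor> = n" for t n
    using recR_minus_recL[OF pos(1) that, of U] by (simp add: fun_eq_iff W_def)
  have d3: "(local_deriv \<tau> ^^ 3) (recL \<tau> U) t = (\<lambda>x. (1 / 2 + (t - of_int n * \<tau>) / \<tau>) *\<^sub>R dquot \<tau> 3 W (n - 1) x
      + (1 / 2 - (t - of_int n * \<tau>) / \<tau>) *\<^sub>R dquot \<tau> 3 W (n - 2) x)" if "\<lfloor>t / \<tau>\<rfloor> = n" for t n
    using local_deriv_3_recL[OF pos(1) that, of U] by (simp add: fun_eq_iff W_def del: funpow.simps)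
  have "damped_integral \<rho> (\<lambda>t. (l2_norm \<Omega> (local_deriv \<tau> ?\<delta> t))\<^sup>2)
      \<le> ennreal (1944 * exp 8 * ((\<tau>\<^sup>2)\<^sup>2 / \<rho>\<^sup>2)) * damped_integral \<rho> (\<lambda>t. (N 2 t)\<^sup>2)"
  proof (rule damped_estimate[OF pos _ A(1) energy3])
    show "in_L2 \<Omega> (local_deriv \<tau> ?\<delta> t) \<and> (AE x in lebesgue_on \<Omega>. local_deriv \<tau> ?\<delta> t x
        = (\<lambda>s. 0) (t - of_int n * \<tau>) *\<^sub>R dquot \<tau> 3 W n x
        + defect_coeff_deriv \<tau> 0 (t - of_int n * \<tau>) *\<^sub>R dquot \<tau> 3 W (n - 1) x
        + defect_coeff_deriv \<tau> 1 (t - of_int n * \<tau>) *\<^sub>R dquot \<tau> 3 W (n - 2) x)"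
      if "\<lfloor>t / \<tau>\<rfloor> = n" for t n
      unfolding dd[OF that] using in_L2_lincomb[OF A(1) A(1)] by simp
    show "\<bar>(\<lambda>s. 0) s\<bar> \<le> \<tau>\<^sup>2 \<and> \<bar>defect_coeff_deriv \<tau> 0 s\<bar> \<le> \<tau>\<^sup>2 \<and> \<bar>defect_coeff_deriv \<tau> 1 s\<bar> \<le> \<tau>\<^sup>2"
      if "0 \<le> s" "s \<le> \<tau>" for s
      using defect_coeff_deriv_bound[OF pos(1) that] by simp
  qed (use pos g[of 2] in \<open>auto intro: Ncont N0 l2_norm_nonneg\<close>)
  then have 1: "damped_integral \<rho> (\<lambda>t. (l2_norm \<Omega> (local_deriv \<tau> ?\<delta> t))\<^sup>2)
      \<le> ennreal (7776 * exp 8 * (\<tau> ^ 4 / \<rho>\<^sup>2)) * damped_integral \<rho> (\<lambda>t. (l2_norm \<Omega> (?f2 t))\<^sup>2)"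
    unfolding \<tau>4 f_eq by (rule order_trans[OF _ mult_right_mono[OF const]]) simp
  have "damped_integral \<rho> (\<lambda>t. (l2_norm \<Omega> (weak_grad \<Omega> (?\<delta> t)))\<^sup>2)
      \<le> ennreal (1944 * exp 8 * ((\<tau>\<^sup>2)\<^sup>2 / \<rho>\<^sup>2)) * damped_integral \<rho> (\<lambda>t. (N 2 t)\<^sup>2)"
  proof (rule damped_estimate[OF pos _ A(2) energy(2)[of 2]])
    show "in_L2 \<Omega> (weak_grad \<Omega> (?\<delta> t)) \<and> (AE x in lebesgue_on \<Omega>. weak_grad \<Omega> (?\<delta> t) x
        = defect_coeff \<tau> 0 (t - of_int n * \<tau>) *\<^sub>R dquot \<tau> 2 Z n x
        + defect_coeff \<tau> 1 (t - of_int n * \<tau>) *\<^sub>R dquot \<tau> 2 Z (n - 1) x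
        + defect_coeff \<tau> 2 (t - of_int n * \<tau>) *\<^sub>R dquot \<tau> 2 Z (n - 2) x)"
      if "\<lfloor>t / \<tau>\<rfloor> = n" for t n
      using grad_eq[OF has_weak_grad_lincomb[OF \<Omega> has_weak_grad_lincomb[OF \<Omega> A(3) A(3)] A(3), of 1
          "defect_coeff \<tau> 0 (t - of_int n * \<tau>)" 2 n "defect_coeff \<tau> 1 (t - of_int n * \<tau>)" 2 "n - 1"
          "defect_coeff \<tau> 2 (t - of_int n * \<tau>)" 2 "n - 2"]]
      unfolding d[OF that] by simp
    show "\<bar>defect_coeff \<tau> 0 s\<bar> \<le> \<tau>\<^sup>2 \<and> \<bar>defect_coeff \<tau> 1 s\<bar> \<le> \<tau>\<^sup>2 \<and> \<bar>defect_coeff \<tau> 2 s\<bar> \<le> \<tau>\<^sup>2"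
      if "0 \<le> s" "s \<le> \<tau>" for s
      using defect_coeff_bound[OF pos(1) that] by simp
  qed (use pos g[of 2] in \<open>auto intro: Ncont N0 l2_norm_nonneg\<close>)
  also have "\<dots> \<le> ennreal (7776 * exp 8 * (\<tau> ^ 4 / \<rho>\<^sup>2)) * damped_integral \<rho> (\<lambda>t. (N 2 t)\<^sup>2)"
    unfolding \<tau>4 by (rule mult_right_mono[OF const]) simp
  also have "damped_integral \<rho> (\<lambda>t. (N 2 t)\<^sup>2)
      \<le> damped_integral \<rho> (\<lambda>t. (l2_norm \<Omega> (?f2 t))\<^sup>2 + \<tau>\<^sup>2 * (l2_norm \<Omega> (?f3 t))\<^sup>2)"
    unfolding f_eq unfolding damped_integral_def
    by (intro nn_integral_mono mult_right_mono ennreal_leI) auto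
  finally have 2: "damped_integral \<rho> (\<lambda>t. (l2_norm \<Omega> (weak_grad \<Omega> (?\<delta> t)))\<^sup>2)
      \<le> ennreal (7776 * exp 8 * (\<tau> ^ 4 / \<rho>\<^sup>2))
        * damped_integral \<rho> (\<lambda>t. (l2_norm \<Omega> (?f2 t))\<^sup>2 + \<tau>\<^sup>2 * (l2_norm \<Omega> (?f3 t))\<^sup>2)"
    by (simp add: mult_left_mono)
  have "damped_integral \<rho> (\<lambda>t. (l2_norm \<Omega> (weak_grad \<Omega> (local_deriv \<tau> ?\<delta> t)))\<^sup>2)
      \<le> ennreal (1944 * exp 8 * ((\<tau>\<^sup>2)\<^sup>2 / \<rho>\<^sup>2)) * damped_integral \<rho> (\<lambda>t. (N 3 t)\<^sup>2)"
  proof (rule damped_estimate[OF pos _ A(2) energy(2)[of 3]])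
    show "in_L2 \<Omega> (weak_grad \<Omega> (local_deriv \<tau> ?\<delta> t)) \<and> (AE x in lebesgue_on \<Omega>. weak_grad \<Omega> (local_deriv \<tau> ?\<delta> t) x
        = (\<lambda>s. 0) (t - of_int n * \<tau>) *\<^sub>R dquot \<tau> 3 Z n x
        + defect_coeff_deriv \<tau> 0 (t - of_int n * \<tau>) *\<^sub>R dquot \<tau> 3 Z (n - 1) x
        + defect_coeff_deriv \<tau> 1 (t - of_int n * \<tau>) *\<^sub>R dquot \<tau> 3 Z (n - 2) x)"
      if "\<lfloor>t / \<tau>\<rfloor> = n" for t n
      using grad_eq[OF has_weak_grad_lincomb[OF \<Omega> A(3) A(3), of "defect_coeff_deriv \<tau> 0 (t - of_int n * \<tau>)" 3 "n - 1"
          "defect_coeff_deriv \<tau> 1 (t - of_int n * \<tau>)" 3 "n - 2"]]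
      unfolding dd[OF that] by simp
    show "\<bar>(\<lambda>s. 0) s\<bar> \<le> \<tau>\<^sup>2 \<and> \<bar>defect_coeff_deriv \<tau> 0 s\<bar> \<le> \<tau>\<^sup>2 \<and> \<bar>defect_coeff_deriv \<tau> 1 s\<bar> \<le> \<tau>\<^sup>2"
      if "0 \<le> s" "s \<le> \<tau>" for s
      using defect_coeff_deriv_bound[OF pos(1) that] by simp
  qed (use pos g[of 3] in \<open>auto intro: Ncont N0 l2_norm_nonneg\<close>)
  then have 3: "damped_integral \<rho> (\<lambda>t. (l2_norm \<Omega> (weak_grad \<Omega> (local_deriv \<tau> ?\<delta> t)))\<^sup>2)
      \<le> ennreal (7776 * exp 8 * (\<tau> ^ 4 / \<rho>\<^sup>2)) * damped_integral \<rho> (\<lambda>t. (l2_norm \<Omega> (?f3 t))\<^sup>2)"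
    unfolding \<tau>4 f_eq by (rule order_trans[OF _ mult_right_mono[OF const]]) simp
  have "damped_integral \<rho> (\<lambda>t. (l2_norm \<Omega> ((local_deriv \<tau> ^^ 3) (recL \<tau> U) t))\<^sup>2)
      \<le> ennreal (1944 * exp 8 * (2\<^sup>2 / \<rho>\<^sup>2)) * damped_integral \<rho> (\<lambda>t. (N 2 t)\<^sup>2)"
  proof (rule damped_estimate[OF pos _ A(1) energy3])
    show "in_L2 \<Omega> ((local_deriv \<tau> ^^ 3) (recL \<tau> U) t) \<and> (AE x in lebesgue_on \<Omega>. (local_deriv \<tau> ^^ 3) (recL \<tau> U) t x
        = (\<lambda>s. 0) (t - of_int n * \<tau>) *\<^sub>R dquot \<tau> 3 W n x
        + (\<lambda>s. 1 / 2 + s / \<tau>) (t - of_int n * \<tau>) *\<^sub>R dquot \<tau> 3 W (n - 1) x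
        + (\<lambda>s. 1 / 2 - s / \<tau>) (t - of_int n * \<tau>) *\<^sub>R dquot \<tau> 3 W (n - 2) x)"
      if "\<lfloor>t / \<tau>\<rfloor> = n" for t n
      unfolding d3[OF that] using in_L2_lincomb[OF A(1) A(1)] by simp
    show "\<bar>(\<lambda>s. 0 :: real) s\<bar> \<le> 2 \<and> \<bar>(\<lambda>s. 1 / 2 + s / \<tau>) s\<bar> \<le> 2 \<and> \<bar>(\<lambda>s. 1 / 2 - s / \<tau>) s\<bar> \<le> (2::real)"
      if "0 \<le> s" "s \<le> \<tau>" for s
    proof -
      have "0 \<le> s / \<tau>" "s / \<tau> \<le> 1" using that pos(1) by auto
      then show ?thesis by (simp add: abs_le_iff)
    qed
  qed (use pos g[of 2] in \<open>auto intro: Ncont N0 l2_norm_nonneg\<close>)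
  then have 4: "damped_integral \<rho> (\<lambda>t. (l2_norm \<Omega> ((local_deriv \<tau> ^^ 3) (recL \<tau> U) t))\<^sup>2)
      \<le> ennreal (7776 * exp 8 * (1 / \<rho>\<^sup>2)) * damped_integral \<rho> (\<lambda>t. (l2_norm \<Omega> (?f2 t))\<^sup>2)"
    unfolding f_eq by simp
  show "let u = recR \<tau> U;
          w = recL \<tau> U;
          \<delta> = (\<lambda>t x. u t x - w t x);
          d\<delta> = local_deriv \<tau> \<delta>;
          d3w = (local_deriv \<tau> ^^ 3) w;
          f2 = (l2_deriv \<Omega> ^^ 2) f;
          f3 = (l2_deriv \<Omega> ^^ 3) f
      in
        damped_integral \<rho> (\<lambda>t. (l2_norm \<Omega> (d\<delta> t))\<^sup>2)
          \<le> ennreal (7776 * exp 8 * (\<tau> ^ 4 / \<rho>\<^sup>2)) * damped_integral \<rho> (\<lambda>t. (l2_norm \<Omega> (f2 t))\<^sup>2) \<and>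
        damped_integral \<rho> (\<lambda>t. (l2_norm \<Omega> (weak_grad \<Omega> (\<delta> t)))\<^sup>2)
          \<le> ennreal (7776 * exp 8 * (\<tau> ^ 4 / \<rho>\<^sup>2)) *
             damped_integral \<rho> (\<lambda>t. (l2_norm \<Omega> (f2 t))\<^sup>2 + \<tau>\<^sup>2 * (l2_norm \<Omega> (f3 t))\<^sup>2) \<and>
        damped_integral \<rho> (\<lambda>t. (l2_norm \<Omega> (weak_grad \<Omega> (d\<delta> t)))\<^sup>2)
          \<le> ennreal (7776 * exp 8 * (\<tau> ^ 4 / \<rho>\<^sup>2)) * damped_integral \<rho> (\<lambda>t. (l2_norm \<Omega> (f3 t))\<^sup>2) \<and>
        damped_integral \<rho> (\<lambda>t. (l2_norm \<Omega> (d3w t))\<^sup>2)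
          \<le> ennreal (7776 * exp 8 * (1 / \<rho>\<^sup>2)) * damped_integral \<rho> (\<lambda>t. (l2_norm \<Omega> (f2 t))\<^sup>2)"
    unfolding Let_def using 1 2 3 4 by blast
qed

end
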